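(* Let $G=(\mathcal V,\mathcal E)$ be a connected multigraph (with $|\mathcal V|\ge 2$) that is not a bipartite graph, and let $\mu\in\mathcal M(\mathcal V)$. The following properties are equivalent. (i) The measure $\mu$ is invariant for a reversible random walk on the edges of the multigraph $G$. (ii) The measure $\mu$ is a weighted measure, that is, there exist weights $\alpha=(\alpha_{i,j})_{(i,j)\in\mathcal E}$ such that for all $i\in\mathcal V$, $\mu(i)=\mu^\alpha(i)$. (iii) For any non-empty subset $U$ of $\mathcal V$ with $U\neq\mathcal V$, $\mu(U)<\mu(\mathcal E(U))$. (iv) For any independent set $\mathcal I$ of $G$, $\mu(\mathcal I)<\mu(\mathcal E(\mathcal I))$. (v) The measure $\bar\mu$ belongs to $\textsc{stab}(G,\textsc{fcfm})$, that is: if items arrive according to the distribution $\bar\mu$, then the general stochastic matching model $(G,\textsc{fcfm},\bar\mu)$ is stable. (vi) The continuous-time general stochastic matching model $(G,\textsc{fcfm},\mu)$ is stable.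
   Context: Multigraphs. A multigraph $G=(\mathcal V,\mathcal E)$ has a finite node set $\mathcal V$ and an edge set $\mathcal E\subset\mathcal V\times\mathcal V$ that is symmetric ($(u,v)\in\mathcal E\Rightarrow(v,u)\in\mathcal E$); self-loops $(v,v)$ are allowed, all edges are simple. A graph is a multigraph without self-loops. For $U\subset\mathcal V$, $\mathcal E(U)=\{v\in\mathcal V:\exists u\in U,\ (u,v)\in\mathcal E\}$ and $\mathcal E(u)=\mathcal E(\{u\})$. An independent set of $G$ is a non-empty $\mathcal I\subset\mathcal V$ such that $(i,j)\notin\mathcal E$ for all $(i,j)\in\mathcal I^2$. A graph is bipartite if its node set can be partitioned into two independent sets. Measures. $\mathcal M(A)$ is the set of positive measures with full support on the finite set $A$. For $\mu\in\mathcal M(\mathcal V)$, $\bar\mu=\mu/\mu(\mathcal V)$ is the normalized probability measure. A family of weights on $\mathcal E$ is a family of real numbers $\alpha=(\alpha_{i,j})_{(i,j)\in\mathcal E}$ with $\alpha_{i,j}=\alpha_{j,i}>0$ for all $(i,j)\in\mathcal E$; the associated weighted measure is $\mu^\alpha(i)=\sum_{j\in\mathcal E(i)}\alpha_{i,j}$, $i\in\mathcal V$. Random walks. A stochastic matrix $P=(P(i,j))_{(i,j)\in\mathcal V^2}$ defines a random walk on the edges of $G$ if $P(i,j)=0$ as soon as $(i,j)\notin\mathcal E$. It is reversible if the associated Markov chain admits a reversible invariant measure. General stochastic matching model, policy First Come, First Matched (FCFM). Items enter one by one at times $n\in\{1,2,\dots\}$; the class $V_n\in\mathcal V$ of the $n$-th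 item is drawn i.i.d. from $\bar\mu$. Two items of classes $i,j$ are compatible iff $(i,j)\in\mathcal E$. An arriving item is matched with the oldest stored item compatible with it, if there is any, and both leave immediately; otherwise it is stored. The system is represented by a Markov chain (recording the classes of the stored items in order of arrival). The model is stable if this chain is positive recurrent, and $\textsc{stab}(G,\textsc{fcfm})$ is the set of probability measures with full support on $\mathcal V$ for which this holds. The continuous-time model $(G,\textsc{fcfm},\mu)$ is defined in the same way except that arrivals of items of each class $i$ follow a Poisson process of intensity $\mu(i)$, independently of everything else; stability again means positive recurrence.
   Formalization: In (i), a random walk on the edges of G must have P(i,j)>0 on every edge, not only P(i,j)=0 off the edges; otherwise (i) does not imply (ii): on a triangle, the walk 1→2, 3→2, 2→1 or 3 (prob. 1/2 each) is reversible with μ=(1,2,1), violating (ii)–(iv). *)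

theory Defs
  imports "HOL-Probability.Probability"
begin

section \<open>Multigraphs\<close>

definition multigraph :: "'a set \<Rightarrow> ('a \<times> 'a) set \<Rightarrow> bool" where
  "multigraph V E \<longleftrightarrow> finite V \<and> E \<subseteq> V \<times> V \<and> sym E"

text \<open>For \<open>U \<subseteq> V\<close>, the neighbourhood of \<open>U\<close> is the relational image \<open>E `` U\<close>.\<close>

definition connected_multigraph :: "'a set \<Rightarrow> ('a \<times> 'a) set \<Rightarrow> bool" where
  "connected_multigraph V E \<longleftrightarrow> multigraph V E \<and> (\<forall>u\<in>V. \<forall>v\<in>V. (u, v) \<in> E\<^sup>*)"

definition independent_set :: "'a set \<Rightarrow> ('a \<times> 'a) set \<Rightarrow> 'a set \<Rightarrow> bool" where
  "independent_set V E I \<longleftrightarrow> I \<noteq> {} \<and> I \<subseteq> V \<and> (\<forall>i\<in>I. \<forall>j\<in>I. (i, j) \<notin> E)"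

definition simple_graph :: "'a set \<Rightarrow> ('a \<times> 'a) set \<Rightarrow> bool" where
  "simple_graph V E \<longleftrightarrow> multigraph V E \<and> irrefl E"

definition bipartite_graph :: "'a set \<Rightarrow> ('a \<times> 'a) set \<Rightarrow> bool" where
  "bipartite_graph V E \<longleftrightarrow> simple_graph V E \<and>
     (\<exists>A B. independent_set V E A \<and> independent_set V E B \<and> A \<inter> B = {} \<and> A \<union> B = V)"

section \<open>Measures and weights\<close>

text \<open>A measure on the finite set \<open>V\<close> is given by its point masses, so that the measure of
  \<open>U \<subseteq> V\<close> is \<open>sum \<mu> U\<close>; values of \<open>\<mu>\<close> outside \<open>V\<close> are never used.\<close>

definition full_support_measure :: "'a set \<Rightarrow> ('a \<Rightarrow> real) \<Rightarrow> bool" where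
  "full_support_measure V \<mu> \<longleftrightarrow> (\<forall>i\<in>V. 0 < \<mu> i)"

definition normalized :: "'a set \<Rightarrow> ('a \<Rightarrow> real) \<Rightarrow> 'a pmf" where
  "normalized V \<mu> = embed_pmf (\<lambda>i. if i \<in> V then \<mu> i / sum \<mu> V else 0)"

definition edge_weights :: "('a \<times> 'a) set \<Rightarrow> ('a \<Rightarrow> 'a \<Rightarrow> real) \<Rightarrow> bool" where
  "edge_weights E \<alpha> \<longleftrightarrow> (\<forall>(i, j)\<in>E. \<alpha> i j = \<alpha> j i \<and> 0 < \<alpha> i j)"

definition weighted_measure :: "('a \<times> 'a) set \<Rightarrow> ('a \<Rightarrow> 'a \<Rightarrow> real) \<Rightarrow> 'a \<Rightarrow> real" where
  "weighted_measure E \<alpha> i = (\<Sum>j\<in>E `` {i}. \<alpha> i j)"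

section \<open>Reversible random walks\<close>

definition stochastic_matrix :: "'a set \<Rightarrow> ('a \<Rightarrow> 'a \<Rightarrow> real) \<Rightarrow> bool" where
  "stochastic_matrix V P \<longleftrightarrow> (\<forall>i\<in>V. (\<forall>j\<in>V. 0 \<le> P i j) \<and> (\<Sum>j\<in>V. P i j) = 1)"

text \<open>The walk moves exactly along the edges: \<open>P\<close> vanishes off \<open>E\<close> and is positive on \<open>E\<close>.
  Positivity on the edges matters. On the triangle \<open>{1, 2, 3}\<close>, the walk that goes from 1 and
  from 3 to 2, and from 2 to 1 or 3 with probability 1/2 each, vanishes off the edges and is
  reversible with invariant measure \<open>(1, 2, 1)\<close>. This measure does not satisfy
  \<open>\<mu>({2}) < \<mu>({1, 3})\<close>, and it is not a weighted measure for positive weights.\<close>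

definition random_walk_on_edges :: "'a set \<Rightarrow> ('a \<times> 'a) set \<Rightarrow> ('a \<Rightarrow> 'a \<Rightarrow> real) \<Rightarrow> bool" where
  "random_walk_on_edges V E P \<longleftrightarrow>
     stochastic_matrix V P \<and> (\<forall>i\<in>V. \<forall>j\<in>V. P i j = 0 \<longleftrightarrow> (i, j) \<notin> E)"

definition invariant_measure :: "'a set \<Rightarrow> ('a \<Rightarrow> 'a \<Rightarrow> real) \<Rightarrow> ('a \<Rightarrow> real) \<Rightarrow> bool" where
  "invariant_measure V P \<nu> \<longleftrightarrow>
     (\<forall>i\<in>V. 0 \<le> \<nu> i) \<and> (\<exists>i\<in>V. 0 < \<nu> i) \<and> (\<forall>j\<in>V. (\<Sum>i\<in>V. \<nu> i * P i j) = \<nu> j)"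

definition reversible :: "'a set \<Rightarrow> ('a \<Rightarrow> 'a \<Rightarrow> real) \<Rightarrow> bool" where
  "reversible V P \<longleftrightarrow>
     (\<exists>\<nu>. invariant_measure V P \<nu> \<and> (\<forall>i\<in>V. \<forall>j\<in>V. \<nu> i * P i j = \<nu> j * P j i))"

section \<open>First come, first matched\<close>

text \<open>A state lists the classes of the stored items, oldest first. An arriving item of class \<open>v\<close>
  removes the oldest compatible item, or is appended at the end of the list if there is none.\<close>

fun fcfm_step :: "('a \<times> 'a) set \<Rightarrow> 'a list \<Rightarrow> 'a \<Rightarrow> 'a list" where
  "fcfm_step E [] v = [v]"
| "fcfm_step E (u # w) v = (if (u, v) \<in> E then w else u # fcfm_step E w v)"

text \<open>The possible states: no two stored items are compatible. These are exactly the states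
  that can be reached from the empty system.\<close>

definition fcfm_states :: "'a set \<Rightarrow> ('a \<times> 'a) set \<Rightarrow> 'a list set" where
  "fcfm_states V E = {w. set w \<subseteq> V \<and> sorted_wrt (\<lambda>u v. (u, v) \<notin> E) w}"

text \<open>\<open>X x n \<omega>\<close> is the state at time \<open>n\<close> of the chain started from \<open>x\<close>. The infimum is the first
  return time to \<open>x\<close>; it is \<open>\<infinity>\<close> if the chain does not return.\<close>

definition positive_recurrent ::
    "'w measure \<Rightarrow> 's set \<Rightarrow> ('s \<Rightarrow> nat \<Rightarrow> 'w \<Rightarrow> 's) \<Rightarrow> bool" where
  "positive_recurrent M S X \<longleftrightarrow>
     (\<forall>x\<in>S. (\<integral>\<^sup>+\<omega>. (INF n\<in>{n. 0 < n \<and> X x n \<omega> = x}. ennreal (real n)) \<partial>M) < \<infinity>)"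

text \<open>The continuous-time analogue, for right-continuous jump processes without absorbing states:
  the infimum is the first time the process is at \<open>x\<close> after having left \<open>x\<close>.\<close>

definition positive_recurrent_ct ::
    "'w measure \<Rightarrow> 's set \<Rightarrow> ('s \<Rightarrow> real \<Rightarrow> 'w \<Rightarrow> 's) \<Rightarrow> bool" where
  "positive_recurrent_ct M S X \<longleftrightarrow>
     (\<forall>x\<in>S. (\<integral>\<^sup>+\<omega>. (INF t\<in>{t. X x t \<omega> = x \<and> (\<exists>s. 0 \<le> s \<and> s < t \<and> X x s \<omega> \<noteq> x)}. ennreal t) \<partial>M)
        < \<infinity>)"

subsection \<open>Discrete time\<close>

text \<open>\<open>\<omega>\<close> is the i.i.d. sequence of classes of the arriving items.\<close>

definition fcfm_chain :: "('a \<times> 'a) set \<Rightarrow> 'a list \<Rightarrow> nat \<Rightarrow> 'a stream \<Rightarrow> 'a list" where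
  "fcfm_chain E w n \<omega> = foldl (fcfm_step E) w (stake n \<omega>)"

definition fcfm_stable :: "'a set \<Rightarrow> ('a \<times> 'a) set \<Rightarrow> 'a pmf \<Rightarrow> bool" where
  "fcfm_stable V E p \<longleftrightarrow>
     positive_recurrent (stream_space (measure_pmf p)) (fcfm_states V E) (fcfm_chain E)"

definition fcfm_stab :: "'a set \<Rightarrow> ('a \<times> 'a) set \<Rightarrow> 'a pmf set" where
  "fcfm_stab V E = {p. set_pmf p = V \<and> fcfm_stable V E p}"

subsection \<open>Continuous time\<close>

text \<open>Independent Poisson processes of intensities \<open>\<mu> i\<close>, \<open>i \<in> V\<close>, are given by independent
  interarrival times: \<open>\<omega> (i, k)\<close> is the time between the \<open>k\<close>-th and the \<open>(k+1)\<close>-st arrival of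
  class \<open>i\<close> (the first arrival time, if \<open>k = 0\<close>) and is exponential with parameter \<open>\<mu> i\<close>.\<close>

definition interarrival_space :: "'a set \<Rightarrow> ('a \<Rightarrow> real) \<Rightarrow> ('a \<times> nat \<Rightarrow> real) measure" where
  "interarrival_space V \<mu> =
     (\<Pi>\<^sub>M ik\<in>V \<times> UNIV. density lborel (\<lambda>x. ennreal (exponential_density (\<mu> (fst ik)) x)))"

definition arrival_time :: "('a \<times> nat \<Rightarrow> real) \<Rightarrow> 'a \<times> nat \<Rightarrow> real" where
  "arrival_time \<omega> ik = (\<Sum>l\<le>snd ik. \<omega> (fst ik, l))"

text \<open>The classes of all items arrived up to time \<open>t\<close>, in order of arrival. Almost surely there are
  finitely many of them and no two arrive simultaneously, so that the list is well defined.\<close>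

definition arrivals_until :: "'a set \<Rightarrow> ('a \<times> nat \<Rightarrow> real) \<Rightarrow> real \<Rightarrow> 'a list" where
  "arrivals_until V \<omega> t =
     map fst (sorted_key_list_of_set (arrival_time \<omega>) {ik \<in> V \<times> UNIV. arrival_time \<omega> ik \<le> t})"

definition fcfm_process ::
    "'a set \<Rightarrow> ('a \<times> 'a) set \<Rightarrow> 'a list \<Rightarrow> real \<Rightarrow> ('a \<times> nat \<Rightarrow> real) \<Rightarrow> 'a list" where
  "fcfm_process V E w t \<omega> = foldl (fcfm_step E) w (arrivals_until V \<omega> t)"

definition fcfm_stable_ct :: "'a set \<Rightarrow> ('a \<times> 'a) set \<Rightarrow> ('a \<Rightarrow> real) \<Rightarrow> bool" where
  "fcfm_stable_ct V E \<mu> \<longleftrightarrow>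
     positive_recurrent_ct (interarrival_space V \<mu>) (fcfm_states V E) (fcfm_process V E)"

end

theory Submission
  imports Defs
begin

text \<open>
  Everything is linked through one explicit object. Let \<open>p\<close> be the normalized measure. For a state
  \<open>w = w\<^sub>1 \<dots> w\<^sub>n\<close> put \<open>\<pi>(w) = \<Prod>l. p(w\<^sub>l) / p(E({w\<^sub>1, \<dots>, w\<^sub>l}))\<close>. For every state \<open>w\<close> and class
  \<open>u\<close>, consider the states obtained by inserting \<open>u\<close> somewhere in \<open>w\<close>. The rate at which, under \<open>\<pi>\<close>,
  the inserted item is matched, leaving \<open>w\<close>, is \<open>\<pi>(w) p(u)\<close> if \<open>u\<close> can be stored in state \<open>w\<close>, and 0
  otherwise: the contributions of the possible positions of \<open>u\<close> telescope (\<open>removal_balance_from\<close>).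
  Summed over \<open>u\<close>, this says that \<open>\<pi>\<close> is invariant for the matching chain; kept for each \<open>u\<close>
  separately, it says that as many items of class \<open>u\<close> leave the store as enter it.

  Call \<open>p\<close> expanding if \<open>p(I) < p(E(I))\<close> for every independent set \<open>I\<close>. An expanding \<open>p\<close> gives \<open>\<pi>\<close>
  finite mass: while the set \<open>A\<close> of stored classes stays the same, each further item multiplies the
  total weight by \<open>p(A - E(A)) / p(E(A)) < 1\<close> (\<open>weight_sum_bounded\<close>). Two consequences follow. By
  Kac's argument the mean return times are finite (\<open>mean_return_le\<close>). And the rates at which classes
  \<open>i\<close> and \<open>j\<close> are matched with each other under \<open>\<pi>\<close>, symmetrized and normalized, are positive
  weights with weighted measure \<open>p\<close>, because every item is matched exactly once
  (\<open>weights_if_expansion\<close>). The dynamics thus provide the weights that a flow argument would give.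

  Conversely, suppose that mean return times are finite but \<open>p(E(I)) \<le> p(I)\<close> for an independent set
  \<open>I\<close>. The number of stored items in \<open>I\<close> minus the number of those in \<open>E(I)\<close> then has nonnegative
  drift, and it is at most the length of the store, hence at most the mean time to empty it.
  Optional stopping makes it nonpositive wherever that mean time is finite, but it is 1 when a
  single item of \<open>I\<close> is stored (\<open>expansion_if_finite_returns\<close>).

  That weights force expansion is a double counting of edges; equality would split the nodes into
  two independent sets, and this is where the graph must not be bipartite
  (\<open>expansion_of_weighted_measure\<close>). Weights and reversible walks are the same thing via
  \<open>\<alpha> i j = \<mu> i * P i j\<close>, once the invariant measure is known to be unique up to a factor.

  Finally, the finiteness of mean return times is the same in discrete and in continuous time. Apart
  from the absence of explosion, it depends on two properties of the arrivals only: the first class has law \<open>p\<close> and is independent of all that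
  follows, and the first delay has a positive and finite mean (locale \<open>arrival_process\<close>). For a
  stream of independent classes this is clear; for independent Poisson processes it is the lack of
  memory of the exponential law (\<open>regenerate_box\<close>).
\<close>

section \<open>Weighted measures and reversible walks\<close>

lemma multigraphD:
  assumes "connected_multigraph V E"
  shows "finite V" "E \<subseteq> V \<times> V" "sym E"
  using assms by (auto simp: connected_multigraph_def multigraph_def)

text \<open>Connectedness is used in this form throughout: zero sets, equality cases and the like are
  shown to be closed under taking neighbours.\<close>

lemma connected_closed_eq:
  assumes "connected_multigraph V E" and "U \<subseteq> V" "U \<noteq> {}" and "E `` U \<subseteq> U"
  shows "U = V"
proof -
  obtain u where "u \<in> U" using assms by auto
  have "v \<in> U" if "v \<in> V" for v
  proof -
    have "(u, v) \<in> E\<^sup>*"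
      using assms \<open>u \<in> U\<close> that by (auto simp: connected_multigraph_def)
    then show ?thesis
      by (induction rule: rtrancl_induct) (use assms \<open>u \<in> U\<close> in auto)
  qed
  then show ?thesis using assms by auto
qed

lemma connected_neighbour:
  assumes "connected_multigraph V E" and "2 \<le> card V" and "v \<in> V"
  shows "\<exists>u\<in>V. (v, u) \<in> E"
proof (rule ccontr)
  assume "\<not> ?thesis"
  then have "E `` {v} = {}" using multigraphD[OF assms(1)] by auto
  then have "{v} = V"
    using connected_closed_eq[OF assms(1), of "{v}"] assms(3) by auto
  then show False using assms(2) by auto
qed

text \<open>Subtract from \<open>\<nu>\<close> the largest multiple of \<open>\<mu>\<close> that keeps the difference nonnegative. The
  difference is invariant and vanishes somewhere, and invariance spreads its zeros to neighbours.\<close>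

lemma invariant_measure_unique:
  assumes con: "connected_multigraph V E"
    and P: "random_walk_on_edges V E P"
    and \<mu>: "invariant_measure V P \<mu>" "\<forall>i\<in>V. 0 < \<mu> i"
    and \<nu>: "invariant_measure V P \<nu>"
  shows "\<exists>r>0. \<forall>i\<in>V. \<nu> i = r * \<mu> i"
proof -
  have fin: "finite V" and sy: "sym E" and sub: "E \<subseteq> V \<times> V"
    using multigraphD[OF con] by auto
  have ne: "V \<noteq> {}" using \<mu>(1) by (auto simp: invariant_measure_def)
  define r where "r = Min ((\<lambda>i. \<nu> i / \<mu> i) ` V)"
  define d where "d = (\<lambda>i. \<nu> i - r * \<mu> i)"
  have "r \<in> (\<lambda>i. \<nu> i / \<mu> i) ` V"
    unfolding r_def using fin ne by (intro Min_in) auto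
  then obtain k where k: "k \<in> V" "r = \<nu> k / \<mu> k" by auto
  have "d k = 0" using k \<mu>(2) by (auto simp: d_def)
  have d0: "0 \<le> d i" if "i \<in> V" for i
  proof -
    have "r \<le> \<nu> i / \<mu> i"
      unfolding r_def using fin that by (intro Min_le) auto
    then show ?thesis using \<mu>(2) that by (auto simp: d_def field_simps)
  qed
  have dP: "(\<Sum>i\<in>V. d i * P i j) = d j" if "j \<in> V" for j
  proof -
    have "(\<Sum>i\<in>V. d i * P i j) = (\<Sum>i\<in>V. \<nu> i * P i j) - r * (\<Sum>i\<in>V. \<mu> i * P i j)"
      by (simp add: d_def algebra_simps sum_subtractf sum_distrib_left)
    then show ?thesis
      using \<mu>(1) \<nu> that by (simp add: invariant_measure_def d_def)
  qed
  define U where "U = {i \<in> V. d i = 0}"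
  have "E `` U \<subseteq> U"
  proof
    fix i assume "i \<in> E `` U"
    then obtain j where j: "j \<in> U" "(j, i) \<in> E" by auto
    then have i: "i \<in> V" "j \<in> V" "(i, j) \<in> E" using sub sy by (auto simp: sym_def)
    have Pn: "0 \<le> P a j" if "a \<in> V" for a
      using P i that by (auto simp: random_walk_on_edges_def stochastic_matrix_def)
    have "(\<Sum>a\<in>V. d a * P a j) = 0"
      using dP[of j] i j by (auto simp: U_def)
    then have "d i * P i j = 0"
      using fin d0 Pn i by (subst (asm) sum_nonneg_eq_0_iff) auto
    moreover have "P i j \<noteq> 0"
      using P i by (auto simp: random_walk_on_edges_def)
    ultimately show "i \<in> U" using i by (auto simp: U_def)
  qed
  then have "U = V"
    using connected_closed_eq[OF con, of U] k \<open>d k = 0\<close> by (auto simp: U_def)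
  then have eq: "\<nu> i = r * \<mu> i" if "i \<in> V" for i
    using that by (auto simp: U_def d_def)
  obtain i where "i \<in> V" "0 < \<nu> i" using \<nu> by (auto simp: invariant_measure_def)
  then have "0 < r" using eq[of i] \<mu>(2) by (metis mult_less_0_iff not_less_iff_gr_or_eq
        zero_less_mult_iff)
  then show ?thesis using eq by auto
qed

text \<open>Reversibility is only assumed with respect to some invariant measure; uniqueness transfers
  the detailed balance to \<open>\<mu>\<close>, so that \<open>\<mu> i * P i j\<close> is symmetric.\<close>

lemma reversible_walk_iff_weighted:
  assumes con: "connected_multigraph V E" and ne: "V \<noteq> {}" and pos: "\<forall>i\<in>V. 0 < \<mu> i"
  shows "(\<exists>P. random_walk_on_edges V E P \<and> reversible V P \<and> invariant_measure V P \<mu>) \<longleftrightarrow>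
    (\<exists>\<alpha>. edge_weights E \<alpha> \<and> (\<forall>k\<in>V. \<mu> k = weighted_measure E \<alpha> k))"
    (is "?L \<longleftrightarrow> ?R")
proof
  have fin: "finite V" and sy: "sym E" and sub: "E \<subseteq> V \<times> V"
    using multigraphD[OF con] by auto
  {
    assume ?L
    then obtain P \<nu> where P: "random_walk_on_edges V E P" and \<mu>: "invariant_measure V P \<mu>"
      and \<nu>: "invariant_measure V P \<nu>"
      and rev: "\<And>i j. i \<in> V \<Longrightarrow> j \<in> V \<Longrightarrow> \<nu> i * P i j = \<nu> j * P j i"
      unfolding reversible_def by blast
    obtain r where r: "0 < r" "\<And>i. i \<in> V \<Longrightarrow> \<nu> i = r * \<mu> i"
      using invariant_measure_unique[OF con P \<mu> pos \<nu>] by auto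
    have sym\<mu>: "\<mu> i * P i j = \<mu> j * P j i" if "i \<in> V" "j \<in> V" for i j
      using rev[OF that] r that by auto
    have "0 < P i j" if "(i, j) \<in> E" for i j
    proof -
      have "i \<in> V" "j \<in> V" using that sub by auto
      moreover from this have "0 \<le> P i j" "P i j \<noteq> 0"
        using P that by (auto simp: random_walk_on_edges_def stochastic_matrix_def)
      ultimately show ?thesis by simp
    qed
    then have "edge_weights E (\<lambda>i j. \<mu> i * P i j)"
      unfolding edge_weights_def using sym\<mu> sub pos by fastforce
    moreover have "\<mu> k = weighted_measure E (\<lambda>i j. \<mu> i * P i j) k" if "k \<in> V" for k
    proof -
      have "(\<Sum>j\<in>E `` {k}. \<mu> k * P k j) = (\<Sum>j\<in>V. \<mu> k * P k j)"
        using P sub fin that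
        by (intro sum.mono_neutral_left) (auto simp: random_walk_on_edges_def)
      also have "\<dots> = \<mu> k * (\<Sum>j\<in>V. P k j)"
        by (simp add: sum_distrib_left)
      also have "\<dots> = \<mu> k"
        using P that by (simp add: random_walk_on_edges_def stochastic_matrix_def)
      finally show ?thesis by (simp add: weighted_measure_def)
    qed
    ultimately show ?R by blast
  }
  {
    assume ?R
    then obtain \<alpha> where \<alpha>: "edge_weights E \<alpha>" and \<mu>: "\<And>k. k \<in> V \<Longrightarrow> \<mu> k = weighted_measure E \<alpha> k"
      by auto
    define P where "P = (\<lambda>i j. if (i, j) \<in> E then \<alpha> i j / \<mu> i else 0)"
    have \<alpha>pos: "0 < \<alpha> i j" "\<alpha> i j = \<alpha> j i" if "(i, j) \<in> E" for i j
      using \<alpha> that by (auto simp: edge_weights_def)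
    have row: "(\<Sum>j\<in>V. P i j) = 1" if "i \<in> V" for i
    proof -
      have "(\<Sum>j\<in>V. P i j) = (\<Sum>j\<in>E `` {i}. P i j)"
        using fin sub by (intro sum.mono_neutral_right) (auto simp: P_def)
      also have "\<dots> = (\<Sum>j\<in>E `` {i}. \<alpha> i j / \<mu> i)"
        by (intro sum.cong) (auto simp: P_def)
      also have "\<dots> = weighted_measure E \<alpha> i / \<mu> i"
        by (simp add: weighted_measure_def sum_divide_distrib)
      also have "\<dots> = 1" using \<mu>[OF that] pos that by auto
      finally show ?thesis .
    qed
    have walk: "random_walk_on_edges V E P"
      unfolding random_walk_on_edges_def stochastic_matrix_def
      using row \<alpha>pos pos by (auto simp: P_def less_imp_le less_imp_neq[symmetric])
    have rev: "\<mu> i * P i j = \<mu> j * P j i" if "i \<in> V" "j \<in> V" for i j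
    proof (cases "(i, j) \<in> E")
      case True
      then have "(j, i) \<in> E" using sy by (auto simp: sym_def)
      then show ?thesis
        using True pos that \<alpha>pos(2)[OF True] by (auto simp: P_def less_imp_neq[symmetric])
    next
      case False
      then have "(j, i) \<notin> E" using sy by (auto simp: sym_def)
      then show ?thesis using False by (simp add: P_def)
    qed
    have inv: "invariant_measure V P \<mu>"
      unfolding invariant_measure_def
    proof (intro conjI ballI)
      fix j assume j: "j \<in> V"
      have "(\<Sum>i\<in>V. \<mu> i * P i j) = (\<Sum>i\<in>V. \<mu> j * P j i)"
        using rev j by (intro sum.cong) auto
      also have "\<dots> = \<mu> j" using row[OF j] by (simp add: sum_distrib_left[symmetric])
      finally show "(\<Sum>i\<in>V. \<mu> i * P i j) = \<mu> j" .
    qed (use pos ne in \<open>auto intro: less_imp_le\<close>)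
    then have "reversible V P" using rev by (auto simp: reversible_def)
    then show ?L using walk inv by blast
  }
qed

section \<open>Expansion conditions\<close>

text \<open>Every edge that leaves \<open>U\<close> is counted, with its weight, in the measure of \<open>E `` U\<close>. If
  nothing else is counted there, then \<open>E `` (E `` U) \<subseteq> U\<close>, and connectedness makes \<open>U\<close> and
  \<open>E `` U\<close> the two sides of a bipartition.\<close>

lemma expansion_of_weighted_measure:
  assumes con: "connected_multigraph V E" and card: "2 \<le> card V" and nb: "\<not> bipartite_graph V E"
    and \<alpha>: "edge_weights E \<alpha>" and \<mu>: "\<forall>k\<in>V. \<mu> k = weighted_measure E \<alpha> k"
    and U: "U \<subseteq> V" "U \<noteq> {}" "U \<noteq> V"
  shows "sum \<mu> U < sum \<mu> (E `` U)"
proof -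
  have fin: "finite V" and sy: "sym E" and sub: "E \<subseteq> V \<times> V"
    using multigraphD[OF con] by auto
  have \<alpha>pos: "0 < \<alpha> i j" "\<alpha> i j = \<alpha> j i" if "(i, j) \<in> E" for i j
    using \<alpha> that by (auto simp: edge_weights_def)
  define W where "W = E `` U"
  have "W \<subseteq> V" using sub by (auto simp: W_def)
  have finU: "finite U" and finW: "finite W"
    using U \<open>W \<subseteq> V\<close> fin by (auto intro: finite_subset)
  have finE: "finite (E `` X)" for X
    using sub fin by (rule_tac finite_subset[of _ V]) auto
  \<comment> \<open>\<open>A\<close> holds the pairs counted in the measure of \<open>U\<close>, \<open>B\<close> the reversed pairs counted in that of \<open>W\<close>.\<close>
  define e where "e = (\<lambda>(i, j). \<alpha> i j)"
  define A where "A = Sigma U (\<lambda>i. E `` {i})"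
  define B where "B = {(i, j). (j, i) \<in> Sigma W (\<lambda>j. E `` {j})}"
  have muU: "sum \<mu> U = sum e A"
    unfolding A_def e_def using finU finE \<mu> U
    by (subst sum.Sigma[symmetric]) (auto simp: weighted_measure_def intro!: sum.cong)
  have "sum \<mu> W = (\<Sum>(j, i)\<in>Sigma W (\<lambda>j. E `` {j}). \<alpha> j i)"
    using finW finE \<mu> \<open>W \<subseteq> V\<close>
    by (subst sum.Sigma[symmetric]) (auto simp: weighted_measure_def intro!: sum.cong)
  also have "\<dots> = (\<Sum>(j, i)\<in>Sigma W (\<lambda>j. E `` {j}). \<alpha> i j)"
  proof (intro sum.cong refl)
    fix x assume "x \<in> Sigma W (\<lambda>j. E `` {j})"
    then show "(case x of (j, i) \<Rightarrow> \<alpha> j i) = (case x of (j, i) \<Rightarrow> \<alpha> i j)"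
      using \<alpha>pos(2)[of "fst x" "snd x"] by (cases x) simp
  qed
  also have "\<dots> = sum e B"
    unfolding B_def e_def
    by (rule sum.reindex_bij_witness[where i = prod.swap and j = prod.swap]) auto
  finally have muW: "sum \<mu> W = sum e B" .
  have "A \<subseteq> B" unfolding A_def B_def W_def using sy by (auto simp: sym_def)
  have "B \<subseteq> E" unfolding B_def using sy by (auto simp: sym_def)
  have finB: "finite B" using \<open>B \<subseteq> E\<close> sub fin by (auto intro: finite_subset[of _ "V \<times> V"])
  have "A \<noteq> B"
  proof
    assume "A = B"
    have WU: "E `` W \<subseteq> U"
    proof
      fix i assume "i \<in> E `` W"
      then obtain j where "j \<in> W" "(j, i) \<in> E" by auto
      then have "(i, j) \<in> B" by (auto simp: B_def)
      then show "i \<in> U" using \<open>A = B\<close> by (auto simp: A_def)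
    qed
    have "U \<union> W = V"
      using WU U \<open>W \<subseteq> V\<close> by (intro connected_closed_eq[OF con]) (auto simp: W_def)
    have disj: "U \<inter> W = {}"
    proof (rule ccontr)
      assume "U \<inter> W \<noteq> {}"
      moreover have "E `` (U \<inter> W) \<subseteq> U \<inter> W" using WU by (auto simp: W_def)
      ultimately have "U \<inter> W = V"
        using U by (intro connected_closed_eq[OF con]) auto
      then show False using U by auto
    qed
    have "W \<noteq> {}" using connected_neighbour[OF con card] U by (fastforce simp: W_def)
    have "(i, j) \<notin> E" if "i \<in> U" "j \<in> U" for i j
      using that disj by (auto simp: W_def)
    then have iU: "independent_set V E U" using U by (auto simp: independent_set_def)
    have "(i, j) \<notin> E" if "i \<in> W" "j \<in> W" for i j
      using that disj WU by auto
    then have iW: "independent_set V E W"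
      using \<open>W \<noteq> {}\<close> \<open>W \<subseteq> V\<close> by (auto simp: independent_set_def)
    have "irrefl E"
    proof (rule irreflI)
      fix v show "(v, v) \<notin> E"
        using iU iW \<open>U \<union> W = V\<close> sub unfolding independent_set_def by blast
    qed
    then have "bipartite_graph V E"
      using iU iW disj \<open>U \<union> W = V\<close> con
      unfolding bipartite_graph_def simple_graph_def connected_multigraph_def by blast
    then show False using nb by simp
  qed
  then obtain x where "x \<in> B - A" using \<open>A \<subseteq> B\<close> by auto
  moreover have epos: "0 < e x" if "x \<in> E" for x
    using that \<alpha>pos(1) by (cases x) (auto simp: e_def)
  ultimately have "sum e A < sum e B"
    using \<open>B \<subseteq> E\<close>
    by (intro sum_strict_mono2[OF finB \<open>A \<subseteq> B\<close>, of x e]) (blast intro: less_imp_le)+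
  then show ?thesis using muU muW by (simp add: W_def)
qed

text \<open>The part of \<open>U\<close> that is covered by \<open>E `` U\<close> does not matter, and what remains of \<open>U\<close> is
  independent or empty. If it is empty, connectedness gives a neighbour outside \<open>U\<close>.\<close>

lemma expansion_iff_independent_expansion:
  fixes \<mu> :: "'a \<Rightarrow> real"
  assumes con: "connected_multigraph V E" and card: "2 \<le> card V" and pos: "\<forall>i\<in>V. 0 < \<mu> i"
  shows "(\<forall>U. U \<subseteq> V \<and> U \<noteq> {} \<and> U \<noteq> V \<longrightarrow> sum \<mu> U < sum \<mu> (E `` U)) \<longleftrightarrow>
    (\<forall>I. independent_set V E I \<longrightarrow> sum \<mu> I < sum \<mu> (E `` I))" (is "?L \<longleftrightarrow> ?R")
proof
  have fin: "finite V" and sy: "sym E" and sub: "E \<subseteq> V \<times> V"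
    using multigraphD[OF con] by auto
  have finE: "finite (E `` X)" for X
    using sub fin by (rule_tac finite_subset[of _ V]) auto
  {
    assume L: ?L
    show ?R
    proof (intro allI impI)
      fix I assume I: "independent_set V E I"
      then obtain i where "i \<in> I" "i \<in> V" by (auto simp: independent_set_def)
      then obtain j where "j \<in> V" "(i, j) \<in> E" using connected_neighbour[OF con card] by blast
      then have "I \<noteq> V" using I \<open>i \<in> I\<close> by (auto simp: independent_set_def)
      then show "sum \<mu> I < sum \<mu> (E `` I)" using L I by (auto simp: independent_set_def)
    qed
  }
  {
    assume R: ?R
    show ?L
    proof (intro allI impI)
      fix U assume U: "U \<subseteq> V \<and> U \<noteq> {} \<and> U \<noteq> V"
      have finU: "finite U" using U fin by (auto intro: finite_subset)
      define I where "I = U - E `` U"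
      show "sum \<mu> U < sum \<mu> (E `` U)"
      proof (cases "I = {}")
        case True
        then have "U \<subseteq> E `` U" by (auto simp: I_def)
        moreover have "U \<noteq> E `` U"
          using connected_closed_eq[OF con, of U] U by auto
        ultimately obtain j where j: "j \<in> E `` U - U" by auto
        have pos': "0 < \<mu> x" if "x \<in> E `` U" for x
          using that sub pos by auto
        show ?thesis
          by (rule sum_strict_mono2[OF finE \<open>U \<subseteq> E `` U\<close> j])
             (use j pos' in \<open>blast intro: less_imp_le\<close>)+
      next
        case False
        then have "independent_set V E I"
          using U by (auto simp: I_def independent_set_def)
        then have lt: "sum \<mu> I < sum \<mu> (E `` I)" using R by blast
        have "E `` I \<inter> U = {}" using sy by (auto simp: I_def sym_def)
        have "sum \<mu> U = sum \<mu> (U - I) + sum \<mu> I"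
          using finU by (intro sum.subset_diff) (auto simp: I_def)
        also have "\<dots> < sum \<mu> (U - I) + sum \<mu> (E `` I)" using lt by simp
        also have "\<dots> = sum \<mu> ((U - I) \<union> E `` I)"
          using finU finE \<open>E `` I \<inter> U = {}\<close> by (intro sum.union_disjoint[symmetric]) auto
        also have "\<dots> \<le> sum \<mu> (E `` U)"
        proof (intro sum_mono2 finE)
          show "0 \<le> \<mu> x" if "x \<in> E `` U - (U - I \<union> E `` I)" for x
            using that sub pos by (intro less_imp_le) auto
        qed (auto simp: I_def)
        finally show ?thesis .
      qed
    qed
  }
qed

section \<open>Sums over words\<close>

definition words :: "'a set \<Rightarrow> nat \<Rightarrow> 'a list set" where
  "words V m = {w. set w \<subseteq> V \<and> length w = m}"

lemma finite_words: "finite V \<Longrightarrow> finite (words V m)"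
  unfolding words_def by (rule finite_lists_length_eq)

lemma sum_words_0 [simp]: "(\<Sum>w\<in>words V 0. f w) = f []"
proof -
  have "words V 0 = {[]}" by (auto simp: words_def)
  then show ?thesis by simp
qed

lemma sum_words_Suc:
  fixes f :: "'a list \<Rightarrow> real"
  assumes "finite V"
  shows "(\<Sum>w\<in>words V (Suc m). f w) = (\<Sum>v\<in>V. \<Sum>w\<in>words V m. f (v # w))"
proof -
  have "words V (Suc m) = (\<lambda>(v, w). v # w) ` (V \<times> words V m)"
    by (auto simp: words_def length_Suc_conv image_iff)
  then have "(\<Sum>w\<in>words V (Suc m). f w) = (\<Sum>(v, w)\<in>V \<times> words V m. f (v # w))"
    by (simp add: sum.reindex inj_on_def case_prod_unfold)
  then show ?thesis by (simp add: sum.cartesian_product)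
qed

section \<open>The product-form measure\<close>

locale fcfm_model =
  fixes V :: "'a set" and E :: "('a \<times> 'a) set" and p :: "'a \<Rightarrow> real"
  assumes connected: "connected_multigraph V E"
    and card_ge_2: "2 \<le> card V"
    and p_pos: "\<And>i. i \<in> V \<Longrightarrow> 0 < p i"
    and sum_p: "sum p V = 1"
begin

lemma finite_V: "finite V" and sym_E: "sym E" and E_subset: "E \<subseteq> V \<times> V"
  using multigraphD[OF connected] by auto

lemma E_sym: "(i, j) \<in> E \<longleftrightarrow> (j, i) \<in> E"
  using sym_E by (auto simp: sym_def)

lemma nbr_subset: "E `` A \<subseteq> V"
  using E_subset by auto

lemma finite_nbr: "finite (E `` A)"
  using finite_subset[OF nbr_subset finite_V] .

definition nbr_mass :: "'a set \<Rightarrow> real" where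
  "nbr_mass A = sum p (E `` A)"

lemma nbr_mass_empty [simp]: "nbr_mass {} = 0"
  by (simp add: nbr_mass_def)

lemma p_nonneg: "i \<in> V \<Longrightarrow> 0 \<le> p i"
  using p_pos less_imp_le by blast

lemma nbr_mass_nonneg: "0 \<le> nbr_mass A"
  unfolding nbr_mass_def using nbr_subset by (intro sum_nonneg p_nonneg) auto

lemma nbr_mass_le_1: "nbr_mass A \<le> 1"
  unfolding nbr_mass_def sum_p[symmetric]
  using nbr_subset finite_V p_nonneg by (intro sum_mono2) auto

lemma nbr_mass_pos:
  assumes "v \<in> A" "v \<in> V"
  shows "0 < nbr_mass A"
proof -
  obtain u where "u \<in> V" "(v, u) \<in> E"
    using connected_neighbour[OF connected card_ge_2 assms(2)] by auto
  then have "E `` A \<noteq> {}" using assms by auto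
  then show ?thesis
    unfolding nbr_mass_def using finite_nbr nbr_subset p_pos by (intro sum_pos) auto
qed

lemma nbr_mass_insert: "nbr_mass (insert u A) = nbr_mass A + sum p (E `` {u} - E `` A)"
proof -
  have "E `` insert u A = E `` A \<union> (E `` {u} - E `` A)" by auto
  then show ?thesis
    unfolding nbr_mass_def using finite_nbr
    by (simp only: sum.union_disjoint finite_Diff Diff_disjoint)
qed

text \<open>The weight of a word is built from its oldest item on, and the set \<open>A\<close> of classes that have
  already been read is the only memory needed. So \<open>weight {} w\<close> is the product-form measure of the
  state \<open>w\<close>, and it is 0 on words that are not states, which allows sums over all words.\<close>

definition factor :: "'a set \<Rightarrow> 'a \<Rightarrow> real" where
  "factor A v = (if v \<in> V - E `` A then p v / nbr_mass (insert v A) else 0)"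

fun weight :: "'a set \<Rightarrow> 'a list \<Rightarrow> real" where
  "weight A [] = 1"
| "weight A (v # w) = factor A v * weight (insert v A) w"

lemma factor_nonneg: "0 \<le> factor A v"
  using p_nonneg nbr_mass_nonneg by (auto simp: factor_def)

lemma weight_nonneg: "0 \<le> weight A w"
  by (induction w arbitrary: A) (auto simp: factor_nonneg)

lemma weight_pos:
  assumes "set w \<subseteq> V" "sorted_wrt (\<lambda>u v. (u, v) \<notin> E) w" "\<forall>v\<in>set w. v \<notin> E `` A"
  shows "0 < weight A w"
  using assms
proof (induction w arbitrary: A)
  case (Cons v w)
  have "0 < factor A v"
    using Cons.prems p_pos[of v] nbr_mass_pos[of v "insert v A"] by (auto simp: factor_def)
  moreover have "0 < weight (insert v A) w"
    using Cons.prems by (intro Cons.IH) auto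
  ultimately show ?case by simp
qed simp

lemma factor_times_mass: "factor A u * nbr_mass (insert u A) = (if u \<in> V - E `` A then p u else 0)"
  using nbr_mass_pos[of u "insert u A"] by (auto simp: factor_def)

text \<open>Up to a factor for the classes read so far, the weight does not see the order of two
  adjacent items. This is what makes the sum over insertion positions telescope.\<close>

lemma weight_exchange:
  "nbr_mass (insert u A) * weight A (u # v # w) = nbr_mass (insert v A) * weight A (v # u # w)"
proof -
  have key: "nbr_mass (insert u A) * (factor A u * factor (insert u A) v) =
      nbr_mass (insert v A) * (factor A v * factor (insert v A) u)"
  proof (cases "u \<in> V - E `` A \<and> v \<in> V - E `` A")
    case True
    have "v \<in> E `` insert u A \<longleftrightarrow> (u, v) \<in> E" "u \<in> E `` insert v A \<longleftrightarrow> (u, v) \<in> E"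
      using True E_sym by auto
    moreover have "nbr_mass (insert u A) \<noteq> 0" "nbr_mass (insert v A) \<noteq> 0"
      using True nbr_mass_pos[of u "insert u A"] nbr_mass_pos[of v "insert v A"] by auto
    ultimately show ?thesis using True by (simp add: factor_def insert_commute)
  next
    case False
    then have "factor A u * factor (insert u A) v = 0" "factor A v * factor (insert v A) u = 0"
      by (auto simp: factor_def)
    then show ?thesis by (simp only: mult_zero_right)
  qed
  have "nbr_mass (insert u A) * weight A (u # v # w) =
      (nbr_mass (insert u A) * (factor A u * factor (insert u A) v)) * weight (insert v (insert u A)) w"
    by simp
  also have "\<dots> = nbr_mass (insert v A) * weight A (v # u # w)"
    by (simp add: key insert_commute[of v u])
  finally show ?thesis .
qed

subsection \<open>Balance of removals and arrivals\<close>

text \<open>The value of \<open>F\<close> at the class of the item that an arriving \<open>c\<close> removes and at the remaining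
  word, and 0 if \<open>c\<close> is stored instead. Keeping the removed class as an argument of \<open>F\<close> allows the
  same identity to be used for the balance equation and for the matching rates.\<close>

fun matched :: "('a \<Rightarrow> 'a list \<Rightarrow> real) \<Rightarrow> 'a list \<Rightarrow> 'a \<Rightarrow> real" where
  "matched F [] c = 0"
| "matched F (u # w) c = (if (u, c) \<in> E then F u w else matched (\<lambda>x y. F x (u # y)) w c)"

lemma matched_eq_0: "c \<notin> E `` set z \<Longrightarrow> matched F z c = 0"
  by (induction z arbitrary: F) auto

lemma matched_step: "c \<in> E `` set z \<Longrightarrow> matched (\<lambda>u. f) z c = f (fcfm_step E z c)"
  by (induction z arbitrary: f) auto

lemma step_append: "c \<notin> E `` set z \<Longrightarrow> fcfm_step E z c = z @ [c]"
  by (induction z) auto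

lemma matched_const: "matched (\<lambda>u w. k) z c = (if c \<in> E `` set z then k else 0)"
  by (induction z) auto

lemma matched_nonneg: "(\<And>u w. 0 \<le> F u w) \<Longrightarrow> 0 \<le> matched F z c"
  by (induction z arbitrary: F) auto

lemma matched_sum: "(\<Sum>j\<in>J. matched (F j) z c) = matched (\<lambda>u w. \<Sum>j\<in>J. F j u w) z c"
  by (induction z arbitrary: F) auto

lemma matched_cong:
  "(\<And>u w. (u, c) \<in> E \<Longrightarrow> u \<in> set z \<Longrightarrow> F u w = G u w) \<Longrightarrow> matched F z c = matched G z c"
proof (induction z arbitrary: F G)
  case (Cons a z)
  have "matched (\<lambda>x y. F x (a # y)) z c = matched (\<lambda>x y. G x (a # y)) z c"
    by (rule Cons.IH) (simp add: Cons.prems)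
  then show ?case using Cons.prems[of a z] by simp
qed simp

text \<open>The telescoping identity, for words that are read after the classes in \<open>A\<close>. The left side
  weighs the words from which an item is removed, the right side the words that remain. In the term
  that is subtracted \<open>u\<close> is in front of \<open>w\<close>: it is the end of the telescoping sum, and it disappears for
  \<open>A = {}\<close>. In the induction step the first item of the word either is the one that is
  removed or becomes a member of \<open>A\<close>.\<close>

lemma removal_balance_from:
  "(\<Sum>z\<in>words V (Suc m). weight A z * (\<Sum>c\<in>V - E `` A. p c * matched F z c)) =
   (\<Sum>w\<in>words V m. \<Sum>u\<in>V. F u w *
      (weight A w * (if u \<in> E `` (A \<union> set w) then 0 else p u) - nbr_mass A * weight A (u # w)))"
proof (induction m arbitrary: A F)
  case 0
  have sumc: "(\<Sum>c\<in>V - E `` A. p c * (if (u, c) \<in> E then F u [] else 0)) =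
      (nbr_mass (insert u A) - nbr_mass A) * F u []" for u
  proof -
    have "(\<Sum>c\<in>V - E `` A. p c * (if (u, c) \<in> E then F u [] else 0)) =
      (\<Sum>c\<in>E `` {u} - E `` A. p c * F u [])"
      using finite_V E_subset by (intro sum.mono_neutral_cong_right) auto
    then show ?thesis by (simp add: nbr_mass_insert sum_distrib_right)
  qed
  have eq: "factor A u * ((nbr_mass (insert u A) - nbr_mass A) * F u []) =
      F u [] * ((if u \<in> E `` A then 0 else p u) - nbr_mass A * factor A u)" if "u \<in> V" for u
  proof -
    have "factor A u * ((nbr_mass (insert u A) - nbr_mass A) * F u []) =
      F u [] * (factor A u * nbr_mass (insert u A) - nbr_mass A * factor A u)"
      by (simp add: algebra_simps)
    also have "\<dots> = F u [] * ((if u \<in> V - E `` A then p u else 0) - nbr_mass A * factor A u)"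
      by (simp only: factor_times_mass)
    finally show ?thesis using that by (simp split: if_splits)
  qed
  have single: "matched F [u] c = (if (u, c) \<in> E then F u [] else 0)" for u c
    by simp
  have "(\<Sum>z\<in>words V (Suc 0). weight A z * (\<Sum>c\<in>V - E `` A. p c * matched F z c)) =
      (\<Sum>u\<in>V. factor A u * ((nbr_mass (insert u A) - nbr_mass A) * F u []))"
    by (simp add: sum_words_Suc[OF finite_V] sumc single del: matched.simps)
  also have "\<dots> = (\<Sum>u\<in>V. F u [] * ((if u \<in> E `` A then 0 else p u) - nbr_mass A * factor A u))"
    by (rule sum.cong[OF refl eq])
  finally show ?case by simp
next
  case (Suc m)
  let ?g = "\<lambda>A w u. weight A w * (if u \<in> E `` (A \<union> set w) then 0 else p u)"
  have sumc: "(\<Sum>c\<in>V - E `` A. p c * matched F (v # w) c) =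
      (nbr_mass (insert v A) - nbr_mass A) * F v w +
      (\<Sum>c\<in>V - E `` insert v A. p c * matched (\<lambda>x y. F x (v # y)) w c)" for v w
  proof -
    have un: "V - E `` A = (E `` {v} - E `` A) \<union> (V - E `` insert v A)"
    proof -
      have gen: "V - X = (S - X) \<union> (V - (S \<union> X))" if "S \<subseteq> V" for S X
        using that by blast
      have im: "E `` insert v A = E `` {v} \<union> E `` A" by blast
      show ?thesis unfolding im by (rule gen[OF nbr_subset])
    qed
    have "(\<Sum>c\<in>V - E `` A. p c * matched F (v # w) c) =
       (\<Sum>c\<in>E `` {v} - E `` A. p c * matched F (v # w) c) +
       (\<Sum>c\<in>V - E `` insert v A. p c * matched F (v # w) c)"
      unfolding un using finite_V finite_nbr
      by (intro sum.union_disjoint) auto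
    also have "(\<Sum>c\<in>E `` {v} - E `` A. p c * matched F (v # w) c) =
       (nbr_mass (insert v A) - nbr_mass A) * F v w"
      by (simp add: nbr_mass_insert sum_distrib_right)
    also have "(\<Sum>c\<in>V - E `` insert v A. p c * matched F (v # w) c) =
       (\<Sum>c\<in>V - E `` insert v A. p c * matched (\<lambda>x y. F x (v # y)) w c)"
      by (intro sum.cong) auto
    finally show ?thesis .
  qed
  define S where "S = (\<lambda>v w. \<Sum>c\<in>V - E `` insert v A. p c * matched (\<lambda>x y. F x (v # y)) w c)"
  have "(\<Sum>z\<in>words V (Suc (Suc m)). weight A z * (\<Sum>c\<in>V - E `` A. p c * matched F z c)) =
     (\<Sum>v\<in>V. \<Sum>w\<in>words V (Suc m). factor A v * weight (insert v A) w *
        ((nbr_mass (insert v A) - nbr_mass A) * F v w + S v w))"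
    by (simp only: sum_words_Suc[OF finite_V, of _ "Suc m"] sumc weight.simps S_def)
  also have "\<dots> = (\<Sum>v\<in>V. \<Sum>w\<in>words V (Suc m). (nbr_mass (insert v A) - nbr_mass A) * weight A (v # w) * F v w) +
     (\<Sum>v\<in>V. factor A v * (\<Sum>w\<in>words V (Suc m). weight (insert v A) w * S v w))"
    unfolding sum_distrib_left sum.distrib[symmetric]
    by (intro sum.cong refl) (simp add: algebra_simps)
  also have "(\<Sum>v\<in>V. \<Sum>w\<in>words V (Suc m). (nbr_mass (insert v A) - nbr_mass A) * weight A (v # w) * F v w) =
     (\<Sum>w\<in>words V (Suc m). \<Sum>u\<in>V. (nbr_mass (insert u A) - nbr_mass A) * weight A (u # w) * F u w)"
    by (rule sum.swap)
  also have "(\<Sum>v\<in>V. factor A v * (\<Sum>w\<in>words V (Suc m). weight (insert v A) w * S v w)) =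
     (\<Sum>v\<in>V. factor A v * (\<Sum>w\<in>words V m. \<Sum>u\<in>V. F u (v # w) *
        (?g (insert v A) w u - nbr_mass (insert v A) * weight (insert v A) (u # w))))"
    by (simp only: S_def Suc.IH)
  also have "\<dots> = (\<Sum>v\<in>V. \<Sum>w\<in>words V m. \<Sum>u\<in>V. F u (v # w) *
        (?g A (v # w) u - nbr_mass (insert v A) * weight A (v # u # w)))"
    unfolding sum_distrib_left by (intro sum.cong refl) (simp add: algebra_simps)
  also have "\<dots> = (\<Sum>v\<in>V. \<Sum>w\<in>words V m. \<Sum>u\<in>V. F u (v # w) *
        (?g A (v # w) u - nbr_mass (insert u A) * weight A (u # v # w)))"
    by (simp only: weight_exchange)
  also have "\<dots> = (\<Sum>w\<in>words V (Suc m). \<Sum>u\<in>V. F u w *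
        (?g A w u - nbr_mass (insert u A) * weight A (u # w)))"
    by (simp only: sum_words_Suc[OF finite_V])
  also have "(\<Sum>w\<in>words V (Suc m). \<Sum>u\<in>V. (nbr_mass (insert u A) - nbr_mass A) * weight A (u # w) * F u w) +
     (\<Sum>w\<in>words V (Suc m). \<Sum>u\<in>V. F u w * (?g A w u - nbr_mass (insert u A) * weight A (u # w))) =
     (\<Sum>w\<in>words V (Suc m). \<Sum>u\<in>V. F u w * (?g A w u - nbr_mass A * weight A (u # w)))"
    unfolding sum.distrib[symmetric]
    by (intro sum.cong refl) (simp add: algebra_simps split del: if_split)
  finally show ?case .
qed

lemma removal_balance:
  "(\<Sum>z\<in>words V (Suc m). weight {} z * (\<Sum>c\<in>V. p c * matched F z c)) =
   (\<Sum>w\<in>words V m. weight {} w * (\<Sum>u\<in>V - E `` set w. p u * F u w))"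
proof -
  have "(\<Sum>u\<in>V. F u w * (weight {} w * (if u \<in> E `` set w then 0 else p u))) =
     weight {} w * (\<Sum>u\<in>V - E `` set w. p u * F u w)" for w
    unfolding sum_distrib_left using finite_V by (intro sum.mono_neutral_cong_right) auto
  then show ?thesis
    using removal_balance_from[where m = m and A = "{}" and F = F] by simp
qed

text \<open>Storing \<open>c\<close> after \<open>z\<close> multiplies the weight by \<open>p c / nbr_mass (A \<union> set (z @ [c]))\<close>.\<close>

lemma arrival_balance_from:
  "(\<Sum>z\<in>words V m. weight A z * (\<Sum>c\<in>V - E `` (A \<union> set z). p c * f (z @ [c]))) =
   (\<Sum>w\<in>words V (Suc m). weight A w * nbr_mass (A \<union> set w) * f w)"
proof (induction m arbitrary: A f)
  case 0
  have "(\<Sum>c\<in>V - E `` A. p c * f [c]) = (\<Sum>c\<in>V. factor A c * nbr_mass (insert c A) * f [c])"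
    using finite_V by (intro sum.mono_neutral_cong_left) (auto simp: factor_times_mass)
  then show ?case by (simp add: sum_words_Suc[OF finite_V])
next
  case (Suc m)
  have "(\<Sum>z\<in>words V (Suc m). weight A z * (\<Sum>c\<in>V - E `` (A \<union> set z). p c * f (z @ [c]))) =
    (\<Sum>v\<in>V. factor A v * (\<Sum>z\<in>words V m. weight (insert v A) z *
      (\<Sum>c\<in>V - E `` (insert v A \<union> set z). p c * f (v # z @ [c]))))"
    by (simp add: sum_words_Suc[OF finite_V] sum_distrib_left mult.assoc)
  also have "\<dots> = (\<Sum>v\<in>V. factor A v * (\<Sum>w\<in>words V (Suc m). weight (insert v A) w *
      nbr_mass (insert v A \<union> set w) * f (v # w)))"
    by (simp only: Suc.IH[where f = "\<lambda>w. f (v # w)" for v])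
  also have "\<dots> = (\<Sum>w\<in>words V (Suc (Suc m)). weight A w * nbr_mass (A \<union> set w) * f w)"
    by (simp add: sum_words_Suc[OF finite_V, of _ "Suc m"] sum_distrib_left mult.assoc)
  finally show ?case .
qed

lemma step_sum_split:
  "(\<Sum>c\<in>V. p c * f (fcfm_step E z c)) =
   (\<Sum>c\<in>V. p c * matched (\<lambda>u. f) z c) + (\<Sum>c\<in>V - E `` set z. p c * f (z @ [c]))"
proof -
  have "(\<Sum>c\<in>V. p c * f (fcfm_step E z c)) =
    (\<Sum>c\<in>V. p c * matched (\<lambda>u. f) z c + (if c \<in> V - E `` set z then p c * f (z @ [c]) else 0))"
    by (intro sum.cong) (auto simp: matched_eq_0 matched_step step_append)
  then show ?thesis
    unfolding sum.distrib using finite_V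
    by (simp add: sum.If_cases Int_def set_diff_eq)
qed

definition level_sum :: "('a list \<Rightarrow> real) \<Rightarrow> nat \<Rightarrow> real" where
  "level_sum f m = (\<Sum>w\<in>words V m. weight {} w * f w)"

text \<open>The invariance of the product-form measure, truncated to words of bounded length so that
  only finite sums occur. Only an inequality survives the truncation, and it suffices for bounding
  mean return times.\<close>

lemma product_form_excessive:
  assumes f: "\<And>w. 0 \<le> f w"
  shows "(\<Sum>m\<le>N. level_sum (\<lambda>z. \<Sum>c\<in>V. p c * f (fcfm_step E z c)) m) \<le> (\<Sum>m\<le>Suc N. level_sum f m)"
proof -
  \<comment> \<open>The inflow into a word splits into storage of its last item, with rate \<open>nbr_mass (set w)\<close>, and
    removals, with the complementary rate.\<close>
  define a where "a = level_sum (\<lambda>w. nbr_mass (set w) * f w)"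
  define b where "b = level_sum (\<lambda>w. (1 - nbr_mass (set w)) * f w)"
  have ab: "level_sum f m = a m + b m" for m
    unfolding a_def b_def level_sum_def sum.distrib[symmetric]
    by (intro sum.cong) (auto simp: algebra_simps)
  have "a 0 = 0" by (simp add: a_def level_sum_def)
  have b0: "0 \<le> b m" for m
    unfolding b_def level_sum_def using f nbr_mass_le_1 weight_nonneg by (intro sum_nonneg) auto
  define r where "r = level_sum (\<lambda>z. \<Sum>c\<in>V. p c * matched (\<lambda>u. f) z c)"
  have r0: "r 0 = 0" by (simp add: r_def level_sum_def)
  have compl: "(\<Sum>u\<in>V - E `` set w. p u * f w) = (1 - nbr_mass (set w)) * f w" for w
    using sum_diff[OF finite_V nbr_subset, of p "set w"]
    by (simp add: sum_p nbr_mass_def flip: sum_distrib_right)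
  have rS: "r (Suc m) = b m" for m
    unfolding r_def b_def level_sum_def removal_balance compl ..
  have level: "level_sum (\<lambda>z. \<Sum>c\<in>V. p c * f (fcfm_step E z c)) m = r m + a (Suc m)" for m
    using arrival_balance_from[where m = m and A = "{}" and f = f]
    by (simp add: step_sum_split level_sum_def r_def a_def distrib_left sum.distrib mult.assoc)
  have "(\<Sum>m\<le>N. r m) \<le> (\<Sum>m\<le>Suc N. b m)"
  proof -
    have "(\<Sum>m\<le>N. r m) \<le> (\<Sum>m\<le>Suc N. r m)" using b0 rS by simp
    also have "\<dots> = (\<Sum>m\<le>N. b m)" by (simp add: sum.atMost_Suc_shift r0 rS del: sum.atMost_Suc)
    also have "\<dots> \<le> (\<Sum>m\<le>Suc N. b m)" using b0 by simp
    finally show ?thesis .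
  qed
  moreover have "(\<Sum>m\<le>N. a (Suc m)) = (\<Sum>m\<le>Suc N. a m)"
    by (simp add: sum.atMost_Suc_shift \<open>a 0 = 0\<close> del: sum.atMost_Suc)
  ultimately show ?thesis by (simp only: level ab sum.distrib)
qed


subsection \<open>Summability\<close>

lemma weight_sum_Suc:
  "(\<Sum>m\<le>Suc N. \<Sum>w\<in>words V m. weight A w) =
   1 + (\<Sum>v\<in>V. factor A v * (\<Sum>m\<le>N. \<Sum>w\<in>words V m. weight (insert v A) w))"
proof -
  have "(\<Sum>m\<le>N. \<Sum>w\<in>words V (Suc m). weight A w) =
      (\<Sum>v\<in>V. \<Sum>m\<le>N. \<Sum>w\<in>words V m. factor A v * weight (insert v A) w)"
    by (simp only: sum_words_Suc[OF finite_V] weight.simps) (rule sum.swap)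
  then show ?thesis
    by (simp add: sum.atMost_Suc_shift sum_distrib_left del: sum.atMost_Suc)
qed

lemma independent_unmatched:
  assumes "A \<subseteq> V" "A - E `` A \<noteq> {}"
  shows "independent_set V E (A - E `` A)"
  using assms by (auto simp: independent_set_def)

definition expanding :: bool where
  "expanding \<longleftrightarrow> (\<forall>I. independent_set V E I \<longrightarrow> sum p I < sum p (E `` I))"

text \<open>The factors with \<open>v \<in> A\<close> do not enlarge the set of classes. Their sum is
  \<open>p(A - E(A)) / p(E(A))\<close>, and \<open>A - E(A)\<close> is independent or empty.\<close>

lemma stay_factor_less_1:
  assumes exp: expanding
    and A: "A \<subseteq> V"
  shows "(\<Sum>v\<in>A. factor A v) < 1"
proof (cases "A - E `` A = {}")
  case True
  then have "factor A v = 0" if "v \<in> A" for v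
    using that by (auto simp: factor_def)
  then show ?thesis by simp
next
  case False
  have finA: "finite A" using A finite_V by (rule finite_subset)
  have "(\<Sum>v\<in>A. factor A v) = (\<Sum>v\<in>A - E `` A. p v / nbr_mass A)"
    using A finA by (intro sum.mono_neutral_cong_right) (auto simp: factor_def insert_absorb)
  also have "\<dots> = sum p (A - E `` A) / nbr_mass A"
    by (simp add: sum_divide_distrib)
  also have "\<dots> < 1"
  proof -
    have "sum p (A - E `` A) < sum p (E `` (A - E `` A))"
      using exp independent_unmatched[OF A False] unfolding expanding_def by blast
    also have "\<dots> \<le> nbr_mass A"
      unfolding nbr_mass_def using nbr_subset p_nonneg
      by (intro sum_mono2 finite_nbr) auto
    finally show ?thesis
      using nbr_mass_nonneg[of A] sum_nonneg[of "A - E `` A" p] p_nonneg A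
      by (simp add: divide_less_eq_1 subset_iff)
  qed
  finally show ?thesis .
qed

text \<open>Induction on the number of classes that are not yet in \<open>A\<close>: a new class leads to a bounded
  sum, and repeating classes of \<open>A\<close> costs a factor below 1.\<close>

lemma weight_sum_bounded:
  assumes exp: expanding
    and A: "A \<subseteq> V"
  shows "\<exists>K. \<forall>N. (\<Sum>m\<le>N. \<Sum>w\<in>words V m. weight A w) \<le> K"
  using A
proof (induction "card (V - A)" arbitrary: A rule: less_induct)
  case less
  let ?S = "\<lambda>B N. \<Sum>m\<le>N. \<Sum>w\<in>words V m. weight B w"
  have "\<exists>K. \<forall>N. ?S (insert v A) N \<le> K" if v: "v \<in> V - A" for v
  proof (rule less.hyps)
    show "card (V - insert v A) < card (V - A)"
      using v finite_V by (intro psubset_card_mono) auto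
    show "insert v A \<subseteq> V" using v less.prems by auto
  qed
  then obtain K where K: "\<And>v N. v \<in> V - A \<Longrightarrow> ?S (insert v A) N \<le> K v"
    by metis
  define r where "r = (\<Sum>v\<in>A. factor A v)"
  define D where "D = (\<Sum>v\<in>V - A. factor A v * K v)"
  \<comment> \<open>the fixed point of \<open>C \<mapsto> 1 + D + r C\<close>, raised to 1 for the start of the induction on \<open>N\<close>\<close>
  define C where "C = max 1 ((1 + D) / (1 - r))"
  have r: "r < 1"
    unfolding r_def using stay_factor_less_1[OF exp less.prems] .
  have "(1 + D) / (1 - r) \<le> C" by (simp add: C_def)
  then have C: "1 + D + r * C \<le> C" using r by (simp add: field_simps)
  have "?S A N \<le> C" for N
  proof (induction N)
    case 0
    then show ?case by (simp add: C_def)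
  next
    case (Suc N)
    have "(\<Sum>v\<in>V. factor A v * ?S (insert v A) N) =
        (\<Sum>v\<in>A. factor A v * ?S (insert v A) N) + (\<Sum>v\<in>V - A. factor A v * ?S (insert v A) N)"
      by (subst sum.subset_diff[OF less.prems finite_V]) (rule add.commute)
    also have "(\<Sum>v\<in>A. factor A v * ?S (insert v A) N) = r * ?S A N"
      unfolding r_def sum_distrib_right by (intro sum.cong) (auto simp: insert_absorb)
    also have "r * ?S A N \<le> r * C"
      using Suc by (intro mult_left_mono) (auto simp: r_def sum_nonneg factor_nonneg)
    also have "(\<Sum>v\<in>V - A. factor A v * ?S (insert v A) N) \<le> D"
      unfolding D_def using K by (intro sum_mono mult_left_mono factor_nonneg) auto
    finally have "(\<Sum>v\<in>V. factor A v * ?S (insert v A) N) \<le> r * C + D" by simp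
    then show ?case unfolding weight_sum_Suc using C by simp
  qed
  then show ?case by blast
qed

lemma level_sum_nonneg: "(\<And>w. 0 \<le> f w) \<Longrightarrow> 0 \<le> level_sum f m"
  unfolding level_sum_def by (intro sum_nonneg mult_nonneg_nonneg weight_nonneg) auto

lemma level_sum_mono: "(\<And>w. set w \<subseteq> V \<Longrightarrow> f w \<le> g w) \<Longrightarrow> level_sum f m \<le> level_sum g m"
  unfolding level_sum_def
  by (intro sum_mono mult_left_mono weight_nonneg) (auto simp: words_def)

lemma level_sum_cong: "(\<And>w. set w \<subseteq> V \<Longrightarrow> f w = g w) \<Longrightarrow> level_sum f m = level_sum g m"
  unfolding level_sum_def by (intro sum.cong) (auto simp: words_def)

lemma level_sum_add: "level_sum (\<lambda>w. f w + g w) m = level_sum f m + level_sum g m"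
  by (simp add: level_sum_def distrib_left sum.distrib)

lemma level_sum_cmult: "level_sum (\<lambda>w. k * f w) m = k * level_sum f m"
  by (simp add: level_sum_def sum_distrib_left mult.left_commute)

lemma level_sum_sum: "(\<Sum>j\<in>J. level_sum (f j) m) = level_sum (\<lambda>w. \<Sum>j\<in>J. f j w) m"
  by (simp add: level_sum_def sum_distrib_left) (rule sum.swap)

lemma level_sum_bounded:
  assumes exp: expanding
  shows "\<exists>C. \<forall>N. (\<Sum>m\<le>N. level_sum (\<lambda>w. 1) m) \<le> C"
  using weight_sum_bounded[OF exp, of "{}"] by (simp add: level_sum_def)

lemma level_sum_summable:
  assumes exp: expanding
    and f: "\<And>w. 0 \<le> f w" "\<And>w. f w \<le> k"
  shows "summable (level_sum f)"
proof -
  obtain C where C: "\<And>N. (\<Sum>m\<le>N. level_sum (\<lambda>w. 1) m) \<le> C"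
    using level_sum_bounded[OF exp] by blast
  have "summable (level_sum (\<lambda>w. 1))"
    using C by (intro bounded_imp_summable level_sum_nonneg) auto
  then have summ: "summable (\<lambda>m. k * level_sum (\<lambda>w. 1) m)"
    by (rule summable_mult)
  have "level_sum f m \<le> k * level_sum (\<lambda>w. 1) m" for m
    unfolding level_sum_cmult[symmetric] using f by (intro level_sum_mono) auto
  moreover have "0 \<le> level_sum f m" for m
    using f by (intro level_sum_nonneg)
  ultimately have "norm (level_sum f m) \<le> k * level_sum (\<lambda>w. 1) m" for m
    by simp
  with summ show ?thesis by (rule summable_comparison_test'[where N = 0])
qed

subsection \<open>Mean hitting times\<close>

text \<open>The mean of the minimum of \<open>n\<close> and the time to reach \<open>x\<close> from \<open>z\<close>. Working with these
  truncations keeps all quantities real and bounded.\<close>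

fun hit :: "'a list \<Rightarrow> nat \<Rightarrow> 'a list \<Rightarrow> real" where
  "hit x 0 z = 0"
| "hit x (Suc n) z = (if z = x then 0 else 1 + (\<Sum>c\<in>V. p c * hit x n (fcfm_step E z c)))"

lemma hit_nonneg: "0 \<le> hit x n z"
  by (induction n arbitrary: z) (auto intro!: add_nonneg_nonneg sum_nonneg mult_nonneg_nonneg p_nonneg)

lemma sum_p_const: "(\<Sum>c\<in>V. p c * k) = k"
  using sum_p by (simp flip: sum_distrib_right)

lemma hit_le: "hit x n z \<le> real n"
proof (induction n arbitrary: z)
  case (Suc n)
  have "(\<Sum>c\<in>V. p c * hit x n (fcfm_step E z c)) \<le> (\<Sum>c\<in>V. p c * real n)"
    using Suc p_nonneg by (intro sum_mono mult_left_mono) auto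
  then show ?case by (simp add: sum_p_const)
qed simp

lemma hit_le_Suc: "hit x n z \<le> hit x (Suc n) z"
proof (induction n arbitrary: z)
  case 0
  then show ?case by (simp only: hit.simps(1) hit_nonneg)
next
  case (Suc n)
  have "(\<Sum>c\<in>V. p c * hit x n (fcfm_step E z c)) \<le> (\<Sum>c\<in>V. p c * hit x (Suc n) (fcfm_step E z c))"
    using Suc p_nonneg by (intro sum_mono mult_left_mono) auto
  then show ?case by (simp only: hit.simps) simp
qed

lemma hit_incseq: "incseq (\<lambda>n. hit x n z)"
  using hit_le_Suc by (intro incseq_SucI)

text \<open>This is positive recurrence of the chain, with the first step of each return split off.\<close>

definition finite_returns :: bool where
  "finite_returns \<longleftrightarrow> (\<forall>x\<in>fcfm_states V E. \<exists>K. \<forall>n. (\<Sum>c\<in>V. p c * hit x n (fcfm_step E x c)) \<le> K)"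

subsection \<open>Expansion implies positive recurrence\<close>

lemma level_sum_except:
  assumes "set x \<subseteq> V"
  shows "level_sum (\<lambda>z. if z = x then 0 else g z) m =
    level_sum g m - (if m = length x then weight {} x * g x else 0)"
proof -
  have "level_sum g m = level_sum (\<lambda>z. if z = x then 0 else g z) m + level_sum (\<lambda>z. if z = x then g x else 0) m"
    unfolding level_sum_add[symmetric] by (intro level_sum_cong) auto
  moreover have "level_sum (\<lambda>z. if z = x then g x else 0) m = (if m = length x then weight {} x * g x else 0)"
  proof -
    have "level_sum (\<lambda>z. if z = x then g x else 0) m = (\<Sum>z\<in>words V m. if z = x then weight {} x * g x else 0)"
      unfolding level_sum_def by (intro sum.cong) auto
    also have "\<dots> = (if x \<in> words V m then weight {} x * g x else 0)"
      using finite_words[OF finite_V] by (rule sum.delta)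
    finally show ?thesis using assms by (auto simp: words_def)
  qed
  ultimately show ?thesis by simp
qed

text \<open>Kac's argument. Integrate the recursion of \<open>hit x\<close> against the product-form measure: by
  invariance the mean of \<open>hit x n\<close> cancels, and what is left is the total mass on one side and \<open>weight {} x\<close>
  times the mean return time on the other. The truncation to words of length at most \<open>N\<close> leaves an
  error of at most \<open>n\<close> times the mass of level \<open>N + 1\<close>, which vanishes in the limit.\<close>

lemma mean_return_le:
  assumes C: "\<And>N. (\<Sum>m\<le>N. level_sum (\<lambda>w. 1) m) \<le> C" and x: "set x \<subseteq> V"
  shows "weight {} x * (1 + (\<Sum>c\<in>V. p c * hit x n (fcfm_step E x c))) \<le> C"
proof -
  define PH where "PH = (\<lambda>z. \<Sum>c\<in>V. p c * hit x n (fcfm_step E z c))"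
  have "summable (level_sum (\<lambda>w. 1))"
    using C by (intro bounded_imp_summable level_sum_nonneg) auto
  then have lim0: "level_sum (\<lambda>w. 1) \<longlonglongrightarrow> 0"
    by (rule summable_LIMSEQ_zero)
  have bound: "weight {} x * (1 + PH x) \<le> C + real n * level_sum (\<lambda>w. 1) (Suc N)"
    if N: "length x \<le> N" for N
  proof -
    have hit_Suc: "level_sum (hit x (Suc n)) m = level_sum (\<lambda>z. if z = x then 0 else 1 + PH z) m" for m
      by (intro level_sum_cong) (simp add: PH_def)
    have "(\<Sum>m\<le>N. level_sum (hit x n) m) \<le> (\<Sum>m\<le>N. level_sum (hit x (Suc n)) m)"
      using hit_le_Suc by (intro sum_mono level_sum_mono)
    also have "\<dots> = (\<Sum>m\<le>N. level_sum (\<lambda>z. 1 + PH z) m -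
        (if m = length x then weight {} x * (1 + PH x) else 0))"
      by (simp only: hit_Suc level_sum_except[OF x])
    also have "\<dots> = (\<Sum>m\<le>N. level_sum (\<lambda>z. 1) m) + (\<Sum>m\<le>N. level_sum PH m) - weight {} x * (1 + PH x)"
      using N by (simp add: sum_subtractf level_sum_add sum.distrib sum.delta)
    also have "(\<Sum>m\<le>N. level_sum PH m) \<le> (\<Sum>m\<le>Suc N. level_sum (hit x n) m)"
      unfolding PH_def using hit_nonneg by (rule product_form_excessive)
    also have "\<dots> = (\<Sum>m\<le>N. level_sum (hit x n) m) + level_sum (hit x n) (Suc N)"
      by simp
    also have "level_sum (hit x n) (Suc N) \<le> real n * level_sum (\<lambda>w. 1) (Suc N)"
      unfolding level_sum_cmult[symmetric] using hit_le by (intro level_sum_mono) simp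
    finally show ?thesis using C[of N] by simp
  qed
  have "(\<lambda>N. C + real n * level_sum (\<lambda>w. 1) (Suc N)) \<longlonglongrightarrow> C + real n * 0"
    by (intro tendsto_intros LIMSEQ_Suc lim0)
  then have "weight {} x * (1 + PH x) \<le> C + real n * 0"
    by (rule LIMSEQ_le_const) (use bound in blast)
  then show ?thesis by (simp add: PH_def)
qed

lemma finite_returns_if_expansion:
  assumes exp: expanding
  shows finite_returns
  unfolding finite_returns_def
proof
  fix x assume "x \<in> fcfm_states V E"
  then have x: "set x \<subseteq> V" "sorted_wrt (\<lambda>u v. (u, v) \<notin> E) x" by (auto simp: fcfm_states_def)
  obtain C where C: "\<And>N. (\<Sum>m\<le>N. level_sum (\<lambda>w. 1) m) \<le> C"
    using level_sum_bounded[OF exp] by blast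
  have w: "0 < weight {} x" using x by (intro weight_pos) auto
  have "(\<Sum>c\<in>V. p c * hit x n (fcfm_step E x c)) \<le> C / weight {} x" for n
    using mean_return_le[OF C x(1), of n] w by (simp add: field_simps)
  then show "\<exists>K. \<forall>n. (\<Sum>c\<in>V. p c * hit x n (fcfm_step E x c)) \<le> K" by blast
qed

subsection \<open>Matching rates\<close>

lemma matched_le: "(\<And>u w. F u w \<le> 1) \<Longrightarrow> matched F z c \<le> 1"
  by (induction z arbitrary: F) auto

text \<open>\<open>R i j\<close> is the rate at which an arriving \<open>j\<close> removes a stored \<open>i\<close>. For fixed \<open>i\<close>, the rates
  \<open>R i j\<close> add up to the rate at which items of class \<open>i\<close> are stored, by \<open>removal_balance\<close>, and the
  rates \<open>R j i\<close> to the rate at which they are matched on arrival. Together these are all arrivals of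
  class \<open>i\<close>.\<close>

lemma weights_if_expansion:
  assumes exp: expanding
  shows "\<exists>\<alpha>. edge_weights E \<alpha> \<and> (\<forall>k\<in>V. p k = weighted_measure E \<alpha> k)"
proof -
  define \<delta> :: "'a \<Rightarrow> 'a \<Rightarrow> 'a list \<Rightarrow> real" where "\<delta> = (\<lambda>i u w. if u = i then 1 else 0)"
  define r where "r = (\<lambda>i j. level_sum (\<lambda>z. p j * matched (\<delta> i) z j))"
  define R where "R = (\<lambda>i j. suminf (r i j))"
  define Z where "Z = suminf (level_sum (\<lambda>w. 1))"
  have m0: "0 \<le> matched (\<delta> i) z j" for i z j by (intro matched_nonneg) (auto simp: \<delta>_def)
  have m1: "matched (\<delta> i) z j \<le> 1" for i z j by (intro matched_le) (auto simp: \<delta>_def)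
  have r0: "0 \<le> r i j m" if "j \<in> V" for i j m
    unfolding r_def using m0 p_nonneg[OF that] by (intro level_sum_nonneg) auto
  have summ: "summable (r i j)" if "j \<in> V" for i j
    unfolding r_def using m0 m1 p_nonneg[OF that]
    by (intro level_sum_summable[OF exp, of _ "p j"]) (auto intro: mult_left_le)
  then have sums: "r i j sums R i j" if "j \<in> V" for i j
    using that by (auto simp: R_def)
  have summ1: "summable (level_sum (\<lambda>w. 1))"
    by (rule level_sum_summable[OF exp, of _ 1]) auto
  then have Z: "level_sum (\<lambda>w. 1) sums Z" by (auto simp: Z_def)
  have Zpos: "0 < Z"
    unfolding Z_def using summ1
    by (rule suminf_pos2[of _ 0]) (simp_all add: level_sum_def sum_nonneg weight_nonneg)
  have row: "(\<Sum>j\<in>V. R i j + R j i) = p i * Z" if i: "i \<in> V" for i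
  proof -
    let ?out = "level_sum (\<lambda>w. if i \<in> E `` set w then 0 else p i)"
    let ?in = "level_sum (\<lambda>w. if i \<in> E `` set w then p i else 0)"
    have "(\<Sum>j\<in>V. r i j (Suc m)) = ?out m" for m
    proof -
      have "(\<Sum>j\<in>V. r i j (Suc m)) = (\<Sum>z\<in>words V (Suc m). weight {} z * (\<Sum>c\<in>V. p c * matched (\<delta> i) z c))"
        unfolding r_def level_sum_sum by (simp only: level_sum_def)
      also have "\<dots> = (\<Sum>w\<in>words V m. weight {} w * (\<Sum>u\<in>V - E `` set w. p u * \<delta> i u w))"
        by (rule removal_balance)
      also have "\<dots> = ?out m"
        unfolding level_sum_def using i finite_V
        by (intro sum.cong refl arg_cong2[where f = "(*)"]) (simp add: \<delta>_def if_distrib sum.delta cong: if_cong)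
      finally show ?thesis .
    qed
    moreover have "(\<lambda>m. \<Sum>j\<in>V. r i j m) sums (\<Sum>j\<in>V. R i j)"
      using sums by (intro sums_sum) auto
    moreover have "(\<Sum>j\<in>V. r i j 0) = 0"
      by (simp add: r_def level_sum_def)
    ultimately have out: "?out sums (\<Sum>j\<in>V. R i j)"
      using sums_Suc_iff[of "\<lambda>m. \<Sum>j\<in>V. r i j m"] by simp
    have "(\<Sum>j\<in>V. r j i m) = ?in m" for m
    proof -
      have "(\<Sum>j\<in>V. p i * matched (\<delta> j) z i) = (if i \<in> E `` set z then p i else 0)"
        if "set z \<subseteq> V" for z
      proof -
        have "(\<Sum>j\<in>V. p i * matched (\<delta> j) z i) = p i * matched (\<lambda>u w. \<Sum>j\<in>V. \<delta> j u w) z i"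
          by (simp add: sum_distrib_left[symmetric] matched_sum)
        also have "matched (\<lambda>u w. \<Sum>j\<in>V. \<delta> j u w) z i = matched (\<lambda>u w. 1) z i"
          using that finite_V by (intro matched_cong) (auto simp: \<delta>_def)
        finally show ?thesis by (simp add: matched_const)
      qed
      moreover have "(\<Sum>j\<in>V. r j i m) = level_sum (\<lambda>z. \<Sum>j\<in>V. p i * matched (\<delta> j) z i) m"
        unfolding r_def by (rule level_sum_sum)
      ultimately show ?thesis by (simp cong: level_sum_cong)
    qed
    moreover have "(\<lambda>m. \<Sum>j\<in>V. r j i m) sums (\<Sum>j\<in>V. R j i)"
      using sums[OF i] by (intro sums_sum) auto
    ultimately have "?in sums (\<Sum>j\<in>V. R j i)" by simp
    with out have "(\<lambda>m. ?out m + ?in m) sums ((\<Sum>j\<in>V. R i j) + (\<Sum>j\<in>V. R j i))"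
      by (rule sums_add)
    moreover have "?out m + ?in m = p i * level_sum (\<lambda>w. 1) m" for m
      unfolding level_sum_add[symmetric] level_sum_cmult[symmetric]
      by (intro level_sum_cong) auto
    ultimately have "(\<Sum>j\<in>V. R i j) + (\<Sum>j\<in>V. R j i) = p i * Z"
      using sums_mult[OF Z, of "p i"] by (simp add: sums_unique2)
    then show ?thesis by (simp add: sum.distrib)
  qed
  have Rpos: "0 < R i j" if ij: "(i, j) \<in> E" for i j
  proof -
    have V: "i \<in> V" "j \<in> V" using ij E_subset by auto
    have "0 < r i j (Suc 0)"
    proof -
      have "0 < factor {} i * (p j * matched (\<delta> i) [i] j)"
        using weight_pos[of "[i]" "{}"] V ij p_pos by (simp add: \<delta>_def)
      moreover have "0 \<le> factor {} v * (p j * matched (\<delta> i) [v] j)" for v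
        by (intro mult_nonneg_nonneg factor_nonneg m0 p_nonneg[OF V(2)])
      ultimately have "0 < (\<Sum>v\<in>V. factor {} v * (p j * matched (\<delta> i) [v] j))"
        by (rule sum_pos2[OF finite_V V(1)])
      then show ?thesis
        by (simp add: r_def level_sum_def sum_words_Suc[OF finite_V] del: matched.simps)
    qed
    then show ?thesis
      unfolding R_def using summ V r0 by (intro suminf_pos2[of _ "Suc 0"]) auto
  qed
  have Rzero: "R i j = 0" if "(i, j) \<notin> E" for i j
  proof -
    have "matched (\<delta> i) z j = matched (\<lambda>u w. 0) z j" for z
      using that by (intro matched_cong) (auto simp: \<delta>_def)
    then have "r i j = (\<lambda>m. 0)"
      by (simp add: r_def level_sum_def matched_const fun_eq_iff)
    then show ?thesis by (simp add: R_def)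
  qed
  define \<alpha> where "\<alpha> = (\<lambda>i j. (R i j + R j i) / Z)"
  have "edge_weights E \<alpha>"
    unfolding edge_weights_def
  proof clarify
    fix i j assume "(i, j) \<in> E"
    then have "0 < R i j" "0 < R j i" using Rpos E_sym by auto
    then show "\<alpha> i j = \<alpha> j i \<and> 0 < \<alpha> i j" using Zpos by (simp add: \<alpha>_def)
  qed
  moreover have "p k = weighted_measure E \<alpha> k" if k: "k \<in> V" for k
  proof -
    have "weighted_measure E \<alpha> k = (\<Sum>j\<in>V. \<alpha> k j)"
      unfolding weighted_measure_def using finite_V nbr_subset
    proof (intro sum.mono_neutral_left)
      show "\<forall>j\<in>V - E `` {k}. \<alpha> k j = 0"
        using E_sym by (auto simp: \<alpha>_def Rzero)
    qed auto
    also have "\<dots> = p k * Z / Z"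
      unfolding \<alpha>_def sum_divide_distrib[symmetric] row[OF k] ..
    finally show ?thesis using Zpos by simp
  qed
  ultimately show ?thesis by blast
qed

subsection \<open>Positive recurrence implies expansion\<close>

text \<open>Stored items of \<open>I\<close> count 1 and stored items of \<open>E(I)\<close> count -1.\<close>

definition imbalance :: "'a set \<Rightarrow> 'a list \<Rightarrow> real" where
  "imbalance I z = (\<Sum>u\<leftarrow>z. indicator I u - indicator (E `` I) u)"

text \<open>Storing \<open>c\<close> changes the imbalance by exactly the term in parentheses. If \<open>c\<close> removes \<open>u\<close>, then an \<open>I\<close>
  among the two forces the other into \<open>E(I)\<close>, so that the terms of \<open>u\<close> and \<open>c\<close> have a nonpositive sum.\<close>

lemma imbalance_step:
  assumes "independent_set V E I"
  shows "imbalance I z + (indicator I c - indicator (E `` I) c) \<le> imbalance I (fcfm_step E z c)"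
proof (induction z)
  case (Cons u w)
  show ?case
  proof (cases "(u, c) \<in> E")
    case True
    then have "u \<in> I \<Longrightarrow> c \<in> E `` I" "c \<in> I \<Longrightarrow> u \<in> E `` I" using E_sym by auto
    moreover have "I \<inter> E `` I = {}" using assms by (auto simp: independent_set_def)
    ultimately show ?thesis using True
      by (auto simp: imbalance_def indicator_def simp del: Image_singleton_iff split: if_splits)
  qed (use Cons in \<open>simp add: imbalance_def\<close>)
qed (simp add: imbalance_def)

lemma imbalance_drift:
  assumes I: "independent_set V E I" and le: "sum p (E `` I) \<le> sum p I"
  shows "imbalance I z \<le> (\<Sum>c\<in>V. p c * imbalance I (fcfm_step E z c))"
proof -
  have "I \<subseteq> V" using I by (simp add: independent_set_def)
  have ind: "(\<Sum>c\<in>V. p c * indicator B c) = sum p B" if "B \<subseteq> V" for B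
    using that finite_V by (simp add: sum.inter_restrict[symmetric] indicator_def Int_absorb1
        if_distrib[of "\<lambda>x. _ * x"] cong: if_cong)
  have "imbalance I z \<le> (\<Sum>c\<in>V. p c * imbalance I z) + sum p I - sum p (E `` I)"
    using le by (simp add: sum_p_const)
  also have "\<dots> = (\<Sum>c\<in>V. p c * (imbalance I z + (indicator I c - indicator (E `` I) c)))"
    by (simp only: ind[OF \<open>I \<subseteq> V\<close>, symmetric] ind[OF nbr_subset, symmetric]
        distrib_left right_diff_distrib sum.distrib sum_subtractf)
  also have "\<dots> \<le> (\<Sum>c\<in>V. p c * imbalance I (fcfm_step E z c))"
    using imbalance_step[OF I] p_nonneg by (intro sum_mono mult_left_mono) auto
  finally show ?thesis .
qed

lemma imbalance_le_length: "imbalance I z \<le> real (length z)"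
  by (induction z) (auto simp: imbalance_def indicator_def)

lemma length_step: "length z \<le> Suc (length (fcfm_step E z c))"
  by (induction z) auto

lemma le_hit_empty: "n \<le> length z \<Longrightarrow> real n \<le> hit [] n z"
proof (induction n arbitrary: z)
  case (Suc n)
  have "real n \<le> hit [] n (fcfm_step E z c)" for c
    using length_step[of z c] Suc.prems by (intro Suc.IH) simp
  then have "(\<Sum>c\<in>V. p c * real n) \<le> (\<Sum>c\<in>V. p c * hit [] n (fcfm_step E z c))"
    using p_nonneg by (intro sum_mono mult_left_mono) auto
  then show ?case using Suc.prems by (auto simp: sum_p_const)
qed simp

text \<open>Let \<open>h\<close> be the mean time to empty the store. Optional stopping at time \<open>n\<close> takes the form
  \<open>imbalance I z \<le> h z - hit [] n z\<close>: the right side is the mean time still needed after \<open>n\<close> steps,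
  which is at least the mean length of the store if it has not been empty until then. It tends to 0.\<close>

lemma expansion_if_finite_returns:
  assumes fin: finite_returns
  shows expanding
proof (rule ccontr)
  assume "\<not> expanding"
  then obtain I where I: "independent_set V E I" and "\<not> sum p I < sum p (E `` I)"
    by (auto simp: expanding_def)
  then have le: "sum p (E `` I) \<le> sum p I" by simp
  \<comment> \<open>\<open>Bd\<close>: the states with a finite mean emptying time\<close>
  define Bd where "Bd = (\<lambda>z. \<exists>K. \<forall>n. hit [] n z \<le> K)"
  define h where "h = (\<lambda>z. lim (\<lambda>n. hit [] n z))"
  have lim: "(\<lambda>n. hit [] n z) \<longlonglongrightarrow> h z" if bd: "Bd z" for z
  proof -
    obtain K where "\<forall>n. hit [] n z \<le> K" using bd unfolding Bd_def by blast
    then obtain L where "(\<lambda>n. hit [] n z) \<longlonglongrightarrow> L"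
      using incseq_convergent[OF hit_incseq] by blast
    then show ?thesis by (simp add: h_def limI)
  qed
  have hge: "hit [] n z \<le> h z" if "Bd z" for n z
    using incseq_le[OF hit_incseq lim[OF that]] .
  have BdE: "Bd c" if bd: "\<And>n. (\<Sum>c\<in>V. p c * hit [] n (s c)) \<le> K" and a: "a \<in> V" "c = s a" for s K c a
  proof -
    have "hit [] n c \<le> K / p a" for n
    proof -
      have "p a * hit [] n (s a) \<le> (\<Sum>c\<in>V. p c * hit [] n (s c))"
        using p_nonneg hit_nonneg by (intro member_le_sum[OF a(1) _ finite_V]) auto
      then show ?thesis using bd[of n] p_pos[OF a(1)] a(2)
        by (simp add: field_simps)
    qed
    then show ?thesis by (auto simp: Bd_def)
  qed
  have BdS: "Bd (fcfm_step E z a)" if bd: "Bd z" "z \<noteq> []" "a \<in> V" for z a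
  proof -
    obtain K where K: "\<forall>n. hit [] n z \<le> K" using bd unfolding Bd_def by blast
    have "(\<Sum>c\<in>V. p c * hit [] n (fcfm_step E z c)) \<le> K" for n
      using K[rule_format, of "Suc n"] \<open>z \<noteq> []\<close> by simp
    then show ?thesis using BdE[of "fcfm_step E z" K a] bd by blast
  qed
  have hS: "h z = 1 + (\<Sum>c\<in>V. p c * h (fcfm_step E z c))" if "Bd z" "z \<noteq> []" for z
  proof -
    have "(\<lambda>n. hit [] (Suc n) z) \<longlonglongrightarrow> 1 + (\<Sum>c\<in>V. p c * h (fcfm_step E z c))"
      using that BdS by (auto intro!: tendsto_intros lim)
    moreover have "(\<lambda>n. hit [] (Suc n) z) \<longlonglongrightarrow> h z"
      using lim[OF that(1)] by (rule LIMSEQ_Suc)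
    ultimately show ?thesis by (rule LIMSEQ_unique[symmetric])
  qed
  have "imbalance I z \<le> h z - hit [] n z" if "Bd z" for n z
    using that
  proof (induction n arbitrary: z)
    case 0
    have "real (length z) \<le> h z"
      using le_hit_empty[of "length z" z] hge[OF 0] by (meson order.refl order.trans)
    then show ?case using imbalance_le_length[of I z] by simp
  next
    case (Suc n)
    show ?case
    proof (cases "z = []")
      case True
      then show ?thesis using hge[OF Suc.prems, of "Suc n"] by (simp add: imbalance_def)
    next
      case False
      have "imbalance I z \<le> (\<Sum>c\<in>V. p c * imbalance I (fcfm_step E z c))"
        using imbalance_drift[OF I le] .
      also have "\<dots> \<le> (\<Sum>c\<in>V. p c * (h (fcfm_step E z c) - hit [] n (fcfm_step E z c)))"
        using Suc.IH BdS[OF Suc.prems False] p_nonneg by (intro sum_mono mult_left_mono) auto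
      also have "\<dots> = h z - hit [] (Suc n) z"
        using False hS[OF Suc.prems False] by (simp add: right_diff_distrib sum_subtractf)
      finally show ?thesis .
    qed
  qed
  then have neg: "imbalance I z \<le> 0" if "Bd z" for z
  proof -
    have "(\<lambda>n. h z - hit [] n z) \<longlonglongrightarrow> h z - h z"
      using lim[OF that] by (intro tendsto_intros)
    then have "imbalance I z \<le> h z - h z"
      by (rule LIMSEQ_le_const) (use \<open>\<And>z n. Bd z \<Longrightarrow> imbalance I z \<le> h z - hit [] n z\<close> that in blast)
    then show ?thesis by simp
  qed
  obtain i where i: "i \<in> I" "i \<in> V" "i \<notin> E `` I" using I by (auto simp: independent_set_def)
  have "[] \<in> fcfm_states V E" by (simp add: fcfm_states_def)
  then obtain K where "\<And>n. (\<Sum>c\<in>V. p c * hit [] n (fcfm_step E [] c)) \<le> K"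
    using fin unfolding finite_returns_def by blast
  then have "Bd [i]" using BdE[of "fcfm_step E []" K i "[i]"] i by simp
  then show False using neg[of "[i]"] i by (simp add: imbalance_def)
qed

end

section \<open>Return times of systems fed by regenerative arrivals\<close>

lemma ennreal_min_add: "min (d + a) (d + b) = d + min a (b :: ennreal)"
proof (cases "a \<le> b")
  case True
  then have "d + a \<le> d + b" by (rule add_left_mono)
  with True show ?thesis by (simp only: min_absorb1)
next
  case False
  then have "b \<le> a" by simp
  then have "d + b \<le> d + a" by (rule add_left_mono)
  with \<open>b \<le> a\<close> show ?thesis by (simp only: min_absorb2)
qed

text \<open>Arrivals in discrete or continuous time, as seen from the start: the class of the first item,
  the time until it arrives, and the arrivals after it. The law of the future given the first class is
  again \<open>M\<close>. The set \<open>G\<close> collects the outcomes on which the arrivals behave well.\<close>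

locale arrival_process = fcfm_model V E p + prob_space M
  for V :: "'a set" and E and p and M :: "'w measure" +
  fixes first :: "'w \<Rightarrow> 'a" and delay :: "'w \<Rightarrow> ennreal" and rest :: "'w \<Rightarrow> 'w" and G :: "'w set"
  assumes measurable_first: "a \<in> V \<Longrightarrow> {\<omega> \<in> space M. first \<omega> = a} \<in> sets M"
    and measurable_delay [measurable]: "delay \<in> borel_measurable M"
    and measurable_rest [measurable]: "rest \<in> M \<rightarrow>\<^sub>M M"
    and regenerate: "\<And>a f. a \<in> V \<Longrightarrow> f \<in> borel_measurable M \<Longrightarrow>
      (\<integral>\<^sup>+\<omega>. indicator {a} (first \<omega>) * f (rest \<omega>) \<partial>M) = ennreal (p a) * (\<integral>\<^sup>+\<omega>. f \<omega> \<partial>M)"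
    and AE_G: "AE \<omega> in M. \<omega> \<in> G"
    and first_G: "\<And>\<omega>. \<omega> \<in> G \<Longrightarrow> first \<omega> \<in> V"
    and rest_G: "\<And>\<omega>. \<omega> \<in> G \<Longrightarrow> rest \<omega> \<in> G"
    and no_explosion: "\<And>\<omega>. \<omega> \<in> G \<Longrightarrow> (SUP n. \<Sum>k<n. delay ((rest ^^ k) \<omega>)) = \<infinity>"
    and mean_delay: "0 < (\<integral>\<^sup>+\<omega>. delay \<omega> \<partial>M)" "(\<integral>\<^sup>+\<omega>. delay \<omega> \<partial>M) < \<infinity>"
begin

lemma measurable_first_ind [measurable]:
  "a \<in> V \<Longrightarrow> (\<lambda>\<omega>. indicator {a} (first \<omega>) :: ennreal) \<in> borel_measurable M"
proof -
  assume "a \<in> V"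
  then have "(indicator {\<omega> \<in> space M. first \<omega> = a} :: _ \<Rightarrow> ennreal) \<in> borel_measurable M"
    using measurable_first by (intro borel_measurable_indicator)
  then show ?thesis
    by (rule measurable_cong[THEN iffD1, rotated]) (auto simp: indicator_def)
qed

text \<open>The time to reach \<open>x\<close>, stopped after \<open>n\<close> arrivals. The sum over \<open>a\<close> selects the class that
  arrives; in contrast to a direct use of \<open>first \<omega>\<close> as an argument it is measurable termwise, also
  where \<open>first \<omega>\<close> is not in \<open>V\<close>.\<close>

fun hit_time :: "'a list \<Rightarrow> nat \<Rightarrow> 'a list \<Rightarrow> 'w \<Rightarrow> ennreal" where
  "hit_time x 0 z \<omega> = 0"
| "hit_time x (Suc n) z \<omega> = (if z = x then 0 else
     delay \<omega> + (\<Sum>a\<in>V. indicator {a} (first \<omega>) * hit_time x n (fcfm_step E z a) (rest \<omega>)))"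

lemma measurable_hit_time [measurable]: "hit_time x n z \<in> borel_measurable M"
proof (induction n arbitrary: z)
  case 0
  have "hit_time x 0 z = (\<lambda>\<omega>. 0)" by auto
  then show ?case by simp
next
  case (Suc n)
  have [measurable]: "hit_time x n (fcfm_step E z a) \<in> borel_measurable M" for a
    by (rule Suc.IH)
  have eq: "hit_time x (Suc n) z = (\<lambda>\<omega>. if z = x then 0 else
     delay \<omega> + (\<Sum>a\<in>V. indicator {a} (first \<omega>) * hit_time x n (fcfm_step E z a) (rest \<omega>)))"
    by auto
  show ?case unfolding eq by measurable
qed

lemma sum_first:
  "\<omega> \<in> G \<Longrightarrow> (\<Sum>a\<in>V. indicator {a} (first \<omega>) * f a) = (f (first \<omega>) :: ennreal)"
  using finite_V first_G[of \<omega>] by (subst sum.remove[of V "first \<omega>"]) (auto simp: indicator_def)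

lemma nn_integral_next:
  assumes f: "\<And>a. f a \<in> borel_measurable M"
  shows "(\<integral>\<^sup>+\<omega>. delay \<omega> + (\<Sum>a\<in>V. indicator {a} (first \<omega>) * f a (rest \<omega>)) \<partial>M) =
    (\<integral>\<^sup>+\<omega>. delay \<omega> \<partial>M) + (\<Sum>a\<in>V. ennreal (p a) * (\<integral>\<^sup>+\<omega>. f a \<omega> \<partial>M))"
proof -
  note f[measurable]
  have "(\<integral>\<^sup>+\<omega>. delay \<omega> + (\<Sum>a\<in>V. indicator {a} (first \<omega>) * f a (rest \<omega>)) \<partial>M) =
    (\<integral>\<^sup>+\<omega>. delay \<omega> \<partial>M) + (\<Sum>a\<in>V. \<integral>\<^sup>+\<omega>. indicator {a} (first \<omega>) * f a (rest \<omega>) \<partial>M)"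
    by (subst nn_integral_add) (auto simp: nn_integral_sum)
  then show ?thesis using regenerate[OF _ f] by simp
qed

lemma mean_delay_step:
  assumes "\<And>a. 0 \<le> h a"
  shows "t + (\<Sum>a\<in>V. ennreal (p a) * (t * ennreal (h a))) = t * ennreal (1 + (\<Sum>a\<in>V. p a * h a))"
proof -
  have "ennreal (1 + (\<Sum>a\<in>V. p a * h a)) = 1 + (\<Sum>a\<in>V. ennreal (p a) * ennreal (h a))"
    using assms p_nonneg
    by (simp add: ennreal_plus sum_nonneg ennreal_mult[symmetric] sum_ennreal)
  then show ?thesis by (simp add: distrib_left sum_distrib_left mult.left_commute)
qed

lemma nn_integral_hit_time:
  "(\<integral>\<^sup>+\<omega>. hit_time x n z \<omega> \<partial>M) = (\<integral>\<^sup>+\<omega>. delay \<omega> \<partial>M) * ennreal (hit x n z)"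
proof (induction n arbitrary: z)
  case (Suc n)
  show ?case
  proof (cases "z = x")
    case False
    then have "(\<integral>\<^sup>+\<omega>. hit_time x (Suc n) z \<omega> \<partial>M) = (\<integral>\<^sup>+\<omega>. delay \<omega> \<partial>M) +
        (\<Sum>a\<in>V. ennreal (p a) * (\<integral>\<^sup>+\<omega>. hit_time x n (fcfm_step E z a) \<omega> \<partial>M))"
      using nn_integral_next[of "\<lambda>a. hit_time x n (fcfm_step E z a)", OF measurable_hit_time] by simp
    also have "\<dots> = (\<integral>\<^sup>+\<omega>. delay \<omega> \<partial>M) * ennreal (1 + (\<Sum>a\<in>V. p a * hit x n (fcfm_step E z a)))"
      unfolding Suc.IH by (rule mean_delay_step) (rule hit_nonneg)
    finally show ?thesis using False by simp
  qed simp
next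
  case 0
  have "hit_time x 0 z = (\<lambda>\<omega>. 0)" by auto
  then show ?case by simp
qed

lemma hit_time_incseq: "incseq (\<lambda>n. hit_time x n z \<omega>)"
proof (rule incseq_SucI)
  show "hit_time x n z \<omega> \<le> hit_time x (Suc n) z \<omega>" for n
  proof (induction n arbitrary: z \<omega>)
    case (Suc n)
    have "(\<Sum>a\<in>V. indicator {a} (first \<omega>) * hit_time x n (fcfm_step E z a) (rest \<omega>)) \<le>
        (\<Sum>a\<in>V. indicator {a} (first \<omega>) * hit_time x (Suc n) (fcfm_step E z a) (rest \<omega>))"
      using Suc.IH by (intro sum_mono mult_left_mono) auto
    then show ?case by (subst (1 2) hit_time.simps(2)) (auto intro: add_left_mono)
  qed simp
qed

text \<open>If \<open>x\<close> is never reached, the truncations are the successive arrival times, and it is the absence of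
  explosion that makes them tend to \<open>\<infinity>\<close>. Both cases are covered by one induction: \<open>hit_time x n\<close> is at
  least the minimum of \<open>D\<close> and the time of the \<open>n\<close>-th arrival.\<close>

lemma hit_time_limit:
  assumes D0: "\<And>\<omega>. \<omega> \<in> G \<Longrightarrow> D x \<omega> = 0"
    and D: "\<And>z \<omega>. \<omega> \<in> G \<Longrightarrow> z \<noteq> x \<Longrightarrow> D z \<omega> = delay \<omega> + D (fcfm_step E z (first \<omega>)) (rest \<omega>)"
    and \<omega>: "\<omega> \<in> G"
  shows "D z \<omega> = (SUP n. hit_time x n z \<omega>)"
proof (rule antisym)
  have "hit_time x n z \<omega> \<le> D z \<omega>" for n
    using \<omega>
  proof (induction n arbitrary: z \<omega>)
    case (Suc n)
    then show ?case
      using D[OF Suc.prems, of z] rest_G[OF Suc.prems] by (auto simp: sum_first intro!: add_left_mono)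
  qed simp
  then show "(SUP n. hit_time x n z \<omega>) \<le> D z \<omega>" by (intro SUP_least)
  have "inf (D z \<omega>) (\<Sum>k<n. delay ((rest ^^ k) \<omega>)) \<le> hit_time x n z \<omega>" for n
    using \<omega>
  proof (induction n arbitrary: z \<omega>)
    case (Suc n)
    show ?case
    proof (cases "z = x")
      case True
      then show ?thesis using D0[OF Suc.prems] by (simp add: inf_absorb1)
    next
      case False
      let ?S = "\<Sum>k<n. delay ((rest ^^ k) (rest \<omega>))"
      let ?z = "fcfm_step E z (first \<omega>)"
      have "(\<Sum>k<Suc n. delay ((rest ^^ k) \<omega>)) = delay \<omega> + ?S"
        by (simp add: sum.lessThan_Suc_shift funpow_swap1 del: sum.lessThan_Suc)
      then have "inf (D z \<omega>) (\<Sum>k<Suc n. delay ((rest ^^ k) \<omega>)) =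
          min (delay \<omega> + D ?z (rest \<omega>)) (delay \<omega> + ?S)"
        using D[OF Suc.prems False] by (simp only: inf_min)
      also have "\<dots> = delay \<omega> + inf (D ?z (rest \<omega>)) ?S"
        unfolding inf_min by (rule ennreal_min_add)
      also have "\<dots> \<le> delay \<omega> + hit_time x n ?z (rest \<omega>)"
        using Suc.IH rest_G[OF Suc.prems] by (intro add_left_mono)
      also have "\<dots> = hit_time x (Suc n) z \<omega>"
        using False Suc.prems by (simp add: sum_first)
      finally show ?thesis .
    qed
  qed (simp add: inf_absorb2)
  then have "(SUP n. inf (D z \<omega>) (\<Sum>k<n. delay ((rest ^^ k) \<omega>))) \<le> (SUP n. hit_time x n z \<omega>)"
    by (intro SUP_mono) auto
  then show "D z \<omega> \<le> (SUP n. hit_time x n z \<omega>)"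
    by (simp only: inf_SUP[symmetric] no_explosion[OF \<omega>]) simp
qed

lemma nn_integral_return_time:
  assumes D0: "\<And>\<omega>. \<omega> \<in> G \<Longrightarrow> D x \<omega> = 0"
    and D: "\<And>z \<omega>. \<omega> \<in> G \<Longrightarrow> z \<noteq> x \<Longrightarrow> D z \<omega> = delay \<omega> + D (fcfm_step E z (first \<omega>)) (rest \<omega>)"
    and F: "\<And>\<omega>. \<omega> \<in> G \<Longrightarrow> F \<omega> = delay \<omega> + D (fcfm_step E x (first \<omega>)) (rest \<omega>)"
  shows "(\<integral>\<^sup>+\<omega>. F \<omega> \<partial>M) = (SUP n. (\<integral>\<^sup>+\<omega>. delay \<omega> \<partial>M) *
    ennreal (1 + (\<Sum>a\<in>V. p a * hit x n (fcfm_step E x a))))"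
proof -
  let ?t = "\<integral>\<^sup>+\<omega>. delay \<omega> \<partial>M"
  let ?R = "\<lambda>n \<omega>. delay \<omega> + (\<Sum>a\<in>V. indicator {a} (first \<omega>) * hit_time x n (fcfm_step E x a) (rest \<omega>))"
  have "F \<omega> = (SUP n. ?R n \<omega>)" if "\<omega> \<in> G" for \<omega>
    unfolding F[OF that] sum_first[OF that]
    by (subst hit_time_limit[where D = D, OF D0 D rest_G[OF that]]) (auto simp: ennreal_SUP_add_right)
  then have "(\<integral>\<^sup>+\<omega>. F \<omega> \<partial>M) = (\<integral>\<^sup>+\<omega>. (SUP n. ?R n \<omega>) \<partial>M)"
    using AE_G by (intro nn_integral_cong_AE) auto
  also have "\<dots> = (SUP n. \<integral>\<^sup>+\<omega>. ?R n \<omega> \<partial>M)"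
  proof (rule nn_integral_monotone_convergence_SUP)
    show "incseq ?R"
      using hit_time_incseq
      by (auto intro!: incseq_SucI le_funI add_left_mono sum_mono mult_left_mono simp del: hit_time.simps
          dest: incseq_SucD)
    show "?R n \<in> borel_measurable M" for n by measurable
  qed
  also have "(\<lambda>n. \<integral>\<^sup>+\<omega>. ?R n \<omega> \<partial>M) = (\<lambda>n. ?t * ennreal (1 + (\<Sum>a\<in>V. p a * hit x n (fcfm_step E x a))))"
  proof
    fix n
    show "(\<integral>\<^sup>+\<omega>. ?R n \<omega> \<partial>M) = ?t * ennreal (1 + (\<Sum>a\<in>V. p a * hit x n (fcfm_step E x a)))"
      using nn_integral_next[of "\<lambda>a. hit_time x n (fcfm_step E x a)", OF measurable_hit_time]
      by (simp only: nn_integral_hit_time mean_delay_step[OF hit_nonneg])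
  qed
  finally show ?thesis .
qed

text \<open>The arrival process enters the mean return time only through the mean delay, as a factor.\<close>

lemma mean_return_finite_iff:
  assumes D0: "\<And>\<omega>. \<omega> \<in> G \<Longrightarrow> D x \<omega> = 0"
    and D: "\<And>z \<omega>. \<omega> \<in> G \<Longrightarrow> z \<noteq> x \<Longrightarrow> D z \<omega> = delay \<omega> + D (fcfm_step E z (first \<omega>)) (rest \<omega>)"
    and F: "\<And>\<omega>. \<omega> \<in> G \<Longrightarrow> F \<omega> = delay \<omega> + D (fcfm_step E x (first \<omega>)) (rest \<omega>)"
  shows "(\<integral>\<^sup>+\<omega>. F \<omega> \<partial>M) < \<infinity> \<longleftrightarrow> (\<exists>K. \<forall>n. (\<Sum>a\<in>V. p a * hit x n (fcfm_step E x a)) \<le> K)"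
proof -
  obtain t where t: "(\<integral>\<^sup>+\<omega>. delay \<omega> \<partial>M) = ennreal t" "0 < t"
    using mean_delay by (cases "\<integral>\<^sup>+\<omega>. delay \<omega> \<partial>M") (auto simp: top_unique)
  define r where "r = (\<lambda>n. \<Sum>a\<in>V. p a * hit x n (fcfm_step E x a))"
  have r0: "0 \<le> r n" for n
    unfolding r_def using p_nonneg hit_nonneg by (intro sum_nonneg) auto
  have eq: "(\<integral>\<^sup>+\<omega>. F \<omega> \<partial>M) = (SUP n. ennreal (t * (1 + r n)))"
  proof -
    have "(\<integral>\<^sup>+\<omega>. F \<omega> \<partial>M) = (SUP n. ennreal t * ennreal (1 + r n))"
      unfolding r_def t(1)[symmetric] by (rule nn_integral_return_time[of D, OF D0 D F])
    moreover have "ennreal t * ennreal (1 + r n) = ennreal (t * (1 + r n))" for n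
      using t(2) r0[of n] by (intro ennreal_mult[symmetric]) auto
    ultimately show ?thesis by (simp only:)
  qed
  have "(\<integral>\<^sup>+\<omega>. F \<omega> \<partial>M) < \<infinity> \<longleftrightarrow> (\<exists>K. \<forall>n. r n \<le> K)"
  proof
    assume "(\<integral>\<^sup>+\<omega>. F \<omega> \<partial>M) < \<infinity>"
    then obtain s where s: "0 \<le> s" "(SUP n. ennreal (t * (1 + r n))) = ennreal s"
      unfolding eq by (cases "SUP n. ennreal (t * (1 + r n))") auto
    have "r n \<le> s / t" for n
    proof -
      have "ennreal (t * (1 + r n)) \<le> ennreal s"
        unfolding s(2)[symmetric] by (rule SUP_upper) simp
      then have "t * (1 + r n) \<le> s" using s(1) by simp
      then show ?thesis using t(2) by (simp add: field_simps)
    qed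
    then show "\<exists>K. \<forall>n. r n \<le> K" by blast
  next
    assume "\<exists>K. \<forall>n. r n \<le> K"
    then obtain K where "\<And>n. r n \<le> K" by blast
    then have "(SUP n. ennreal (t * (1 + r n))) \<le> ennreal (t * (1 + K))"
      using t(2) by (intro SUP_least ennreal_leI mult_left_mono) auto
    then show "(\<integral>\<^sup>+\<omega>. F \<omega> \<partial>M) < \<infinity>"
      unfolding eq using le_less_trans ennreal_less_top by (metis infinity_ennreal_def)
  qed
  then show ?thesis by (simp only: r_def)
qed

end

section \<open>Discrete time\<close>

lemma INF_shift:
  assumes "A = f ` B" and "\<And>b. b \<in> B \<Longrightarrow> g (f b) = c + h b"
  shows "(INF a\<in>A. g a) = c + (INF b\<in>B. h b :: ennreal)"
proof (cases "B = {}")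
  case False
  have "(INF a\<in>A. g a) = (INF b\<in>B. c + h b)"
    unfolding assms(1) image_image
    by (rule arg_cong[where f = Inf], rule image_cong[OF refl assms(2)])
  also have "\<dots> = c + (INF b\<in>B. h b)"
    using continuous_at_Inf_mono[of "\<lambda>x. c + x" "h ` B"] False
      continuous_add[of "at_right (Inf (h ` B))" "\<lambda>x. c" "\<lambda>x. x"]
    by (simp add: mono_def image_comp comp_def add_left_mono)
  finally show ?thesis .
qed (use assms in simp)

lemma fcfm_chain_0: "fcfm_chain E z 0 \<omega> = z"
  by (simp add: fcfm_chain_def)

lemma fcfm_chain_Suc: "fcfm_chain E z (Suc n) \<omega> = fcfm_chain E (fcfm_step E z (shd \<omega>)) n (stl \<omega>)"
  by (simp add: fcfm_chain_def)

text \<open>With the stream of classes as arrivals every delay is 1, and the first class and the rest of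
  the stream are the head and the tail.\<close>

lemma fcfm_stable_iff:
  assumes model: "fcfm_model V E (pmf q)" and q: "set_pmf q = V"
  shows "fcfm_stable V E q \<longleftrightarrow> fcfm_model.finite_returns V E (pmf q)"
proof -
  interpret fcfm_model V E "pmf q" by fact
  let ?M = "stream_space (measure_pmf q)"
  interpret S: prob_space ?M by (rule prob_space.prob_space_stream_space[OF prob_space_measure_pmf])
  interpret arrival_process V E "pmf q" ?M shd "\<lambda>_. 1" stl "streams V"
  proof
    show "{\<omega> \<in> space ?M. shd \<omega> = a} \<in> sets ?M" for a
      by measurable
    show "(\<integral>\<^sup>+\<omega>. indicator {a} (shd \<omega>) * f (stl \<omega>) \<partial>?M) = ennreal (pmf q a) * (\<integral>\<^sup>+\<omega>. f \<omega> \<partial>?M)"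
      if [measurable]: "f \<in> borel_measurable ?M" for a f
    proof -
      have [measurable]: "(\<lambda>\<omega>. indicator {a} (shd \<omega>) :: ennreal) \<in> borel_measurable ?M"
        by (rule measurable_compose[OF measurable_shd]) simp
      show ?thesis
      by (subst prob_space.nn_integral_stream_space[OF prob_space_measure_pmf])
         (simp_all add: nn_integral_cmult nn_integral_multc emeasure_pmf_single)
    qed
    have "AE \<omega> in ?M. stream_all (\<lambda>c. c \<in> V) \<omega>"
      using q by (intro prob_space.AE_stream_all[OF prob_space_measure_pmf]) (auto simp: AE_measure_pmf_iff)
    then show "AE \<omega> in ?M. \<omega> \<in> streams V"
      by eventually_elim (auto simp: streams_iff_snth stream.pred_set sset_range)
    show "(SUP n. \<Sum>k<(n::nat). 1 :: ennreal) = \<infinity>"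
      using ennreal_SUP_of_nat_eq_top by simp
  qed (auto dest: streams_shd streams_stl simp: S.emeasure_space_1)
  have "(\<integral>\<^sup>+\<omega>. (INF n\<in>{n. 0 < n \<and> fcfm_chain E x n \<omega> = x}. ennreal (real n)) \<partial>?M) < \<infinity> \<longleftrightarrow>
      (\<exists>K. \<forall>n. (\<Sum>a\<in>V. pmf q a * hit x n (fcfm_step E x a)) \<le> K)" for x
  proof (rule mean_return_finite_iff[where D = "\<lambda>z \<omega>. INF n\<in>{n. fcfm_chain E z n \<omega> = x}. ennreal (real n)"])
    show "(INF n\<in>{n. fcfm_chain E x n \<omega> = x}. ennreal (real n)) = 0" for \<omega>
      by (intro antisym INF_lower2[of 0]) (auto simp: fcfm_chain_0)
    show "(INF n\<in>{n. fcfm_chain E z n \<omega> = x}. ennreal (real n)) =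
       1 + (INF n\<in>{n. fcfm_chain E (fcfm_step E z (shd \<omega>)) n (stl \<omega>) = x}. ennreal (real n))"
      if "z \<noteq> x" for z \<omega>
    proof (rule INF_shift)
      show "{n. fcfm_chain E z n \<omega> = x} = Suc ` {n. fcfm_chain E (fcfm_step E z (shd \<omega>)) n (stl \<omega>) = x}"
      proof (intro set_eqI iffI)
        fix n assume "n \<in> {n. fcfm_chain E z n \<omega> = x}"
        then show "n \<in> Suc ` {n. fcfm_chain E (fcfm_step E z (shd \<omega>)) n (stl \<omega>) = x}"
          using that by (cases n) (auto simp: fcfm_chain_0 fcfm_chain_Suc)
      qed (auto simp: fcfm_chain_Suc)
      show "ennreal (real (Suc n)) = 1 + ennreal (real n)" for n
        by (simp flip: ennreal_1 ennreal_plus)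
    qed
    show "(INF n\<in>{n. 0 < n \<and> fcfm_chain E x n \<omega> = x}. ennreal (real n)) =
       1 + (INF n\<in>{n. fcfm_chain E (fcfm_step E x (shd \<omega>)) n (stl \<omega>) = x}. ennreal (real n))" for \<omega>
    proof (rule INF_shift)
      show "{n. 0 < n \<and> fcfm_chain E x n \<omega> = x} = Suc ` {n. fcfm_chain E (fcfm_step E x (shd \<omega>)) n (stl \<omega>) = x}"
      proof (intro set_eqI iffI)
        fix n assume "n \<in> {n. 0 < n \<and> fcfm_chain E x n \<omega> = x}"
        then show "n \<in> Suc ` {n. fcfm_chain E (fcfm_step E x (shd \<omega>)) n (stl \<omega>) = x}"
          by (cases n) (auto simp: fcfm_chain_Suc)
      qed (auto simp: fcfm_chain_Suc)
      show "ennreal (real (Suc n)) = 1 + ennreal (real n)" for n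
        by (simp flip: ennreal_1 ennreal_plus)
    qed
  qed
  then show ?thesis
    unfolding fcfm_stable_def positive_recurrent_def finite_returns_def by simp
qed

section \<open>Continuous time: paths\<close>

text \<open>Interpreting the locale \<open>folding_insort_key\<close> for the order on the reals yields facts about
  the version of the constant that takes the order as an argument. This identifies it with the
  version of the type class.\<close>

lemma sorted_key_list_of_set_real:
  "linorder.sorted_key_list_of_set (\<le>) f = sorted_key_list_of_set (f :: 'b \<Rightarrow> real)"
proof -
  have lin: "class.linorder ((\<le>) :: real \<Rightarrow> _) (<)" by unfold_locales
  have "linorder.insort_key (\<le>) f x xs = insort_key f x xs" for x xs
    by (induction xs) (simp_all add: linorder.insort_key.simps[OF lin])
  then have "linorder.insort_key (\<le>) f = insort_key f" by (intro ext)
  then show ?thesis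
    by (simp only: linorder.sorted_key_list_of_set_def[OF lin] sorted_key_list_of_set_def)
qed

lemma arrival_time_0 [simp]: "arrival_time \<omega> (i, 0) = \<omega> (i, 0)"
  by (simp add: arrival_time_def)

lemma arrival_time_Suc: "arrival_time \<omega> (i, Suc k) = arrival_time \<omega> (i, k) + \<omega> (i, Suc k)"
  by (simp add: arrival_time_def)

lemma arrival_time_unbounded:
  assumes "\<And>k. 0 < \<omega> (i, k)" and "\<And>n. \<exists>k\<ge>n. 1 < \<omega> (i, k)"
  shows "\<exists>k. t < arrival_time \<omega> (i, k)"
proof (rule ccontr)
  assume "\<not> ?thesis"
  then have "(\<Sum>l\<le>k. \<omega> (i, l)) \<le> t" for k by (simp add: arrival_time_def not_less)
  then have "summable (\<lambda>k. \<omega> (i, k))"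
    using assms(1) by (intro bounded_imp_summable[of _ t]) (auto intro: less_imp_le)
  then have "(\<lambda>k. \<omega> (i, k)) \<longlonglongrightarrow> 0" by (rule summable_LIMSEQ_zero)
  then have "eventually (\<lambda>k. \<omega> (i, k) < 1) sequentially" by (rule order_tendstoD) simp
  then obtain n where "\<And>k. n \<le> k \<Longrightarrow> \<omega> (i, k) < 1" by (auto simp: eventually_sequentially)
  then show False using assms(2)[of n] by (meson not_less_iff_gr_or_eq)
qed

lemma arrival_time_strict_mono:
  assumes "\<And>k. 0 < \<omega> (i, k)"
  shows "strict_mono (\<lambda>k. arrival_time \<omega> (i, k))"
  using assms by (intro strict_mono_Suc_iff[THEN iffD2]) (simp add: arrival_time_Suc)

lemma fcfm_step_neq: "fcfm_step E z c \<noteq> z"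
proof -
  have "length (fcfm_step E z c) = Suc (length z) \<or> Suc (length (fcfm_step E z c)) = length z"
    by (induction z) auto
  then show ?thesis by auto
qed

locale poisson_arrivals =
  fixes V :: "'a set" and \<mu> :: "'a \<Rightarrow> real"
  assumes finV: "finite V" and V_ne: "V \<noteq> {}" and \<mu>_pos: "\<And>i. i \<in> V \<Longrightarrow> 0 < \<mu> i"
begin

abbreviation idx :: "('a \<times> nat) set" where
  "idx \<equiv> V \<times> UNIV"

text \<open>The default is chosen inside \<open>V\<close>, so that \<open>next_class\<close> has finite range on all paths, which
  makes measurability easy.\<close>

definition next_class :: "('a \<times> nat \<Rightarrow> real) \<Rightarrow> 'a" where
  "next_class \<omega> = (if \<exists>a\<in>V. \<forall>j\<in>V - {a}. \<omega> (a, 0) < \<omega> (j, 0)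
     then THE a. a \<in> V \<and> (\<forall>j\<in>V - {a}. \<omega> (a, 0) < \<omega> (j, 0)) else SOME a. a \<in> V)"

text \<open>The interarrival times as seen after a first arrival of class \<open>a\<close>: class \<open>a\<close> starts afresh
  with its next interarrival time, and the other classes have been waiting for \<open>\<omega> (a, 0)\<close> already.\<close>

definition shift :: "'a \<Rightarrow> ('a \<times> nat \<Rightarrow> real) \<Rightarrow> 'a \<times> nat \<Rightarrow> real" where
  "shift a \<omega> = (\<lambda>(i, k)\<in>idx. if i = a then \<omega> (a, Suc k)
     else if k = 0 then \<omega> (i, 0) - \<omega> (a, 0) else \<omega> (i, k))"

definition next_delay :: "('a \<times> nat \<Rightarrow> real) \<Rightarrow> real" where
  "next_delay \<omega> = \<omega> (next_class \<omega>, 0)"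

definition remaining :: "('a \<times> nat \<Rightarrow> real) \<Rightarrow> 'a \<times> nat \<Rightarrow> real" where
  "remaining \<omega> = shift (next_class \<omega>) \<omega>"

text \<open>On these paths the list of arrivals up to a given time is well defined: finitely many
  arrivals, at distinct times.\<close>

definition regular_paths :: "('a \<times> nat \<Rightarrow> real) set" where
  "regular_paths = {\<omega>. (\<forall>ik\<in>idx. 0 < \<omega> ik) \<and> inj_on (arrival_time \<omega>) idx \<and>
     (\<forall>i\<in>V. \<forall>t. \<exists>k. t < arrival_time \<omega> (i, k))}"

text \<open>If the first arrival has class \<open>a\<close>, the arrival \<open>ik\<close> of the remaining path has index \<open>skip a ik\<close> in
  the original one.\<close>

definition skip :: "'a \<Rightarrow> 'a \<times> nat \<Rightarrow> 'a \<times> nat" where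
  "skip a ik = (if fst ik = a then (a, Suc (snd ik)) else ik)"

lemma fst_skip [simp]: "fst (skip a ik) = fst ik"
  by (simp add: skip_def)

lemma inj_skip: "inj (skip a)"
  by (auto simp: inj_def skip_def split: if_splits)

lemma skip_image: "skip a ` idx = idx - {(a, 0)}"
proof (intro equalityI subsetI)
  fix jl assume jl: "jl \<in> idx - {(a, 0)}"
  obtain i l where il: "jl = (i, l)" "i \<in> V" using jl by auto
  show "jl \<in> skip a ` idx"
  proof (cases "i = a")
    case True
    then obtain k where "l = Suc k" using jl il by (cases l) auto
    then have "jl = skip a (a, k)" using True il by (simp add: skip_def)
    then show ?thesis using True il by blast
  next
    case False
    then have "jl = skip a jl" using il by (simp add: skip_def)
    then show ?thesis using jl by blast
  qed
qed (auto simp: skip_def)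

lemma arrival_time_mono:
  assumes "\<omega> \<in> regular_paths" "i \<in> V" "k \<le> l"
  shows "arrival_time \<omega> (i, k) \<le> arrival_time \<omega> (i, l)"
  using assms(3)
proof (induction l rule: dec_induct)
  case (step n)
  have "0 < \<omega> (i, Suc n)" using assms by (auto simp: regular_paths_def)
  then show ?case using step by (simp add: arrival_time_Suc)
qed simp

lemma arrival_time_shift:
  assumes "a \<in> V" "ik \<in> idx"
  shows "arrival_time \<omega> (skip a ik) = \<omega> (a, 0) + arrival_time (shift a \<omega>) ik"
proof (cases ik)
  case (Pair i k)
  with assms have "i \<in> V" by auto
  then have "arrival_time \<omega> (skip a (i, k)) = \<omega> (a, 0) + arrival_time (shift a \<omega>) (i, k)"
    by (induction k) (auto simp: skip_def arrival_time_Suc shift_def)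
  then show ?thesis using Pair by simp
qed

lemma next_class_eq:
  assumes "a \<in> V" "\<forall>j\<in>V - {a}. \<omega> (a, 0) < \<omega> (j, 0)"
  shows "next_class \<omega> = a"
proof -
  have "next_class \<omega> = (THE a. a \<in> V \<and> (\<forall>j\<in>V - {a}. \<omega> (a, 0) < \<omega> (j, 0)))"
    using assms unfolding next_class_def by (intro if_P) blast
  also have "\<dots> = a"
  proof (rule the_equality)
  fix b assume b: "b \<in> V \<and> (\<forall>j\<in>V - {b}. \<omega> (b, 0) < \<omega> (j, 0))"
  show "b = a"
  proof (rule ccontr)
    assume "b \<noteq> a"
    then have "\<omega> (a, 0) < \<omega> (b, 0)" "\<omega> (b, 0) < \<omega> (a, 0)" using assms b by auto
    then show False by simp
  qed
  qed (use assms in auto)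
  finally show ?thesis .
qed

lemma next_class_in: "next_class \<omega> \<in> V"
proof (cases "\<exists>a\<in>V. \<forall>j\<in>V - {a}. \<omega> (a, 0) < \<omega> (j, 0)")
  case True
  then show ?thesis using next_class_eq by blast
next
  case False
  then have "next_class \<omega> = (SOME a. a \<in> V)" unfolding next_class_def by (rule if_not_P)
  then show ?thesis using V_ne by (simp add: some_in_eq)
qed

lemma next_class_regular:
  assumes \<omega>: "\<omega> \<in> regular_paths"
  shows "next_class \<omega> \<in> V" "\<forall>j\<in>V - {next_class \<omega>}. \<omega> (next_class \<omega>, 0) < \<omega> (j, 0)"
proof -
  define m where "m = Min ((\<lambda>i. \<omega> (i, 0)) ` V)"
  have "m \<in> (\<lambda>i. \<omega> (i, 0)) ` V"
    unfolding m_def using finV V_ne by (intro Min_in) auto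
  then obtain a where a: "a \<in> V" "m = \<omega> (a, 0)" by auto
  have lt: "\<forall>j\<in>V - {a}. \<omega> (a, 0) < \<omega> (j, 0)"
  proof
    fix j assume j: "j \<in> V - {a}"
    then have "m \<le> \<omega> (j, 0)" unfolding m_def using finV by (intro Min_le) auto
    moreover have "arrival_time \<omega> (a, 0) \<noteq> arrival_time \<omega> (j, 0)"
    proof
      assume eq: "arrival_time \<omega> (a, 0) = arrival_time \<omega> (j, 0)"
      have "inj_on (arrival_time \<omega>) idx" using \<omega> by (simp add: regular_paths_def)
      from inj_onD[OF this eq] show False using a j by auto
    qed
    ultimately show "\<omega> (a, 0) < \<omega> (j, 0)" using a by simp
  qed
  then have "next_class \<omega> = a" using a next_class_eq by blast
  then show "next_class \<omega> \<in> V" "\<forall>j\<in>V - {next_class \<omega>}. \<omega> (next_class \<omega>, 0) < \<omega> (j, 0)"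
    using a lt by auto
qed

lemma arrival_time_remaining:
  assumes "\<omega> \<in> regular_paths" "ik \<in> idx"
  shows "arrival_time \<omega> (skip (next_class \<omega>) ik) = next_delay \<omega> + arrival_time (remaining \<omega>) ik"
  unfolding next_delay_def remaining_def
  by (rule arrival_time_shift[OF next_class_regular(1)[OF assms(1)] assms(2)])

lemma next_delay_pos: "\<omega> \<in> regular_paths \<Longrightarrow> 0 < next_delay \<omega>"
  using next_class_regular(1)[of \<omega>] by (auto simp: next_delay_def regular_paths_def)

lemma next_delay_le_arrival:
  assumes \<omega>: "\<omega> \<in> regular_paths" and ik: "ik \<in> idx"
  shows "next_delay \<omega> \<le> arrival_time \<omega> ik"
proof -
  obtain i k where ik': "ik = (i, k)" "i \<in> V" using ik by auto
  have "next_delay \<omega> \<le> \<omega> (i, 0)"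
  proof (cases "i = next_class \<omega>")
    case False
    then have "\<omega> (next_class \<omega>, 0) < \<omega> (i, 0)" using next_class_regular(2)[OF \<omega>] ik'(2) by blast
    then show ?thesis by (simp add: next_delay_def)
  qed (simp add: next_delay_def)
  then show ?thesis
    using arrival_time_mono[OF \<omega> ik'(2), of 0 k] ik' by simp
qed

lemma remaining_regular:
  assumes \<omega>: "\<omega> \<in> regular_paths"
  shows "remaining \<omega> \<in> regular_paths"
  unfolding regular_paths_def
proof (intro CollectI conjI ballI allI)
  let ?a = "next_class \<omega>"
  note a = next_class_regular[OF \<omega>]
  show "0 < remaining \<omega> ik" if "ik \<in> idx" for ik
    using that \<omega> a by (cases ik) (auto simp: remaining_def shift_def regular_paths_def)
  show "inj_on (arrival_time (remaining \<omega>)) idx"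
  proof (rule inj_onI)
    fix ik jl assume in_idx: "ik \<in> idx" "jl \<in> idx"
      and "arrival_time (remaining \<omega>) ik = arrival_time (remaining \<omega>) jl"
    then have eq: "arrival_time \<omega> (skip ?a ik) = arrival_time \<omega> (skip ?a jl)"
      by (simp add: arrival_time_remaining[OF \<omega>])
    have "inj_on (arrival_time \<omega>) idx" using \<omega> by (simp add: regular_paths_def)
    moreover have "skip ?a ik \<in> idx" "skip ?a jl \<in> idx" using skip_image in_idx by blast+
    ultimately have "skip ?a ik = skip ?a jl" using eq by (auto dest: inj_onD)
    then show "ik = jl" using inj_skip by (auto dest: injD)
  qed
  fix i t assume i: "i \<in> V"
  obtain k where "t + next_delay \<omega> < arrival_time \<omega> (i, k)"
    using \<omega> i unfolding regular_paths_def by blast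
  also have "\<dots> \<le> arrival_time \<omega> (skip ?a (i, k))"
    using arrival_time_mono[OF \<omega> i, of k "Suc k"] by (auto simp: skip_def)
  finally show "\<exists>k. t < arrival_time (remaining \<omega>) (i, k)"
    using arrival_time_remaining[OF \<omega>, of "(i, k)"] i by (intro exI[of _ k]) simp
qed

lemma finite_arrivals:
  assumes \<omega>: "\<omega> \<in> regular_paths"
  shows "finite {ik \<in> idx. arrival_time \<omega> ik \<le> t}"
proof -
  have "\<forall>i\<in>V. \<exists>k. t < arrival_time \<omega> (i, k)" using \<omega> by (simp add: regular_paths_def)
  then obtain K where K: "\<And>i. i \<in> V \<Longrightarrow> t < arrival_time \<omega> (i, K i)" by metis
  have "k < K i" if "i \<in> V" "arrival_time \<omega> (i, k) \<le> t" for i k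
    using arrival_time_mono[OF \<omega> that(1), of "K i" k] K[OF that(1)] that(2)
    by (cases "K i \<le> k") auto
  then have "{ik \<in> idx. arrival_time \<omega> ik \<le> t} \<subseteq> Sigma V (\<lambda>i. {..<K i})"
    by auto
  then show ?thesis by (rule finite_subset) (use finV in auto)
qed

text \<open>Moving the time origin to the first arrival preserves the order of the later arrivals, and
  \<open>skip\<close> keeps their classes. The sorted list is therefore the first arrival followed by the relabelled
  sorted list of the remaining path.\<close>

lemma arrivals_until_rec:
  assumes \<omega>: "\<omega> \<in> regular_paths"
  shows "arrivals_until V \<omega> t = (if t < next_delay \<omega> then []
    else next_class \<omega> # arrivals_until V (remaining \<omega>) (t - next_delay \<omega>))"
proof -
  interpret A: folding_insort_key "(\<le>)" "(<)" idx "arrival_time \<omega>"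
    by unfold_locales (use \<omega> in \<open>simp add: regular_paths_def\<close>)
  note sorted_eq = sorted_key_list_of_set_real[of "arrival_time \<omega>"]
  show ?thesis
  proof (cases "t < next_delay \<omega>")
    case True
    then have "\<not> arrival_time \<omega> ik \<le> t" if "ik \<in> idx" for ik
      using next_delay_le_arrival[OF \<omega> that] by simp
    then have "{ik \<in> idx. arrival_time \<omega> ik \<le> t} = {}" by blast
    then have "arrivals_until V \<omega> t = []"
      by (simp only: arrivals_until_def A.sorted_key_list_of_set_empty[unfolded sorted_eq] list.map)
    then show ?thesis using True by simp
  next
    case False
    let ?a = "next_class \<omega>" and ?\<omega> = "remaining \<omega>"
    have reg: "?\<omega> \<in> regular_paths" by (rule remaining_regular[OF \<omega>])
    interpret B: folding_insort_key "(\<le>)" "(<)" idx "arrival_time ?\<omega>"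
      by unfold_locales (use reg in \<open>simp add: regular_paths_def\<close>)
    define S where "S = {ik \<in> idx. arrival_time ?\<omega> ik \<le> t - next_delay \<omega>}"
    define xs where "xs = sorted_key_list_of_set (arrival_time ?\<omega>) S"
    define ys where "ys = (?a, 0) # map (skip ?a) xs"
    have S: "S \<subseteq> idx" "finite S" using finite_arrivals[OF reg] by (auto simp: S_def)
    have xs: "set xs = S" "sorted (map (arrival_time ?\<omega>) xs)" "distinct xs"
      using B.sorted_key_list_of_set[unfolded sorted_key_list_of_set_real, OF S(1)] S B.distinct_if_distinct_map
      by (simp_all add: xs_def)
    have time: "arrival_time \<omega> (skip ?a ik) = next_delay \<omega> + arrival_time ?\<omega> ik" if "ik \<in> idx" for ik
      using arrival_time_remaining[OF \<omega> that] .
    have time_a: "arrival_time \<omega> (?a, 0) = next_delay \<omega>" by (simp add: next_delay_def)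
    have a: "?a \<in> V" using next_class_regular(1)[OF \<omega>] .
    have "set ys = {ik \<in> idx. arrival_time \<omega> ik \<le> t}"
    proof (intro equalityI subsetI)
      fix ik assume "ik \<in> set ys"
      then consider "ik = (?a, 0)" | jl where "jl \<in> S" "ik = skip ?a jl"
        by (auto simp: ys_def xs)
      then show "ik \<in> {ik \<in> idx. arrival_time \<omega> ik \<le> t}"
      proof cases
        case 1
        then show ?thesis using False time_a a by simp
      next
        case 2
        then have "jl \<in> idx" using S by blast
        then have "ik \<in> idx" using 2 skip_image[of ?a] by blast
        then show ?thesis using 2 time[OF \<open>jl \<in> idx\<close>] by (simp add: S_def)
      qed
    next
      fix ik assume ik: "ik \<in> {ik \<in> idx. arrival_time \<omega> ik \<le> t}"
      show "ik \<in> set ys"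
      proof (cases "ik = (?a, 0)")
        case False
        then have "ik \<in> skip ?a ` idx" using ik skip_image[of ?a] by blast
        then obtain jl where jl: "jl \<in> idx" "ik = skip ?a jl" by blast
        then have "jl \<in> S" using ik time[OF jl(1)] by (simp add: S_def)
        then show ?thesis using jl by (simp add: ys_def xs)
      qed (simp add: ys_def)
  qed
  moreover have "sorted (map (arrival_time \<omega>) ys)"
  proof -
    have eq: "map (arrival_time \<omega>) (map (skip ?a) xs) = map (\<lambda>r. next_delay \<omega> + r) (map (arrival_time ?\<omega>) xs)"
      using xs(1) S(1) time by (auto simp: subset_iff)
    have "sorted (map (\<lambda>r. next_delay \<omega> + r) (map (arrival_time ?\<omega>) xs))"
      using xs(2) by (simp add: sorted_map del: map_map)
    moreover have "next_delay \<omega> \<le> arrival_time \<omega> (skip ?a ik)" if "ik \<in> set xs" for ik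
    proof -
      have "skip ?a ik \<in> idx" using that xs(1) S(1) skip_image[of ?a] by blast
      then show ?thesis by (rule next_delay_le_arrival[OF \<omega>])
    qed
    ultimately show ?thesis
      unfolding ys_def list.map(2) time_a eq[symmetric] sorted_simps by auto
  qed
  moreover have "distinct ys"
    unfolding ys_def using xs(3) inj_on_subset[OF inj_skip, of _ ?a]
    by (auto simp: distinct_map skip_def split: if_splits)
  moreover have "set ys \<subseteq> idx" using calculation(1) by blast
  ultimately have "sorted_key_list_of_set (arrival_time \<omega>) {ik \<in> idx. arrival_time \<omega> ik \<le> t} = ys"
    using A.idem_if_sorted_distinct[unfolded sorted_eq, of ys] by simp
  then have "arrivals_until V \<omega> t = map fst ys" by (simp add: arrivals_until_def)
  also have "\<dots> = ?a # map fst xs" by (simp add: ys_def comp_def)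
  also have "map fst xs = arrivals_until V ?\<omega> (t - next_delay \<omega>)"
    by (simp add: arrivals_until_def xs_def S_def)
  finally show ?thesis using False by simp
  qed
qed

text \<open>If the first \<open>n\<close> arrivals occur up to time \<open>t\<close> for every \<open>n\<close>, the finite list of arrivals until
  \<open>t\<close> has more than any number of elements.\<close>

lemma no_explosion_path:
  assumes \<omega>: "\<omega> \<in> regular_paths"
  shows "(SUP n. \<Sum>k<n. ennreal (next_delay ((remaining ^^ k) \<omega>))) = \<infinity>"
proof (rule ccontr)
  have reg: "(remaining ^^ k) \<omega> \<in> regular_paths" if "\<omega> \<in> regular_paths" for k \<omega>
    using that by (induction k) (auto intro: remaining_regular)
  have count: "n \<le> length (arrivals_until V \<omega> t)"
    if "\<omega> \<in> regular_paths" "(\<Sum>k<n. next_delay ((remaining ^^ k) \<omega>)) \<le> t" for n \<omega> t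
    using that
  proof (induction n arbitrary: \<omega> t)
    case (Suc n)
    have eq: "(\<Sum>k<Suc n. next_delay ((remaining ^^ k) \<omega>)) =
        next_delay \<omega> + (\<Sum>k<n. next_delay ((remaining ^^ k) (remaining \<omega>)))"
      by (simp add: sum.lessThan_Suc_shift funpow_swap1 del: sum.lessThan_Suc)
    have "0 \<le> (\<Sum>k<n. next_delay ((remaining ^^ k) (remaining \<omega>)))"
      by (intro sum_nonneg less_imp_le next_delay_pos reg remaining_regular Suc.prems(1))
    then have "\<not> t < next_delay \<omega>" using Suc.prems(2) unfolding eq by simp
    moreover have "n \<le> length (arrivals_until V (remaining \<omega>) (t - next_delay \<omega>))"
      using Suc.prems(2) unfolding eq by (intro Suc.IH remaining_regular Suc.prems(1)) simp
    ultimately show ?case using arrivals_until_rec[OF Suc.prems(1), of t] by simp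
  qed simp
  assume "(SUP n. \<Sum>k<n. ennreal (next_delay ((remaining ^^ k) \<omega>))) \<noteq> \<infinity>"
  then obtain t where t: "0 \<le> t" "(SUP n. \<Sum>k<n. ennreal (next_delay ((remaining ^^ k) \<omega>))) = ennreal t"
    by (cases "SUP n. \<Sum>k<n. ennreal (next_delay ((remaining ^^ k) \<omega>))") auto
  have "n \<le> length (arrivals_until V \<omega> t)" for n
  proof (rule count[OF \<omega>])
    have "ennreal (\<Sum>k<n. next_delay ((remaining ^^ k) \<omega>)) = (\<Sum>k<n. ennreal (next_delay ((remaining ^^ k) \<omega>)))"
      by (intro sum_ennreal[symmetric] less_imp_le next_delay_pos reg \<omega>)
    also have "\<dots> \<le> ennreal t" unfolding t(2)[symmetric] by (intro SUP_upper) simp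
    finally show "(\<Sum>k<n. next_delay ((remaining ^^ k) \<omega>)) \<le> t" using t(1) by simp
  qed
  from this[of "Suc (length (arrivals_until V \<omega> t))"] show False by simp
qed

lemma fcfm_process_rec:
  assumes "\<omega> \<in> regular_paths"
  shows "fcfm_process V E z t \<omega> = (if t < next_delay \<omega> then z
    else fcfm_process V E (fcfm_step E z (next_class \<omega>)) (t - next_delay \<omega>) (remaining \<omega>))"
  unfolding fcfm_process_def by (subst arrivals_until_rec[OF assms]) simp

lemma fcfm_process_0: "\<omega> \<in> regular_paths \<Longrightarrow> fcfm_process V E z 0 \<omega> = z"
  using fcfm_process_rec[of \<omega> E z 0] next_delay_pos[of \<omega>] by simp

lemma first_visit_rec:
  assumes \<omega>: "\<omega> \<in> regular_paths" and "z \<noteq> x"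
  shows "(INF t\<in>{t. 0 \<le> t \<and> fcfm_process V E z t \<omega> = x}. ennreal t) = ennreal (next_delay \<omega>) +
    (INF t\<in>{t. 0 \<le> t \<and> fcfm_process V E (fcfm_step E z (next_class \<omega>)) t (remaining \<omega>) = x}. ennreal t)"
proof (rule INF_shift)
  let ?B = "{t. 0 \<le> t \<and> fcfm_process V E (fcfm_step E z (next_class \<omega>)) t (remaining \<omega>) = x}"
  show "{t. 0 \<le> t \<and> fcfm_process V E z t \<omega> = x} = (\<lambda>t. next_delay \<omega> + t) ` ?B"
  proof (intro equalityI subsetI)
    fix t assume "t \<in> {t. 0 \<le> t \<and> fcfm_process V E z t \<omega> = x}"
    then have "t - next_delay \<omega> \<in> ?B"
      using fcfm_process_rec[OF \<omega>, of E z t] \<open>z \<noteq> x\<close> by (auto split: if_splits)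
    then show "t \<in> (\<lambda>t. next_delay \<omega> + t) ` ?B" by (intro image_eqI[of _ _ "t - next_delay \<omega>"]) auto
  next
    fix t assume "t \<in> (\<lambda>t. next_delay \<omega> + t) ` ?B"
    then show "t \<in> {t. 0 \<le> t \<and> fcfm_process V E z t \<omega> = x}"
      using next_delay_pos[OF \<omega>] by (auto simp: fcfm_process_rec[OF \<omega>, of E z])
  qed
qed (use next_delay_pos[OF \<omega>] in \<open>simp add: ennreal_plus less_imp_le\<close>)

text \<open>The state changes at every arrival, since the length of the store does. So the process leaves \<open>x\<close>
  exactly at the first arrival, and the first return is the first visit to \<open>x\<close> after it.\<close>

lemma first_return_rec:
  assumes \<omega>: "\<omega> \<in> regular_paths"
  shows "(INF t\<in>{t. fcfm_process V E x t \<omega> = x \<and> (\<exists>s. 0 \<le> s \<and> s < t \<and> fcfm_process V E x s \<omega> \<noteq> x)}. ennreal t) =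
    ennreal (next_delay \<omega>) +
    (INF t\<in>{t. 0 \<le> t \<and> fcfm_process V E (fcfm_step E x (next_class \<omega>)) t (remaining \<omega>) = x}. ennreal t)"
proof (rule INF_shift)
  let ?y = "fcfm_step E x (next_class \<omega>)"
  let ?B = "{t. 0 \<le> t \<and> fcfm_process V E ?y t (remaining \<omega>) = x}"
  let ?A = "{t. fcfm_process V E x t \<omega> = x \<and> (\<exists>s. 0 \<le> s \<and> s < t \<and> fcfm_process V E x s \<omega> \<noteq> x)}"
  have rec: "fcfm_process V E x t \<omega> = (if t < next_delay \<omega> then x else fcfm_process V E ?y (t - next_delay \<omega>) (remaining \<omega>))" for t
    by (rule fcfm_process_rec[OF \<omega>])
  have y: "fcfm_process V E ?y 0 (remaining \<omega>) \<noteq> x"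
    using fcfm_step_neq by (simp add: fcfm_process_0[OF remaining_regular[OF \<omega>]])
  show "?A = (\<lambda>t. next_delay \<omega> + t) ` ?B"
  proof (intro equalityI subsetI)
    fix t assume "t \<in> ?A"
    then obtain s where s: "fcfm_process V E x t \<omega> = x" "s < t" "fcfm_process V E x s \<omega> \<noteq> x" by blast
    then have "next_delay \<omega> \<le> s" using rec[of s] by (auto split: if_splits)
    then have "t - next_delay \<omega> \<in> ?B" using s rec[of t] by (auto split: if_splits)
    then show "t \<in> (\<lambda>t. next_delay \<omega> + t) ` ?B" by (intro image_eqI[of _ _ "t - next_delay \<omega>"]) auto
  next
    fix t assume "t \<in> (\<lambda>t. next_delay \<omega> + t) ` ?B"
    then obtain u where u: "t = next_delay \<omega> + u" "u \<in> ?B" by blast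
    then have "u \<noteq> 0" using y by auto
    then have "0 < u" using u by simp
    then have "next_delay \<omega> < t" using u by simp
    moreover have "fcfm_process V E x (next_delay \<omega>) \<omega> \<noteq> x" using rec[of "next_delay \<omega>"] y by simp
    moreover have "fcfm_process V E x t \<omega> = x" using u rec[of t] by simp
    ultimately show "t \<in> ?A" using next_delay_pos[OF \<omega>] by (auto intro: less_imp_le)
  qed
qed (use next_delay_pos[OF \<omega>] in \<open>simp add: ennreal_plus less_imp_le\<close>)

end

section \<open>Continuous time: the regeneration law\<close>

abbreviation exp_law :: "real \<Rightarrow> real measure" where
  "exp_law l \<equiv> density lborel (\<lambda>x. ennreal (exponential_density l x))"

lemma measurable_exponential_density [measurable]: "exponential_density l \<in> borel_measurable borel"
  unfolding exponential_density_def[abs_def] by measurable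

text \<open>An arrival after time \<open>s\<close> seen from \<open>s\<close>. The endpoint is excluded so that the event fits the strict
  comparison of first arrival times; it has probability 0.\<close>

lemma exp_law_memoryless:
  assumes l: "0 < l" and s: "0 \<le> s" and A [measurable]: "A \<in> sets borel"
  shows "emeasure (exp_law l) {y. y - s \<in> A \<and> s < y} = ennreal (exp (- (l * s))) * emeasure (exp_law l) A"
proof -
  have [measurable]: "{y. y - s \<in> A \<and> s < y} \<in> sets borel" by measurable
  have "emeasure (exp_law l) {y. y - s \<in> A \<and> s < y} =
      (\<integral>\<^sup>+y. ennreal (exponential_density l y) * indicator {y. y - s \<in> A \<and> s < y} y \<partial>lborel)"
    by (subst emeasure_density) auto
  also have "\<dots> = (\<integral>\<^sup>+x. ennreal (exponential_density l (s + x)) * indicator {y. y - s \<in> A \<and> s < y} (s + x) \<partial>lborel)"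
    by (subst nn_integral_real_affine[where c = 1 and t = s]) auto
  \<comment> \<open>At 0 the left integrand vanishes while the right one may be positive; elsewhere they agree.\<close>
  also have "\<dots> = (\<integral>\<^sup>+x. ennreal (exp (- (l * s))) * (ennreal (exponential_density l x) * indicator A x) \<partial>lborel)"
  proof (intro nn_integral_cong_AE)
    have "AE x in lborel. x \<noteq> (0 :: real)" by (rule AE_lborel_singleton)
    then show "AE x in lborel. ennreal (exponential_density l (s + x)) * indicator {y. y - s \<in> A \<and> s < y} (s + x) =
        ennreal (exp (- (l * s))) * (ennreal (exponential_density l x) * indicator A x)"
    proof eventually_elim
      case (elim x)
      show ?case
      proof (cases "0 < x \<and> x \<in> A")
        case True
        then have "exponential_density l (s + x) = exp (- (l * s)) * exponential_density l x"
          using s l by (simp add: exponential_density_def exp_add[symmetric] algebra_simps)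
        then show ?thesis using True l by (simp add: ennreal_mult exponential_density_nonneg)
      next
        case False
        then show ?thesis using elim by (cases "x < 0") (auto simp: exponential_density_def indicator_def)
      qed
    qed
  qed
  also have "\<dots> = ennreal (exp (- (l * s))) * emeasure (exp_law l) A"
    by (simp add: nn_integral_cmult emeasure_density)
  finally show ?thesis .
qed

lemma prod_emb_Collect:
  assumes "J \<subseteq> I"
  shows "prod_emb I M J (Pi\<^sub>E J A) = {x \<in> space (PiM I M). \<forall>i\<in>J. x i \<in> A i}"
  using assms unfolding prod_emb_def by (auto simp: space_PiM PiE_iff extensional_def)

text \<open>The probability that the first arrival with rate \<open>l\<close> comes before one with total rate \<open>c\<close>.\<close>

lemma nn_integral_exp_law:
  assumes l: "0 < l" and c: "0 \<le> c"
  shows "(\<integral>\<^sup>+s. ennreal (exp (- (c * s))) \<partial>exp_law l) = ennreal (l / (l + c))"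
proof -
  interpret P: prob_space "exp_law (l + c)"
    using l c by (intro prob_space_exponential_density) simp
  have "(\<integral>\<^sup>+s. ennreal (exp (- (c * s))) \<partial>exp_law l) =
      (\<integral>\<^sup>+s. ennreal (exponential_density l s) * ennreal (exp (- (c * s))) \<partial>lborel)"
    by (subst nn_integral_density) auto
  also have "\<dots> = (\<integral>\<^sup>+s. ennreal (l / (l + c)) * ennreal (exponential_density (l + c) s) \<partial>lborel)"
  proof (intro nn_integral_cong)
    fix s
    have "exponential_density l s * exp (- (c * s)) = l / (l + c) * exponential_density (l + c) s"
    proof (cases "s < 0")
      case False
      have "exp (- s * l) * exp (- (c * s)) = exp (- s * (l + c))"
        by (simp add: exp_add[symmetric] algebra_simps)
      then show ?thesis using False l c by (simp add: exponential_density_def mult.assoc)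
    qed (simp add: exponential_density_def)
    then show "ennreal (exponential_density l s) * ennreal (exp (- (c * s))) =
        ennreal (l / (l + c)) * ennreal (exponential_density (l + c) s)"
      using l c by (simp add: ennreal_mult[symmetric] exponential_density_nonneg)
  qed
  also have "\<dots> = ennreal (l / (l + c)) * emeasure (exp_law (l + c)) (space (exp_law (l + c)))"
    by (simp add: nn_integral_cmult emeasure_density)
  finally show ?thesis by (simp only: P.emeasure_space_1 mult_1_right)
qed

lemma AE_exp_law_pos: "0 < l \<Longrightarrow> AE s in exp_law l. 0 < s"
proof -
  assume "0 < l"
  have "AE s in lborel. s \<noteq> (0 :: real)" by (rule AE_lborel_singleton)
  then have "AE s in lborel. 0 < ennreal (exponential_density l s) \<longrightarrow> 0 < s"
    by eventually_elim (auto simp: exponential_density_def split: if_splits)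
  then show ?thesis by (subst AE_density) auto
qed

lemma exp_law_atMost_less_1:
  assumes "0 < l"
  shows "measure (exp_law l) {..1} < 1"
proof -
  interpret P: prob_space "exp_law l" by (rule prob_space_exponential_density[OF assms])
  have "{y. y - 1 \<in> UNIV \<and> 1 < y} = {1 :: real<..}" by auto
  then have "emeasure (exp_law l) {1<..} = ennreal (exp (- (l * 1))) * emeasure (exp_law l) UNIV"
    using exp_law_memoryless[of l 1 UNIV] assms by simp
  also have "emeasure (exp_law l) UNIV = 1" using P.emeasure_space_1 by simp
  finally have "P.prob {1<..} = exp (- l)" by (simp add: measure_def)
  moreover have "{..1 :: real} = space (exp_law l) - {1<..}" by auto
  ultimately show ?thesis using P.prob_compl[of "{1<..}"] by simp
qed

context poisson_arrivals
begin

abbreviation law :: "'a \<times> nat \<Rightarrow> real measure" where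
  "law ik \<equiv> exp_law (\<mu> (fst ik))"

abbreviation paths :: "('a \<times> nat \<Rightarrow> real) measure" where
  "paths \<equiv> interarrival_space V \<mu>"

lemma paths_eq: "paths = PiM idx law"
  by (simp add: interarrival_space_def)

lemma prob_law: "ik \<in> idx \<Longrightarrow> prob_space (law ik)"
  using \<mu>_pos by (auto intro: prob_space_exponential_density)

lemma sets_law [measurable_cong]: "sets (law ik) = sets borel"
  by simp

lemma sets_paths_cong [measurable_cong]: "sets paths = sets (PiM idx (\<lambda>_. borel))"
  unfolding paths_eq by (intro sets_PiM_cong) auto

lemma prob_paths: "prob_space paths"
  unfolding paths_eq by (rule prob_space_PiM) (rule prob_law)

lemma measurable_coord [measurable]: "ik \<in> idx \<Longrightarrow> (\<lambda>\<omega>. \<omega> ik) \<in> borel_measurable paths"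
  by (subst measurable_cong_sets[OF sets_paths_cong refl]) (rule measurable_component_singleton)

lemma measurable_arrival_time [measurable]:
  "i \<in> V \<Longrightarrow> (\<lambda>\<omega>. arrival_time \<omega> (i, k)) \<in> borel_measurable paths"
  unfolding arrival_time_def by (intro borel_measurable_sum measurable_coord) auto

definition first_is :: "'a \<Rightarrow> ('a \<times> nat \<Rightarrow> real) set" where
  "first_is a = {\<omega> \<in> space paths. \<forall>j\<in>V - {a}. \<omega> (a, 0) < \<omega> (j, 0)}"

lemma measurable_first_is [measurable]: "a \<in> V \<Longrightarrow> first_is a \<in> sets paths"
  unfolding first_is_def using finV by (intro sets.sets_Collect_finite_All) auto

lemma measurable_shift [measurable]: "a \<in> V \<Longrightarrow> shift a \<in> paths \<rightarrow>\<^sub>M paths"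
proof -
  assume a: "a \<in> V"
  have "shift a \<in> paths \<rightarrow>\<^sub>M PiM idx (\<lambda>_. borel)"
    unfolding shift_def
  proof (rule measurable_restrict)
    fix ik assume "ik \<in> idx"
    then obtain i k where "ik = (i, k)" "i \<in> V" by auto
    then show "(\<lambda>\<omega>. case ik of (i, k) \<Rightarrow> if i = a then \<omega> (a, Suc k)
        else if k = 0 then \<omega> (i, 0) - \<omega> (a, 0) else \<omega> (i, k)) \<in> borel_measurable paths"
      using a by (auto intro!: borel_measurable_diff measurable_coord)
  qed
  then show ?thesis by (subst measurable_cong_sets[OF refl sets_paths_cong])
qed

lemma paths_pair:
  assumes a: "a \<in> V"
  shows "distr (law (a, 0) \<Otimes>\<^sub>M PiM (idx - {(a, 0)}) law) paths (\<lambda>(x, X). X((a, 0) := x)) = paths" (is ?eq)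
    and "(\<lambda>(x, X). X((a, 0) := x)) \<in> (law (a, 0) \<Otimes>\<^sub>M PiM (idx - {(a, 0)}) law) \<rightarrow>\<^sub>M paths" (is ?meas)
proof -
  let ?I = "idx - {(a, 0)}"
  have ins: "insert (a, 0) ?I = idx" using a by auto
  have "distr (law (a, 0) \<Otimes>\<^sub>M PiM ?I law) (PiM (insert (a, 0) ?I) law) (\<lambda>(x, X). X((a, 0) := x)) =
      PiM (insert (a, 0) ?I) law"
    by (rule distr_pair_PiM_eq_PiM) (rule prob_law, use a in blast)+
  then show ?eq by (simp only: ins paths_eq)
  have "(\<lambda>z. (snd z)((a, 0) := fst z)) \<in> (law (a, 0) \<Otimes>\<^sub>M PiM ?I law) \<rightarrow>\<^sub>M PiM (insert (a, 0) ?I) law"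
    by (rule measurable_fun_upd[where J = ?I, OF _ measurable_snd measurable_fst]) simp
  then show ?meas by (simp only: ins paths_eq case_prod_unfold)
qed

text \<open>The first interarrival time of class \<open>a\<close> is separated from all other coordinates. Conditioning
  on it makes the event that \<open>a\<close> comes first a product event; conditioning on the others shows that
  simultaneous arrivals have probability 0.\<close>

lemma paths_split:
  assumes a: "a \<in> V" and S: "S \<in> sets paths"
  shows "emeasure paths S = (\<integral>\<^sup>+s. emeasure (PiM (idx - {(a, 0)}) law)
     {X \<in> space (PiM (idx - {(a, 0)}) law). X((a, 0) := s) \<in> S} \<partial>exp_law (\<mu> a))" (is ?first)
    and "emeasure paths S = (\<integral>\<^sup>+X. emeasure (exp_law (\<mu> a)) {s. X((a, 0) := s) \<in> S}
      \<partial>PiM (idx - {(a, 0)}) law)" (is ?second)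
proof -
  let ?N = "PiM (idx - {(a, 0)}) law"
  let ?S = "(\<lambda>(x, X). X((a, 0) := x)) -` S \<inter> space (law (a, 0) \<Otimes>\<^sub>M ?N)"
  interpret N: prob_space ?N by (rule prob_space_PiM) (rule prob_law, blast)
  interpret L: prob_space "law (a, 0)" using a by (intro prob_law) auto
  interpret LN: pair_prob_space "law (a, 0)" ?N ..
  have meas: "?S \<in> sets (law (a, 0) \<Otimes>\<^sub>M ?N)"
    by (rule measurable_sets[OF paths_pair(2)[OF a] S])
  have eq: "emeasure paths S = emeasure (law (a, 0) \<Otimes>\<^sub>M ?N) ?S"
    by (subst paths_pair(1)[OF a, symmetric], rule emeasure_distr[OF paths_pair(2)[OF a] S])
  have "emeasure paths S = (\<integral>\<^sup>+s. emeasure ?N (Pair s -` ?S) \<partial>law (a, 0))"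
    unfolding eq by (rule N.emeasure_pair_measure_alt[OF meas])
  also have "\<dots> = (\<integral>\<^sup>+s. emeasure ?N {X \<in> space ?N. X((a, 0) := s) \<in> S} \<partial>law (a, 0))"
    by (intro nn_integral_cong arg_cong2[where f = emeasure] refl) (auto simp: space_pair_measure)
  finally show ?first by simp
  have "emeasure paths S = (\<integral>\<^sup>+X. emeasure (law (a, 0)) ((\<lambda>s. (s, X)) -` ?S) \<partial>?N)"
    unfolding eq by (rule LN.emeasure_pair_measure_alt2[OF meas])
  also have "\<dots> = (\<integral>\<^sup>+X. emeasure (law (a, 0)) {s. X((a, 0) := s) \<in> S} \<partial>?N)"
    by (intro nn_integral_cong arg_cong2[where f = emeasure] refl) (auto simp: space_pair_measure)
  finally show ?second by simp
qed

text \<open>Given that the first arrival of class \<open>a\<close> is at time \<open>s\<close>, the event constrains the other coordinates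
  independently. The first arrival time of another class has to exceed \<open>s\<close>, and its excess has to
  lie in a given set; by lack of memory this contributes \<open>exp (- \<mu> i * s)\<close> times the unconditioned
  probability. All other coordinates contribute their unconditioned probability. Integration over
  \<open>s\<close> turns the product of the exponential factors into \<open>\<mu> a / sum \<mu> V\<close>.\<close>

lemma regenerate_box:
  assumes a: "a \<in> V" and J: "finite J" "J \<subseteq> idx" and A: "\<And>ik. ik \<in> J \<Longrightarrow> A ik \<in> sets borel"
  shows "emeasure paths (first_is a \<inter> (shift a -` prod_emb idx law J (Pi\<^sub>E J A) \<inter> space paths)) =
    ennreal (\<mu> a / sum \<mu> V) * (\<Prod>ik\<in>J. emeasure (law ik) (A ik))"
    (is "emeasure paths ?S = _ * ?P")
proof -
  let ?I = "idx - {(a, 0)}"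
  let ?N = "PiM ?I law"
  \<comment> \<open>\<open>J0\<close> adds the indices compared with \<open>\<omega> (a, 0)\<close>; \<open>C s ik\<close> is the constraint on coordinate \<open>skip a ik\<close>
    when \<open>\<omega> (a, 0) = s\<close>, and \<open>e s ik\<close> the resulting factor.\<close>
  define J0 where "J0 = J \<union> (V - {a}) \<times> {0}"
  define A' where "A' = (\<lambda>ik. if ik \<in> J then A ik else UNIV)"
  define C where "C = (\<lambda>s ik. if fst ik \<noteq> a \<and> snd ik = 0 then {y. y - s \<in> A' ik \<and> s < y} else A' ik)"
  define e where "e = (\<lambda>s ik. if fst ik \<noteq> a \<and> snd ik = (0 :: nat) then ennreal (exp (- (\<mu> (fst ik) * s))) else 1)"
  define c where "c = sum \<mu> (V - {a})"
  have J0: "finite J0" "J0 \<subseteq> idx" using J finV by (auto simp: J0_def)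
  have A'm [measurable]: "A' ik \<in> sets borel" for ik using A by (auto simp: A'_def)
  have Cm: "C s ik \<in> sets borel" for s ik
    unfolding C_def by (cases "fst ik \<noteq> a \<and> snd ik = 0") (simp_all only: simp_thms if_True if_False, measurable)
  have embm: "prod_emb idx law J (Pi\<^sub>E J A) \<in> sets paths"
    unfolding paths_eq using J A by (intro sets_PiM_I) auto
  have S: "?S \<in> sets paths"
    by (rule sets.Int[OF measurable_first_is[OF a] measurable_sets[OF measurable_shift[OF a] embm]])
  have fibre: "emeasure ?N {X \<in> space ?N. X((a, 0) := s) \<in> ?S} = (\<Prod>ik\<in>J0. emeasure (law ik) (C s ik))" for s
  proof -
    define B where "B = (\<lambda>jl. C s (inv (skip a) jl))"
    have B: "B (skip a ik) = C s ik" for ik by (simp add: B_def inj_skip)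
    have in_S: "X((a, 0) := s) \<in> ?S \<longleftrightarrow> (\<forall>ik\<in>J0. X (skip a ik) \<in> C s ik)" if X: "X \<in> space ?N" for X
    proof -
      let ?w = "X((a, 0) := s)"
      have w: "?w \<in> space paths" using X a by (auto simp: paths_eq space_PiM PiE_iff extensional_def)
      have "shift a ?w \<in> space paths" using w measurable_space[OF measurable_shift[OF a]] by blast
      then have "?w \<in> ?S \<longleftrightarrow> (\<forall>j\<in>V - {a}. s < X (j, 0)) \<and> (\<forall>ik\<in>J. shift a ?w ik \<in> A ik)"
        using w by (auto simp: prod_emb_Collect[OF J(2)] first_is_def paths_eq)
      also have "(\<forall>ik\<in>J. shift a ?w ik \<in> A ik) \<longleftrightarrow> (\<forall>ik\<in>J0. shift a ?w ik \<in> A' ik)"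
        by (auto simp: J0_def A'_def)
      also have "(\<forall>j\<in>V - {a}. s < X (j, 0)) \<longleftrightarrow> (\<forall>ik\<in>J0. fst ik \<noteq> a \<and> snd ik = 0 \<longrightarrow> s < X ik)"
      proof (intro iffI ballI impI)
        fix ik assume "\<forall>j\<in>V - {a}. s < X (j, 0)" "ik \<in> J0" "fst ik \<noteq> a \<and> snd ik = 0"
        then show "s < X ik" using J0(2) by (cases ik) auto
      next
        fix j assume *: "\<forall>ik\<in>J0. fst ik \<noteq> a \<and> snd ik = 0 \<longrightarrow> s < X ik" and "j \<in> V - {a}"
        then have "(j, 0) \<in> J0" "j \<noteq> a" by (auto simp: J0_def)
        then show "s < X (j, 0)" using * by fastforce
      qed
      finally have "?w \<in> ?S \<longleftrightarrow> (\<forall>ik\<in>J0. (fst ik \<noteq> a \<and> snd ik = 0 \<longrightarrow> s < X ik) \<and> shift a ?w ik \<in> A' ik)"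
        by blast
      moreover have "(fst ik \<noteq> a \<and> snd ik = 0 \<longrightarrow> s < X ik) \<and> shift a ?w ik \<in> A' ik \<longleftrightarrow> X (skip a ik) \<in> C s ik"
        if "ik \<in> J0" for ik
      proof (cases ik)
        case (Pair i k)
        have "ik \<in> idx" using J0(2) that by blast
        then show ?thesis using Pair by (auto simp: shift_def skip_def C_def)
      qed
      ultimately show ?thesis by blast
    qed
    have K: "skip a ` J0 \<subseteq> ?I" using skip_image[of a] J0(2) by blast
    have "{X \<in> space ?N. X((a, 0) := s) \<in> ?S} = {X \<in> space ?N. \<forall>jl\<in>skip a ` J0. X jl \<in> B jl}"
      using in_S B by auto
    also have "\<dots> = prod_emb ?I law (skip a ` J0) (Pi\<^sub>E (skip a ` J0) B)"
      by (rule prod_emb_Collect[OF K, symmetric])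
    finally have "emeasure ?N {X \<in> space ?N. X((a, 0) := s) \<in> ?S} = (\<Prod>jl\<in>skip a ` J0. emeasure (law jl) (B jl))"
      using K J0(1) Cm by (simp only:) (intro emeasure_PiM_emb prob_law, auto simp: B_def)
    also have "\<dots> = (\<Prod>ik\<in>J0. emeasure (law ik) (C s ik))"
      by (subst prod.reindex) (auto simp: B intro: inj_on_subset[OF inj_skip])
    finally show ?thesis .
  qed
  have eprod: "(\<Prod>ik\<in>J0. e s ik) = ennreal (exp (- (c * s)))" for s
  proof -
    have "(\<Prod>ik\<in>J0. e s ik) = (\<Prod>ik\<in>(V - {a}) \<times> {0 :: nat}. ennreal (exp (- (\<mu> (fst ik) * s))))"
    proof (rule prod.mono_neutral_cong_right[OF J0(1)])
      show "\<forall>ik\<in>J0 - (V - {a}) \<times> {0}. e s ik = 1"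
        using J0(2) by (auto simp: e_def)
    qed (auto simp: e_def J0_def)
    also have "\<dots> = (\<Prod>i\<in>V - {a}. ennreal (exp (- (\<mu> i * s))))"
      by (rule prod.reindex_bij_witness[where i = "\<lambda>i. (i, 0)" and j = fst]) auto
    also have "\<dots> = ennreal (exp (- (c * s)))"
      using finV by (simp add: prod_ennreal exp_sum[symmetric] c_def sum_negf sum_distrib_right)
    finally show ?thesis .
  qed
  have Aprod: "(\<Prod>ik\<in>J0. emeasure (law ik) (A' ik)) = ?P"
  proof (rule prod.mono_neutral_cong_right)
    show "\<forall>ik\<in>J0 - J. emeasure (law ik) (A' ik) = 1"
    proof
      fix ik assume ik: "ik \<in> J0 - J"
      then interpret prob_space "law ik" using J0(2) by (intro prob_law) auto
      show "emeasure (law ik) (A' ik) = 1" using ik emeasure_space_1 by (simp add: A'_def)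
    qed
  qed (use J0(1) in \<open>auto simp: J0_def A'_def\<close>)
  have Cprod: "(\<Prod>ik\<in>J0. emeasure (law ik) (C s ik)) = ennreal (exp (- (c * s))) * ?P" if "0 < s" for s
  proof -
    have "emeasure (law ik) (C s ik) = e s ik * emeasure (law ik) (A' ik)" if "ik \<in> J0" for ik
      using exp_law_memoryless[of "\<mu> (fst ik)" s "A' ik"] \<open>0 < s\<close> J0(2) that \<mu>_pos
      by (auto simp: C_def e_def)
    then have "(\<Prod>ik\<in>J0. emeasure (law ik) (C s ik)) = (\<Prod>ik\<in>J0. e s ik * emeasure (law ik) (A' ik))"
      by (rule prod.cong[OF refl])
    then show ?thesis by (simp only: prod.distrib eprod Aprod)
  qed
  have "emeasure paths ?S = (\<integral>\<^sup>+s. (\<Prod>ik\<in>J0. emeasure (law ik) (C s ik)) \<partial>exp_law (\<mu> a))"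
    unfolding paths_split(1)[OF a S] fibre ..
  also have "\<dots> = (\<integral>\<^sup>+s. ennreal (exp (- (c * s))) * ?P \<partial>exp_law (\<mu> a))"
    using AE_exp_law_pos[OF \<mu>_pos[OF a]] by (intro nn_integral_cong_AE) (auto simp: Cprod elim: eventually_mono)
  also have "\<dots> = (\<integral>\<^sup>+s. ennreal (exp (- (c * s))) \<partial>exp_law (\<mu> a)) * ?P"
    by (rule nn_integral_multc) simp
  also have "(\<integral>\<^sup>+s. ennreal (exp (- (c * s))) \<partial>exp_law (\<mu> a)) = ennreal (\<mu> a / (\<mu> a + c))"
    using \<mu>_pos a by (intro nn_integral_exp_law) (auto simp: c_def less_imp_le intro!: sum_nonneg)
  also have "\<mu> a + c = sum \<mu> V"
    unfolding c_def using sum.remove[OF finV a, of \<mu>] by simp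
  finally show ?thesis .
qed

lemma regenerate_shift:
  assumes a: "a \<in> V" and f [measurable]: "f \<in> borel_measurable paths"
  shows "(\<integral>\<^sup>+\<omega>. indicator (first_is a) \<omega> * f (shift a \<omega>) \<partial>paths) =
    ennreal (\<mu> a / sum \<mu> V) * (\<integral>\<^sup>+\<omega>. f \<omega> \<partial>paths)"
proof -
  interpret P: prob_space paths by (rule prob_paths)
  note [measurable] = measurable_first_is[OF a] measurable_shift[OF a]
  define Q where "Q = distr (density paths (indicator (first_is a))) paths (shift a)"
  have Q: "emeasure Q X = emeasure paths (first_is a \<inter> (shift a -` X \<inter> space paths))" if "X \<in> sets paths" for X
    using that measurable_sets[OF measurable_shift[OF a] that]
    by (simp add: Q_def emeasure_distr emeasure_density nn_integral_indicator indicator_inter_arith[symmetric])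
  have "scale_measure (ennreal (\<mu> a / sum \<mu> V)) paths = Q"
  proof (rule measure_eqI_PiM_infinite[where I = idx and M = law])
    show "sets (scale_measure (ennreal (\<mu> a / sum \<mu> V)) paths) = sets (PiM idx law)"
      by (simp add: paths_eq)
    show "sets Q = sets (PiM idx law)" by (simp add: Q_def paths_eq)
    show "finite_measure (scale_measure (ennreal (\<mu> a / sum \<mu> V)) paths)"
      by (rule finite_measureI) (simp add: space_scale_measure P.emeasure_space_1)
    fix A J assume J: "finite J" "J \<subseteq> idx" and A: "\<And>ik. ik \<in> J \<Longrightarrow> A ik \<in> sets (law ik)"
    have "prod_emb idx law J (Pi\<^sub>E J A) \<in> sets paths"
      unfolding paths_eq using J A by (intro sets_PiM_I) auto
    then have "emeasure Q (prod_emb idx law J (Pi\<^sub>E J A)) = ennreal (\<mu> a / sum \<mu> V) * (\<Prod>ik\<in>J. emeasure (law ik) (A ik))"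
      using regenerate_box[OF a J, of A] A by (simp add: Q)
    moreover have "emeasure paths (prod_emb idx law J (Pi\<^sub>E J A)) = (\<Prod>ik\<in>J. emeasure (law ik) (A ik))"
      unfolding paths_eq using J A prob_law by (intro emeasure_PiM_emb) auto
    ultimately show "emeasure (scale_measure (ennreal (\<mu> a / sum \<mu> V)) paths) (prod_emb idx law J (Pi\<^sub>E J A)) =
        emeasure Q (prod_emb idx law J (Pi\<^sub>E J A))"
      by simp
  qed
  then have "ennreal (\<mu> a / sum \<mu> V) * (\<integral>\<^sup>+\<omega>. f \<omega> \<partial>paths) = (\<integral>\<^sup>+\<omega>. f \<omega> \<partial>Q)"
    using nn_integral_scale_measure[OF f] by metis
  also have "\<dots> = (\<integral>\<^sup>+\<omega>. indicator (first_is a) \<omega> * f (shift a \<omega>) \<partial>paths)"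
    unfolding Q_def by (simp add: nn_integral_distr nn_integral_density)
  finally show ?thesis by simp
qed


lemma AE_pos: "AE \<omega> in paths. \<forall>ik\<in>idx. 0 < \<omega> ik"
proof (rule AE_ball_countable')
  show "countable idx" using countable_finite[OF finV] by auto
  fix ik assume "ik \<in> idx"
  then show "AE \<omega> in paths. 0 < \<omega> ik"
    unfolding paths_eq using \<mu>_pos AE_exp_law_pos
    by (intro AE_PiM_component prob_law) auto
qed

text \<open>Infinitely many interarrival times exceed 1, so that the arrival times of a class are
  unbounded: the probability that \<open>K\<close> successive ones are at most 1 is \<open>q ^ K\<close> with \<open>q < 1\<close>.\<close>

lemma AE_large_delay:
  assumes i: "i \<in> V"
  shows "AE \<omega> in paths. \<exists>k\<ge>n. 1 < \<omega> (i, k)"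
proof -
  interpret P: prob_space paths by (rule prob_paths)
  define q where "q = measure (exp_law (\<mu> i)) {..1}"
  interpret L: prob_space "exp_law (\<mu> i)" by (rule prob_space_exponential_density[OF \<mu>_pos[OF i]])
  have q: "0 \<le> q" "q < 1"
    unfolding q_def using exp_law_atMost_less_1[OF \<mu>_pos[OF i]] by (simp_all add: measure_nonneg)
  define B where "B = {\<omega> \<in> space paths. \<forall>k\<ge>n. \<omega> (i, k) \<le> 1}"
  have B: "B \<in> sets paths"
  proof -
    have "{\<omega> \<in> space paths. \<omega> (i, k) \<le> 1} \<in> sets paths" for k
      using i by (intro borel_measurable_le measurable_coord borel_measurable_const) auto
    then have "(\<Inter>k\<in>{n..}. {\<omega> \<in> space paths. \<omega> (i, k) \<le> 1}) \<in> sets paths"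
      by (intro sets.countable_INT') auto
    moreover have "(\<Inter>k\<in>{n..}. {\<omega> \<in> space paths. \<omega> (i, k) \<le> 1}) = B"
      by (auto simp: B_def)
    ultimately show ?thesis by simp
  qed
  have "P.prob B \<le> q ^ K" for K
  proof -
    let ?J = "{i} \<times> {n..<n + K}"
    have J: "?J \<subseteq> idx" "finite ?J" using i by auto
    have C: "prod_emb idx law ?J (Pi\<^sub>E ?J (\<lambda>_. {..1})) \<in> sets paths"
      unfolding paths_eq using J by (intro sets_PiM_I) auto
    have "B \<subseteq> prod_emb idx law ?J (Pi\<^sub>E ?J (\<lambda>_. {..1}))"
      unfolding prod_emb_Collect[OF J(1)] by (auto simp: B_def paths_eq)
    then have "emeasure paths B \<le> emeasure paths (prod_emb idx law ?J (Pi\<^sub>E ?J (\<lambda>_. {..1})))"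
      using C by (rule emeasure_mono)
    also have "\<dots> = (\<Prod>ik\<in>?J. emeasure (law ik) {..1})"
      unfolding paths_eq using J by (intro emeasure_PiM_emb prob_law) auto
    also have "\<dots> = (\<Prod>ik\<in>?J. ennreal q)"
      by (intro prod.cong) (auto simp: q_def L.emeasure_eq_measure)
    also have "\<dots> = ennreal (q ^ K)" using q by (simp add: ennreal_power)
    finally show ?thesis using q by (simp add: P.emeasure_eq_measure)
  qed
  moreover have "(\<lambda>K. q ^ K) \<longlonglongrightarrow> 0" using q by (intro LIMSEQ_realpow_zero)
  ultimately have "P.prob B \<le> 0" by (intro LIMSEQ_le_const[of "\<lambda>K. q ^ K"]) auto
  then have "AE \<omega> in paths. \<omega> \<notin> B" using P.prob_eq_0[OF B] measure_nonneg[of paths B] by simp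
  then show ?thesis using AE_space
    by eventually_elim (auto simp: B_def not_le)
qed

text \<open>Given all other coordinates, at most one value of the first interarrival time of class \<open>i\<close>
  makes the two arrival times equal.\<close>

lemma AE_no_simultaneous:
  assumes i: "i \<in> V" and j: "j \<in> V" and "i \<noteq> j"
  shows "AE \<omega> in paths. arrival_time \<omega> (i, k) \<noteq> arrival_time \<omega> (j, l)"
proof -
  define S where "S = {\<omega> \<in> space paths. arrival_time \<omega> (i, k) = arrival_time \<omega> (j, l)}"
  have S: "S \<in> sets paths" unfolding S_def using i j by measurable
  have "emeasure (exp_law (\<mu> i)) {s. X((i, 0) := s) \<in> S} = 0" for X
  proof -
    have Ti: "arrival_time (X((i, 0) := s)) (i, k) = s + arrival_time (X((i, 0) := 0)) (i, k)" for s
      by (induction k) (simp_all add: arrival_time_Suc)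
    have Tj: "arrival_time (X((i, 0) := s)) (j, l) = arrival_time (X((i, 0) := 0)) (j, l)" for s
      using \<open>i \<noteq> j\<close> by (simp add: arrival_time_def)
    define d where "d = arrival_time (X((i, 0) := 0)) (j, l) - arrival_time (X((i, 0) := 0)) (i, k)"
    have "s = d" if "X((i, 0) := s) \<in> S" for s
      using that Ti[of s] Tj[of s] by (simp add: S_def d_def)
    then have "{s. X((i, 0) := s) \<in> S} \<subseteq> {d}" by blast
    then have "emeasure (exp_law (\<mu> i)) {s. X((i, 0) := s) \<in> S} \<le> emeasure (exp_law (\<mu> i)) {d}"
      by (rule emeasure_mono) simp
    also have "\<dots> = 0"
      by (subst emeasure_density) (auto simp: nn_integral_indicator_singleton)
    finally show ?thesis by simp
  qed
  then have "emeasure paths S = 0"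
    unfolding paths_split(2)[OF i S] by simp
  then show ?thesis using S unfolding S_def by (subst AE_iff_measurable[OF _ refl]) auto
qed

lemma AE_regular_paths: "AE \<omega> in paths. \<omega> \<in> regular_paths"
proof -
  have "AE \<omega> in paths. \<forall>i\<in>V. \<forall>n. \<exists>k\<ge>n. 1 < \<omega> (i, k)"
    using countable_finite[OF finV] AE_large_delay
    by (intro AE_ball_countable') (simp_all add: AE_all_countable)
  moreover have "AE \<omega> in paths. \<forall>i\<in>V. \<forall>j\<in>V. i \<noteq> j \<longrightarrow>
      (\<forall>k l. arrival_time \<omega> (i, k) \<noteq> arrival_time \<omega> (j, l))"
  proof (intro AE_ball_countable' countable_finite[OF finV])
    fix i j assume ij: "i \<in> V" "j \<in> V"
    show "AE \<omega> in paths. i \<noteq> j \<longrightarrow> (\<forall>k l. arrival_time \<omega> (i, k) \<noteq> arrival_time \<omega> (j, l))"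
      using AE_no_simultaneous[OF ij] by (cases "i = j") (simp_all add: AE_all_countable)
  qed
  ultimately show ?thesis using AE_pos
  proof eventually_elim
    case (elim \<omega>)
    have pos: "0 < \<omega> (i, k)" if "i \<in> V" for i k using elim(3) that by blast
    have "inj_on (arrival_time \<omega>) idx"
    proof (rule inj_onI)
      fix ik jl assume "ik \<in> idx" "jl \<in> idx" and eq: "arrival_time \<omega> ik = arrival_time \<omega> jl"
      then obtain i k j l where ik: "ik = (i, k)" "jl = (j, l)" "i \<in> V" "j \<in> V" by auto
      then have "i = j" using elim(2) eq by blast
      moreover have "k = l"
        using strict_mono_eq[OF arrival_time_strict_mono[of \<omega> i, OF pos[OF ik(3)]], of k l] eq ik \<open>i = j\<close> by simp
      ultimately show "ik = jl" using ik by simp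
    qed
    moreover have "\<exists>k. t < arrival_time \<omega> (i, k)" if "i \<in> V" for i t
      using that elim(1) by (intro arrival_time_unbounded pos) auto
    ultimately show ?case using elim(3) by (auto simp: regular_paths_def)
  qed
qed

lemma measurable_next_class: "next_class \<in> paths \<rightarrow>\<^sub>M count_space V"
  unfolding measurable_count_space_eq_countable[OF countable_finite[OF finV]]
proof (intro conjI ballI)
  show "next_class \<in> space paths \<rightarrow> V" by (intro Pi_I next_class_in)
  fix a assume a: "a \<in> V"
  let ?d = "SOME a. a \<in> V"
  let ?R = "if a = ?d then space paths - (\<Union>b\<in>V. first_is b) else {}"
  have fst: "\<omega> \<in> space paths \<Longrightarrow> b \<in> V \<Longrightarrow> \<omega> \<in> first_is b \<Longrightarrow> next_class \<omega> = b" for \<omega> b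
    by (rule next_class_eq) (auto simp: first_is_def)
  have none: "next_class \<omega> = ?d" if "\<omega> \<in> space paths" "\<omega> \<notin> (\<Union>b\<in>V. first_is b)" for \<omega>
  proof -
    have "\<not> (\<exists>b\<in>V. \<forall>j\<in>V - {b}. \<omega> (b, 0) < \<omega> (j, 0))" using that by (auto simp: first_is_def)
    then show ?thesis unfolding next_class_def by (rule if_not_P)
  qed
  have "next_class -` {a} \<inter> space paths = first_is a \<union> ?R"
  proof (intro equalityI subsetI)
    fix \<omega> assume \<omega>: "\<omega> \<in> next_class -` {a} \<inter> space paths"
    show "\<omega> \<in> first_is a \<union> ?R"
    proof (cases "\<omega> \<in> (\<Union>b\<in>V. first_is b)")
      case True
      then obtain b where b: "b \<in> V" "\<omega> \<in> first_is b" by blast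
      then have "b = a" using \<omega> fst[of \<omega> b] by simp
      then show ?thesis using b by simp
    next
      case False
      then have "a = ?d" using none[of \<omega>] \<omega> by simp
      then show ?thesis using False \<omega> by simp
    qed
  next
    fix \<omega> assume \<omega>: "\<omega> \<in> first_is a \<union> ?R"
    show "\<omega> \<in> next_class -` {a} \<inter> space paths"
    proof (cases "\<omega> \<in> first_is a")
      case True
      then have "\<omega> \<in> space paths" by (simp add: first_is_def)
      then show ?thesis using fst[OF _ a True] by simp
    next
      case False
      then have "a = ?d" "\<omega> \<in> space paths" "\<omega> \<notin> (\<Union>b\<in>V. first_is b)" using \<omega> by (auto split: if_splits)
      then show ?thesis using none[of \<omega>] by simp
    qed
  qed
  moreover have "first_is a \<union> ?R \<in> sets paths"
    using a finV by (auto intro!: sets.Un sets.Diff sets.finite_UN measurable_first_is)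
  ultimately show "next_class -` {a} \<inter> space paths \<in> sets paths" by simp
qed

lemma measurable_next_delay: "next_delay \<in> borel_measurable paths"
  unfolding next_delay_def[abs_def]
  by (rule measurable_compose_countable'[OF _ measurable_next_class countable_finite[OF finV],
        where f = "\<lambda>a \<omega>. \<omega> (a, 0)"]) (auto intro: measurable_coord)

lemma measurable_remaining: "remaining \<in> paths \<rightarrow>\<^sub>M paths"
  unfolding remaining_def[abs_def]
  by (rule measurable_compose_countable'[OF _ measurable_next_class countable_finite[OF finV],
        where f = shift]) (rule measurable_shift)

text \<open>The first arrival is no later than the first arrival of any fixed class, whose mean is finite.\<close>

lemma mean_next_delay:
  "0 < (\<integral>\<^sup>+\<omega>. ennreal (next_delay \<omega>) \<partial>paths)" "(\<integral>\<^sup>+\<omega>. ennreal (next_delay \<omega>) \<partial>paths) < \<infinity>"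
proof -
  interpret P: prob_space paths by (rule prob_paths)
  note [measurable] = measurable_next_delay
  show "0 < (\<integral>\<^sup>+\<omega>. ennreal (next_delay \<omega>) \<partial>paths)"
  proof (rule ccontr)
    assume "\<not> ?thesis"
    then have "(\<integral>\<^sup>+\<omega>. ennreal (next_delay \<omega>) \<partial>paths) = 0" by simp
    then have "AE \<omega> in paths. ennreal (next_delay \<omega>) = 0"
      by (subst (asm) nn_integral_0_iff_AE) auto
    then have "AE \<omega> in paths. False"
      using AE_regular_paths by eventually_elim (auto simp: ennreal_eq_0_iff dest: next_delay_pos)
    then show False by simp
  qed
  obtain a where a: "a \<in> V" using V_ne by blast
  have "(\<integral>\<^sup>+\<omega>. ennreal (next_delay \<omega>) \<partial>paths) \<le> (\<integral>\<^sup>+\<omega>. ennreal (\<omega> (a, 0)) \<partial>paths)"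
    using AE_regular_paths
    by (intro nn_integral_mono_AE, eventually_elim) (use a next_delay_le_arrival[of _ "(a, 0)"] in \<open>auto intro!: ennreal_leI\<close>)
  also have "\<dots> = (\<integral>\<^sup>+s. ennreal s \<partial>distr paths (law (a, 0)) (\<lambda>\<omega>. \<omega> (a, 0)))"
    using a by (intro nn_integral_distr[symmetric]) (auto simp: measurable_cong_sets[OF refl sets_law] intro: measurable_coord)
  also have "distr paths (law (a, 0)) (\<lambda>\<omega>. \<omega> (a, 0)) = law (a, 0)"
    unfolding paths_eq using a by (intro distr_PiM_component prob_law) auto
  also have "(\<integral>\<^sup>+s. ennreal s \<partial>law (a, 0)) = (\<integral>\<^sup>+s. ennreal (exponential_density (\<mu> a) s * s ^ 1) \<partial>lborel)"
    using \<mu>_pos[OF a]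
    by (subst nn_integral_density) (auto simp: ennreal_mult' exponential_density_nonneg)
  also have "\<dots> < \<infinity>"
    using nn_integral_erlang_ith_moment[OF \<mu>_pos[OF a], of 0 1] by (simp add: ennreal_less_top)
  finally show "(\<integral>\<^sup>+\<omega>. ennreal (next_delay \<omega>) \<partial>paths) < \<infinity>" .
qed

lemma fcfm_stable_ct_iff:
  assumes model: "fcfm_model V E p" and p: "\<And>a. a \<in> V \<Longrightarrow> p a = \<mu> a / sum \<mu> V"
  shows "fcfm_stable_ct V E \<mu> \<longleftrightarrow> fcfm_model.finite_returns V E p"
proof -
  interpret fcfm_model V E p by fact
  interpret P: prob_space paths by (rule prob_paths)
  interpret arrival_process V E p paths next_class "\<lambda>\<omega>. ennreal (next_delay \<omega>)" remaining regular_paths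
  proof
    show "{\<omega> \<in> space paths. next_class \<omega> = a} \<in> sets paths" if "a \<in> V" for a
    proof -
      have "next_class -` {a} \<inter> space paths \<in> sets paths"
        using that by (intro measurable_sets[OF measurable_next_class]) auto
      moreover have "next_class -` {a} \<inter> space paths = {\<omega> \<in> space paths. next_class \<omega> = a}" by auto
      ultimately show ?thesis by simp
    qed
    show "(\<lambda>\<omega>. ennreal (next_delay \<omega>)) \<in> borel_measurable paths"
      using measurable_next_delay by measurable
    show "remaining \<in> paths \<rightarrow>\<^sub>M paths" by (rule measurable_remaining)
    show "AE \<omega> in paths. \<omega> \<in> regular_paths" by (rule AE_regular_paths)
    show "(\<integral>\<^sup>+\<omega>. indicator {a} (next_class \<omega>) * f (remaining \<omega>) \<partial>paths) = ennreal (p a) * (\<integral>\<^sup>+\<omega>. f \<omega> \<partial>paths)"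
      if a: "a \<in> V" and f: "f \<in> borel_measurable paths" for a and f :: "_ \<Rightarrow> ennreal"
    proof -
      have "(\<integral>\<^sup>+\<omega>. indicator {a} (next_class \<omega>) * f (remaining \<omega>) \<partial>paths) =
          (\<integral>\<^sup>+\<omega>. indicator (first_is a) \<omega> * f (shift a \<omega>) \<partial>paths)"
      proof (intro nn_integral_cong_AE)
        show "AE \<omega> in paths. indicator {a} (next_class \<omega>) * f (remaining \<omega>) =
            indicator (first_is a) \<omega> * f (shift a \<omega>)"
          using AE_regular_paths AE_space
        proof eventually_elim
          case (elim \<omega>)
          have "next_class \<omega> = a \<longleftrightarrow> \<omega> \<in> first_is a"
            using next_class_regular[OF elim(1)] next_class_eq[OF a] elim(2) by (auto simp: first_is_def)
          then show ?case by (auto simp: indicator_def remaining_def)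
        qed
      qed
      then show ?thesis using regenerate_shift[OF a f] p[OF a] by simp
    qed
  qed (rule next_class_in mean_next_delay | erule remaining_regular no_explosion_path)+
  have "(\<integral>\<^sup>+\<omega>. (INF t\<in>{t. fcfm_process V E x t \<omega> = x \<and>
        (\<exists>s. 0 \<le> s \<and> s < t \<and> fcfm_process V E x s \<omega> \<noteq> x)}. ennreal t) \<partial>paths) < \<infinity> \<longleftrightarrow>
      (\<exists>K. \<forall>n. (\<Sum>a\<in>V. p a * hit x n (fcfm_step E x a)) \<le> K)" for x
  proof (rule mean_return_finite_iff[where D = "\<lambda>z \<omega>. INF t\<in>{t. 0 \<le> t \<and> fcfm_process V E z t \<omega> = x}. ennreal t"])
    show "(INF t\<in>{t. 0 \<le> t \<and> fcfm_process V E x t \<omega> = x}. ennreal t) = 0" if "\<omega> \<in> regular_paths" for \<omega>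
      using fcfm_process_0[OF that] by (intro antisym INF_lower2[of 0]) auto
  qed (erule (1) first_visit_rec | erule first_return_rec)+
  then show ?thesis
    unfolding fcfm_stable_ct_def positive_recurrent_ct_def finite_returns_def by simp
qed

end

section \<open>Equivalence of the stability conditions\<close>

theorem theorem1:
  fixes V :: "'a set" and E :: "('a \<times> 'a) set" and \<mu> :: "'a \<Rightarrow> real"
  assumes "connected_multigraph V E"
    and "2 \<le> card V"
    and "\<not> bipartite_graph V E"
    and "full_support_measure V \<mu>"
  defines "i \<equiv> \<exists>P. random_walk_on_edges V E P \<and> reversible V P \<and> invariant_measure V P \<mu>"
    and "ii \<equiv> \<exists>\<alpha>. edge_weights E \<alpha> \<and> (\<forall>k\<in>V. \<mu> k = weighted_measure E \<alpha> k)"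
    and "iii \<equiv> \<forall>U. U \<subseteq> V \<and> U \<noteq> {} \<and> U \<noteq> V \<longrightarrow> sum \<mu> U < sum \<mu> (E `` U)"
    and "iv \<equiv> \<forall>I. independent_set V E I \<longrightarrow> sum \<mu> I < sum \<mu> (E `` I)"
    and "v \<equiv> normalized V \<mu> \<in> fcfm_stab V E"
    and "vi \<equiv> fcfm_stable_ct V E \<mu>"
  shows "(i \<longleftrightarrow> ii) \<and> (ii \<longleftrightarrow> iii) \<and> (iii \<longleftrightarrow> iv) \<and> (iv \<longleftrightarrow> v) \<and> (v \<longleftrightarrow> vi)"
proof -
  have con: "connected_multigraph V E" and card: "2 \<le> card V" by fact+
  have pos: "\<forall>k\<in>V. 0 < \<mu> k" using assms(4) by (simp add: full_support_measure_def)
  have fin: "finite V" and sub: "E \<subseteq> V \<times> V" using multigraphD[OF con] by auto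
  have ne: "V \<noteq> {}" using card by auto
  define m where "m = sum \<mu> V"
  have m: "0 < m" unfolding m_def using fin ne pos by (intro sum_pos) auto
  define p where "p = pmf (normalized V \<mu>)"
  have p: "p k = (if k \<in> V then \<mu> k / m else 0)" for k
    unfolding p_def normalized_def m_def[symmetric]
  proof (rule pmf_embed_pmf)
    show "0 \<le> (if k \<in> V then \<mu> k / m else 0)" for k using pos m by (auto intro: less_imp_le)
    have "(\<integral>\<^sup>+k. ennreal (if k \<in> V then \<mu> k / m else 0) \<partial>count_space UNIV) = (\<Sum>k\<in>V. ennreal (\<mu> k / m))"
      by (subst nn_integral_count_space'[OF fin]) auto
    also have "\<dots> = ennreal (\<Sum>k\<in>V. \<mu> k / m)"
      using pos m by (intro sum_ennreal) (auto intro: less_imp_le)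
    also have "(\<Sum>k\<in>V. \<mu> k / m) = 1" using m by (simp add: sum_divide_distrib[symmetric] m_def)
    finally show "(\<integral>\<^sup>+k. ennreal (if k \<in> V then \<mu> k / m else 0) \<partial>count_space UNIV) = 1" by simp
  qed
  have supp: "set_pmf (normalized V \<mu>) = V"
    using p pos m unfolding p_def set_pmf_eq by (auto simp: less_imp_neq[symmetric])
  have sum_scaled: "sum p U = sum \<mu> U / m" if "U \<subseteq> V" for U
    unfolding sum_divide_distrib using that p by (intro sum.cong) auto
  interpret fcfm_model V E p
    using con card p pos m sum_scaled[of V] by unfold_locales (auto simp: m_def)
  interpret poisson_arrivals V \<mu>
    using fin ne pos by unfold_locales auto
  have iv: "iv \<longleftrightarrow> expanding"
  proof -
    have "sum p I < sum p (E `` I) \<longleftrightarrow> sum \<mu> I < sum \<mu> (E `` I)" if "independent_set V E I" for I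
      using that m sum_scaled[of I] sum_scaled[OF nbr_subset[of I]]
      by (simp add: independent_set_def divide_less_cancel)
    then show ?thesis unfolding iv_def expanding_def by blast
  qed
  have "i \<longleftrightarrow> ii"
    unfolding i_def ii_def by (rule reversible_walk_iff_weighted[OF con ne pos])
  moreover have "ii \<Longrightarrow> iii"
    unfolding ii_def iii_def using expansion_of_weighted_measure[OF con card assms(3)] by blast
  moreover have "iii \<longleftrightarrow> iv"
    unfolding iii_def iv_def by (rule expansion_iff_independent_expansion[OF con card pos])
  moreover have "expanding \<Longrightarrow> ii"
  proof -
    assume expanding
    then obtain \<alpha> where \<alpha>: "edge_weights E \<alpha>" "\<And>k. k \<in> V \<Longrightarrow> p k = weighted_measure E \<alpha> k"
      using weights_if_expansion by blast
    have "edge_weights E (\<lambda>j k. m * \<alpha> j k)"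
      using \<alpha>(1) m by (auto simp: edge_weights_def)
    moreover have "\<mu> k = weighted_measure E (\<lambda>j k. m * \<alpha> j k) k" if "k \<in> V" for k
    proof -
      have "\<mu> k = m * p k" using that m by (simp add: p)
      then show ?thesis using \<alpha>(2)[OF that] by (simp add: weighted_measure_def sum_distrib_left)
    qed
    ultimately show ii unfolding ii_def by blast
  qed
  moreover have returns: "expanding \<longleftrightarrow> finite_returns"
    using finite_returns_if_expansion expansion_if_finite_returns by blast
  moreover have "v \<longleftrightarrow> finite_returns"
    using fcfm_stable_iff[of V E "normalized V \<mu>"] supp fcfm_model_axioms
    unfolding v_def fcfm_stab_def p_def by simp
  moreover have "vi \<longleftrightarrow> finite_returns"
    unfolding vi_def by (rule fcfm_stable_ct_iff[OF fcfm_model_axioms]) (simp add: p m_def)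
  ultimately show ?thesis using iv by blast
qed

end
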